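(* Let $T>0$ and let $v(t)=(v_k(t))_{1\le k\le n}$, $t\in[0,T)$, satisfy $v(t)\in\mathrm{Vect}(\mathcal{C}^{sa}_{\infty,1})\cap\mathrm{Vect}(L^1_{sa}(M,\tau)\mid\tau)$ for all $t$. Assume that $v$ is differentiable as a $\mathrm{Vect}(L^1(M,\tau))$-valued function of $t\in[0,T)$ and satisfies the free Euler equations in the form with pressure term, that is $$-\dot v(t)=(\mathcal{D}_{v(t)}v_k(t))_{1\le k\le n}+q(t),\qquad t\in[0,T),$$ where $q(t)\in\mathrm{Vect}(L^1_{sa}(M,\tau))$ is continuous as a function of $t$ and $\Pi_kq(t)=0$ for all $k\ge0$. Let $\Omega(t)=i\sum_{1\le j\le n}[s_j,v_j(t)]$ be the cyclic vorticity of $v(t)$. Then for every integer $m>0$, $\tau(\Omega^m(t))$ is constant in $t\in[0,T)$.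
   Context: Let $n$ be a positive integer and let $(M,\tau)$ be the von Neumann algebra $W^*(s_1,\dots,s_n)$ generated by a semicircular system $s_1,\dots,s_n$ (self-adjoint, freely independent, each with the $(0,1)$ semicircle distribution) with its normal faithful trace state $\tau$. $\mathbb{C}_{\langle n\rangle}\subset M$ is the $*$-algebra of non-commutative polynomials in $s_1,\dots,s_n$. Cyclic derivatives: $\delta_j(s_{i_1}\cdots s_{i_m})=\sum_{k:\,i_k=j}s_{i_{k+1}}\cdots s_{i_m}s_{i_1}\cdots s_{i_{k-1}}$. For a space $\mathcal{E}$, $\mathrm{Vect}\,\mathcal{E}=\mathcal{E}^n$; the superscript or subscript $sa$ denotes the self-adjoint part (componentwise for vector fields). Fock space: $\mathcal{T}(\mathbb{C}^n)=\bigoplus_{k\ge0}(\mathbb{C}^n)^{\otimes k}$ with vacuum vector $1$ and $e_1,\dots,e_n$ the standard orthonormal basis; $l_j\xi=e_j\otimes\xi$, $r_j\xi=\xi\otimes e_j$. One realizes $s_j=l_j+l_j^*$ with $\tau$ the vacuum state, and identifies $L^2(M,\tau)\simeq\mathcal{T}(\mathbb{C}^n)$ via $a\mapsto a1$; each $(\mathbb{C}^n)^{\otimes k}$ then corresponds to a finite-dimensional subspace of $\mathbb{C}_{\langle n\rangle}$. $\mathcal{J}$ is the antiunitary operator $\xi\mapsto\xi^*$ of $L^2(M,\tau)$. Projections: for $\xi\in L^1(M,\tau)$ its component $\xi_k\in(\mathbb{C}^n)^{\otimes k}$ is determined by $\tau(\xi_k\eta)=\tau(\xi\eta)$ for all $\eta\in(\mathbb{C}^n)^{\otimes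 k}\subset M$, and $Q_k:\mathrm{Vect}\,L^1(M,\tau)\to((\mathbb{C}^n)^{\otimes k})^n$ takes the $k$-th component of each entry. Put $\mathcal{X}_k=\{((l_j^*-r_j^* )\xi)_{1\le j\le n}:\xi\in(\mathbb{C}^n)^{\otimes(k+1)}\}\subset((\mathbb{C}^n)^{\otimes k})^n$. $\Pi_k$ is the projection of $\mathrm{Vect}\,L^1(M,\tau)$ onto $\mathcal{X}_k$ obtained by composing $Q_k$ with the orthogonal projection of $((\mathbb{C}^n)^{\otimes k})^n$ onto $\mathcal{X}_k$. Divergence-free fields: $\mathrm{Vect}(L^1(M,\tau)\mid\tau)$ is the set of $\xi=(\xi_j)\in\mathrm{Vect}\,L^1(M,\tau)$ with $\sum_j\tau(\xi_j\,\delta_jR)=0$ for all $R\in\mathbb{C}_{\langle n\rangle}$; $\mathrm{Vect}(L^1_{sa}(M,\tau)\mid\tau)$ is the subset with all $\xi_j=\xi_j^*$. Smooth algebras: with $a\in M$ acting on $L^2(M,\tau)$ by left multiplication, $$\mathcal{B}_{\infty,1}=\{a\in M:[a,r_j-r_j^*]\text{ is trace class},\ 1\le j\le n\},$$ a Banach algebra with norm $|||a|||=\|a\|+\max_{1\le j\le n}\|[a,r_j-r_j^*]\|_1$ ($\|\cdot\|_1$ the trace norm). $\mathcal{C}_{\infty,1}$ is the closure of $\mathbb{C}_{\langle n\rangle}$ in $\mathcal{B}_{\infty,1}$ for this norm. Derivation: $\Phi$ is the contractive linear map from trace-class operators on $L^2(M,\tau)$ to $L^1(M,\tau)$ determined by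 $\mathrm{Tr}(Xa)=\tau(\Phi(X)a)$ for all $a\in M$. With $R_b$ right multiplication by $b\in M$ on $L^2(M,\tau)$, for $b=(b_j)\in M^n$ one sets $$\mathcal{D}_b(a)=\Phi\Big(2^{-1}\sum_{1\le j\le n}R_{b_j}[a,r_j-r_j^*]\Big)\in L^1(M,\tau),\qquad a\in\mathcal{B}_{\infty,1};$$ it extends the derivation of $\mathbb{C}_{\langle n\rangle}$ into $M$ that maps $s_j$ to $b_j$. *)

theory Defs
  imports "HOL-Analysis.Analysis" "HOL-Library.Poly_Mapping"
begin

section \<open>Complex scalars and the Hilbert space of square summable families\<close>

class complex_vector = real_vector +
  fixes scaleC :: "complex \<Rightarrow> 'a \<Rightarrow> 'a" (infixr \<open>*\<^sub>C\<close> 75)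
  assumes scaleC_add_right: "c *\<^sub>C (x + y) = c *\<^sub>C x + c *\<^sub>C y"
    and scaleC_add_left: "(c + d) *\<^sub>C x = c *\<^sub>C x + d *\<^sub>C x"
    and scaleC_scaleC: "c *\<^sub>C d *\<^sub>C x = (c * d) *\<^sub>C x"
    and scaleC_one: "1 *\<^sub>C x = x"
    and scaleR_scaleC: "r *\<^sub>R x = complex_of_real r *\<^sub>C x"

definition square_summable :: "('a \<Rightarrow> complex) \<Rightarrow> bool" where
  "square_summable f \<longleftrightarrow> (\<lambda>i. (cmod (f i))\<^sup>2) summable_on UNIV"

lemma square_summable_zero: "square_summable (\<lambda>_. 0)"
  by (simp add: square_summable_def)

lemma square_summable_add:
  assumes "square_summable f" "square_summable g"
  shows "square_summable (\<lambda>i. f i + g i)"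
proof -
  have *: "(cmod (f i + g i))\<^sup>2 \<le> 2 * (cmod (f i))\<^sup>2 + 2 * (cmod (g i))\<^sup>2" for i
  proof -
    have "(cmod (f i + g i))\<^sup>2 \<le> (cmod (f i) + cmod (g i))\<^sup>2"
      by (intro power_mono norm_triangle_ineq) auto
    also have "\<dots> \<le> 2 * (cmod (f i))\<^sup>2 + 2 * (cmod (g i))\<^sup>2"
      using sum_squares_bound[of "cmod (f i)" "cmod (g i)"] by (simp add: power2_sum)
    finally show ?thesis .
  qed
  have "(\<lambda>i. 2 * (cmod (f i))\<^sup>2 + 2 * (cmod (g i))\<^sup>2) summable_on UNIV"
    using assms unfolding square_summable_def
    by (intro summable_on_add summable_on_cmult_right)
  then show ?thesis
    unfolding square_summable_def by (rule summable_on_comparison_test) (use * in auto)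
qed

lemma square_summable_scale:
  assumes "square_summable f"
  shows "square_summable (\<lambda>i. c * f i)"
  using assms unfolding square_summable_def
  by (simp add: norm_mult power_mult_distrib summable_on_cmult_right)

lemma square_summable_uminus:
  assumes "square_summable f"
  shows "square_summable (\<lambda>i. - f i)"
  using assms unfolding square_summable_def by simp

lemma square_summable_diff:
  assumes "square_summable f" "square_summable g"
  shows "square_summable (\<lambda>i. f i - g i)"
  using square_summable_add[OF assms(1) square_summable_uminus[OF assms(2)]] by simp

lemma square_summable_product:
  assumes "square_summable f" "square_summable g"
  shows "(\<lambda>i. f i * cnj (g i)) summable_on UNIV"
proof (rule abs_summable_summable, rule summable_on_comparison_test)
  show "(\<lambda>i. (cmod (f i))\<^sup>2 + (cmod (g i))\<^sup>2) summable_on UNIV"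
    using assms unfolding square_summable_def by (intro summable_on_add)
  show "norm (f i * cnj (g i)) \<le> (cmod (f i))\<^sup>2 + (cmod (g i))\<^sup>2" for i
  proof -
    have "2 * (cmod (f i) * cmod (g i)) \<le> (cmod (f i))\<^sup>2 + (cmod (g i))\<^sup>2"
      using sum_squares_bound[of "cmod (f i)" "cmod (g i)"] by (simp add: mult.assoc)
    moreover have "0 \<le> cmod (f i) * cmod (g i)" by simp
    ultimately show ?thesis unfolding norm_mult complex_mod_cnj by linarith
  qed
qed auto

lemma square_summable_transport:
  fixes p :: "'a \<Rightarrow> 'b"
  assumes "inj p" "\<And>a. g (p a) = f a" "\<And>b. b \<notin> range p \<Longrightarrow> g b = 0"
    and "square_summable f"
  shows "square_summable g"
    and "(\<Sum>\<^sub>\<infinity>b. (cmod (g b))\<^sup>2) = (\<Sum>\<^sub>\<infinity>a. (cmod (f a))\<^sup>2)"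
proof -
  have eq: "(\<lambda>b. (cmod (g b))\<^sup>2) \<circ> p = (\<lambda>a. (cmod (f a))\<^sup>2)"
    using assms(2) by auto
  have "(\<lambda>b. (cmod (g b))\<^sup>2) summable_on range p"
    using assms(4) summable_on_reindex[OF assms(1), of "\<lambda>b. (cmod (g b))\<^sup>2"]
    by (simp add: eq square_summable_def)
  moreover have "(\<lambda>b. (cmod (g b))\<^sup>2) summable_on range p \<longleftrightarrow>
      (\<lambda>b. (cmod (g b))\<^sup>2) summable_on UNIV"
    by (rule summable_on_cong_neutral) (use assms(3) in auto)
  ultimately show "square_summable g" by (simp add: square_summable_def)
  have "(\<Sum>\<^sub>\<infinity>b. (cmod (g b))\<^sup>2) = (\<Sum>\<^sub>\<infinity>b\<in>range p. (cmod (g b))\<^sup>2)"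
    by (rule infsum_cong_neutral) (use assms(3) in auto)
  also have "\<dots> = (\<Sum>\<^sub>\<infinity>a. (cmod (f a))\<^sup>2)"
    using infsum_reindex[OF assms(1), of "\<lambda>b. (cmod (g b))\<^sup>2"] by (simp add: eq)
  finally show "(\<Sum>\<^sub>\<infinity>b. (cmod (g b))\<^sup>2) = (\<Sum>\<^sub>\<infinity>a. (cmod (f a))\<^sup>2)" .
qed

typedef 'a ell2 = "{f :: 'a \<Rightarrow> complex. square_summable f}"
  morphisms coord Abs_ell2
  using square_summable_zero by blast

setup_lifting type_definition_ell2

instantiation ell2 :: (type) complex_vector
begin

lift_definition zero_ell2 :: "'a ell2" is "\<lambda>_. 0" by (rule square_summable_zero)
lift_definition plus_ell2 :: "'a ell2 \<Rightarrow> 'a ell2 \<Rightarrow> 'a ell2" is "\<lambda>f g i. f i + g i"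
  by (rule square_summable_add)
lift_definition minus_ell2 :: "'a ell2 \<Rightarrow> 'a ell2 \<Rightarrow> 'a ell2" is "\<lambda>f g i. f i - g i"
  by (rule square_summable_diff)
lift_definition uminus_ell2 :: "'a ell2 \<Rightarrow> 'a ell2" is "\<lambda>f i. - f i"
  by (rule square_summable_uminus)
lift_definition scaleC_ell2 :: "complex \<Rightarrow> 'a ell2 \<Rightarrow> 'a ell2" is "\<lambda>c f i. c * f i"
  by (rule square_summable_scale)
definition scaleR_ell2 :: "real \<Rightarrow> 'a ell2 \<Rightarrow> 'a ell2" where
  "scaleR_ell2 r x = complex_of_real r *\<^sub>C x"

instance
  by standard (unfold scaleR_ell2_def, (transfer; auto simp: algebra_simps)+)

end

text \<open>The inner product is linear in the first and antilinear in the second variable.\<close>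

lift_definition cinner :: "'a ell2 \<Rightarrow> 'a ell2 \<Rightarrow> complex"
  is "\<lambda>f g. \<Sum>\<^sub>\<infinity>i. f i * cnj (g i)" .

lemma cinner_commute: "cinner x y = cnj (cinner y x)"
  by transfer (simp add: mult.commute flip: infsum_cnj)

lemma cinner_add_left: "cinner (x + y) z = cinner x z + cinner y z"
  by transfer (simp add: distrib_right infsum_add square_summable_product)

lemma cinner_scaleC_left: "cinner (c *\<^sub>C x) y = c * cinner x y"
  by transfer (simp add: mult.assoc infsum_cmult_right')

lemma cinner_self: "cinner x x = complex_of_real (\<Sum>\<^sub>\<infinity>i. (cmod (coord x i))\<^sup>2)"
proof transfer
  fix f :: "'a \<Rightarrow> complex"
  assume "square_summable f"
  then have "((\<lambda>i. (cmod (f i))\<^sup>2) has_sum (\<Sum>\<^sub>\<infinity>i. (cmod (f i))\<^sup>2)) UNIV"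
    unfolding square_summable_def by (rule has_sum_infsum)
  then have "((\<lambda>i. complex_of_real ((cmod (f i))\<^sup>2)) has_sum
      complex_of_real (\<Sum>\<^sub>\<infinity>i. (cmod (f i))\<^sup>2)) UNIV"
    by (simp only: has_sum_of_real_iff)
  then show "(\<Sum>\<^sub>\<infinity>i. f i * cnj (f i)) = complex_of_real (\<Sum>\<^sub>\<infinity>i. (cmod (f i))\<^sup>2)"
    unfolding complex_norm_square by (rule infsumI)
qed

instantiation ell2 :: (type) real_inner
begin

definition inner_ell2 :: "'a ell2 \<Rightarrow> 'a ell2 \<Rightarrow> real" where
  "inner_ell2 x y = Re (cinner x y)"
definition norm_ell2 :: "'a ell2 \<Rightarrow> real" where
  "norm_ell2 x = sqrt (inner x x)"
definition dist_ell2 :: "'a ell2 \<Rightarrow> 'a ell2 \<Rightarrow> real" where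
  "dist_ell2 x y = norm (x - y)"
definition sgn_ell2 :: "'a ell2 \<Rightarrow> 'a ell2" where
  "sgn_ell2 x = inverse (norm x) *\<^sub>R x"
definition uniformity_ell2 :: "('a ell2 \<times> 'a ell2) filter" where
  "uniformity_ell2 = (INF e\<in>{0<..}. principal {(x, y). dist x y < e})"
definition open_ell2 :: "'a ell2 set \<Rightarrow> bool" where
  "open_ell2 U \<longleftrightarrow> (\<forall>x\<in>U. eventually (\<lambda>(x', y). x' = x \<longrightarrow> y \<in> U) uniformity)"

instance
proof
  fix x y z :: "'a ell2" and r :: real
  show "inner x y = inner y x"
    unfolding inner_ell2_def by (subst cinner_commute) simp
  show "inner (x + y) z = inner x z + inner y z"
    by (simp add: inner_ell2_def cinner_add_left)
  show "inner (r *\<^sub>R x) y = r * inner x y"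
    by (simp add: inner_ell2_def scaleR_ell2_def cinner_scaleC_left)
  show "0 \<le> inner x x"
    by (simp add: inner_ell2_def cinner_self infsum_nonneg)
  show "(inner x x = 0) \<longleftrightarrow> x = 0"
  proof
    assume "inner x x = 0"
    then have 0: "(\<Sum>\<^sub>\<infinity>i. (cmod (coord x i))\<^sup>2) = 0" by (simp add: inner_ell2_def cinner_self)
    have s: "(\<lambda>i. (cmod (coord x i))\<^sup>2) summable_on UNIV"
      using coord[of x] by (simp add: square_summable_def)
    have "coord x i = 0" for i
      using nonneg_infsum_le_0D[of "\<lambda>i. (cmod (coord x i))\<^sup>2" UNIV i] 0 s by simp
    then show "x = 0" by (intro coord_inject[THEN iffD1] ext) (simp add: zero_ell2.rep_eq)
  next
    assume "x = 0"
    then show "inner x x = 0" by (simp add: inner_ell2_def cinner_self zero_ell2.rep_eq)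
  qed
  show "norm x = sqrt (inner x x)" by (rule norm_ell2_def)
qed (simp_all only: dist_ell2_def sgn_ell2_def uniformity_ell2_def open_ell2_def)

end

lemma norm_ell2_sum: "norm x = sqrt (\<Sum>\<^sub>\<infinity>i. (cmod (coord x i))\<^sup>2)"
  by (simp add: norm_ell2_def inner_ell2_def cinner_self)

lemma norm_scaleC_ell2: "norm (c *\<^sub>C x) = cmod c * norm (x :: 'a ell2)"
  by (simp add: norm_ell2_sum scaleC_ell2.rep_eq norm_mult power_mult_distrib
      infsum_cmult_right' real_sqrt_mult)

lemma cmod_cinner_le: "cmod (cinner x y) \<le> norm x * norm y"
proof (cases "cinner x y = 0")
  case False
  define z where "z = cinner x y"
  define u where "u = cnj z / cmod z"
  have z: "cmod z \<noteq> 0" using False by (simp add: z_def)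
  then have u: "cmod u = 1" by (simp add: u_def norm_divide)
  have "u * z = z * cnj z / cmod z" by (simp add: u_def)
  also have "\<dots> = complex_of_real (cmod z)"
    using z by (simp add: power2_eq_square flip: complex_norm_square)
  finally have "u * cinner x y = complex_of_real (cmod (cinner x y))" by (simp only: z_def)
  then have "cmod (cinner x y) = inner (u *\<^sub>C x) y"
    by (simp add: inner_ell2_def cinner_scaleC_left)
  also have "\<dots> \<le> norm (u *\<^sub>C x) * norm y" by (rule norm_cauchy_schwarz)
  finally show ?thesis by (simp add: norm_scaleC_ell2 u)
qed simp

lift_definition ket :: "'a \<Rightarrow> 'a ell2" is "\<lambda>a i. if i = a then 1 else 0"
proof -
  fix a :: 'a
  have "(\<lambda>i. (cmod (if i = a then 1 else 0))\<^sup>2) summable_on UNIV \<longleftrightarrow>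
      (\<lambda>i. (cmod (if i = a then 1 else 0))\<^sup>2) summable_on {a}"
    by (rule summable_on_cong_neutral) auto
  then show "square_summable (\<lambda>i. if i = a then 1 else 0)"
    by (simp add: square_summable_def)
qed

lemma ket_nonzero: "ket a \<noteq> 0"
  by transfer (metis one_neq_zero)


lemma scaleC_zero_ell2: "c *\<^sub>C (0 :: 'a ell2) = 0"
  by transfer simp

lemma scaleC_diff_ell2: "c *\<^sub>C (x - y :: 'a ell2) = c *\<^sub>C x - c *\<^sub>C y"
  by transfer (simp add: algebra_simps)

lemma scaleC_uminus_ell2: "c *\<^sub>C (- x :: 'a ell2) = - (c *\<^sub>C x)"
  by transfer simp

lemma scaleC_scaleR_ell2: "c *\<^sub>C r *\<^sub>R x = r *\<^sub>R c *\<^sub>C (x :: 'a ell2)"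
  by (simp add: scaleR_scaleC scaleC_scaleC mult.commute)

lemma scaleC_commute_ell2: "c *\<^sub>C d *\<^sub>C x = d *\<^sub>C c *\<^sub>C (x :: 'a ell2)"
  by (simp add: scaleC_scaleC mult.commute)

lemma bounded_linear_scaleC_ell2: "bounded_linear (\<lambda>x :: 'a ell2. c *\<^sub>C x)"
  by (rule bounded_linear_intro[where K = "cmod c"])
    (auto simp: scaleC_add_right scaleC_scaleR_ell2 norm_scaleC_ell2)


section \<open>The full Fock space\<close>

text \<open>With \<open>CARD('n) = n\<close>, the full Fock space of \<open>\<complex>\<^sup>n\<close> is \<open>\<ell>\<^sup>2\<close> of the words in the alphabet
  \<open>'n\<close>; \<open>ket [i\<^sub>1, \<dots>, i\<^sub>m]\<close> is \<open>e\<^bsub>i\<^sub>1\<^esub> \<otimes> \<dots> \<otimes> e\<^bsub>i\<^sub>m\<^esub>\<close>.\<close>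

type_synonym 'n fock = "'n list ell2"

abbreviation vacuum :: "'n fock" where
  "vacuum \<equiv> ket []"

definition tensor_power :: "nat \<Rightarrow> 'n fock set" where
  "tensor_power k = {\<xi>. \<forall>w. length w \<noteq> k \<longrightarrow> coord \<xi> w = 0}"

lift_definition left_creation_fun :: "'n \<Rightarrow> 'n fock \<Rightarrow> 'n fock"
  is "\<lambda>j f w. case w of [] \<Rightarrow> 0 | i # u \<Rightarrow> if i = j then f u else 0"
  subgoal for j f
    by (rule square_summable_transport(1)[of "(#) j" _ f])
      (auto split: list.splits)
  done

lift_definition right_creation_fun :: "'n \<Rightarrow> 'n fock \<Rightarrow> 'n fock"
  is "\<lambda>j f w. if w \<noteq> [] \<and> last w = j then f (butlast w) else 0"
  subgoal for j f
    by (rule square_summable_transport(1)[of "\<lambda>w. w @ [j]" _ f])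
      (auto simp: inj_on_def image_iff, metis append_butlast_last_id)
  done

lemma norm_left_creation_fun: "norm (left_creation_fun j x) = norm x"
  unfolding norm_ell2_sum left_creation_fun.rep_eq
  by (subst square_summable_transport(2)[of "(#) j" _ "coord x"])
    (use coord[of x] in \<open>auto split: list.splits\<close>)

lemma norm_right_creation_fun: "norm (right_creation_fun j x) = norm x"
  unfolding norm_ell2_sum right_creation_fun.rep_eq
  by (subst square_summable_transport(2)[of "\<lambda>w. w @ [j]" _ "coord x"])
    (use coord[of x] in \<open>auto simp: inj_on_def image_iff, metis append_butlast_last_id\<close>)

lemma left_creation_fun_add: "left_creation_fun j (x + y) = left_creation_fun j x + left_creation_fun j y"
  by transfer (auto split: list.splits)

lemma left_creation_fun_scaleC: "left_creation_fun j (c *\<^sub>C x) = c *\<^sub>C left_creation_fun j x"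
  by transfer (auto split: list.splits)

lemma right_creation_fun_add: "right_creation_fun j (x + y) = right_creation_fun j x + right_creation_fun j y"
  by transfer auto

lemma right_creation_fun_scaleC: "right_creation_fun j (c *\<^sub>C x) = c *\<^sub>C right_creation_fun j x"
  by transfer auto


lifting_forget ell2.lifting


section \<open>Bounded operators on \<open>\<ell>\<^sup>2\<close>, trace class\<close>

typedef 'a cop = "{T :: 'a ell2 \<Rightarrow>\<^sub>L 'a ell2. \<forall>c x. blinfun_apply T (c *\<^sub>C x) = c *\<^sub>C blinfun_apply T x}"
  morphisms blinfun_of_cop Abs_cop
  by (rule exI[of _ 0]) (auto intro!: coord_inject[THEN iffD1] simp: scaleC_ell2.rep_eq zero_ell2.rep_eq)

setup_lifting type_definition_cop

lift_definition cop_apply :: "'a cop \<Rightarrow> 'a ell2 \<Rightarrow> 'a ell2" (infixr \<open>\<cdot>\<close> 85)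
  is blinfun_apply .

lift_definition scaleC_blinfun :: "complex \<Rightarrow> 'a ell2 \<Rightarrow>\<^sub>L 'a ell2" is "\<lambda>c x. c *\<^sub>C x"
  by (rule bounded_linear_scaleC_ell2)

instantiation cop :: (type) complex_vector
begin

lift_definition zero_cop :: "'a cop" is 0 by (simp add: scaleC_zero_ell2)
lift_definition plus_cop :: "'a cop \<Rightarrow> 'a cop \<Rightarrow> 'a cop" is "(+)"
  by (simp add: blinfun.add_left scaleC_add_right)
lift_definition minus_cop :: "'a cop \<Rightarrow> 'a cop \<Rightarrow> 'a cop" is "(-)"
  by (simp add: blinfun.diff_left scaleC_diff_ell2)
lift_definition uminus_cop :: "'a cop \<Rightarrow> 'a cop" is uminus
  by (simp add: blinfun.minus_left scaleC_uminus_ell2)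
lift_definition scaleR_cop :: "real \<Rightarrow> 'a cop \<Rightarrow> 'a cop" is scaleR
  by (simp add: blinfun.scaleR_left scaleC_scaleR_ell2)
lift_definition scaleC_cop :: "complex \<Rightarrow> 'a cop \<Rightarrow> 'a cop" is "\<lambda>c T. scaleC_blinfun c o\<^sub>L T"
  by (simp add: scaleC_blinfun.rep_eq scaleC_commute_ell2)

instance
  by standard (transfer; auto intro!: blinfun_eqI simp: algebra_simps scaleC_blinfun.rep_eq
      blinfun.add_left blinfun.add_right blinfun.scaleR_left scaleC_add_right scaleC_add_left
      scaleC_scaleC scaleC_one scaleR_scaleC)+

end

instantiation cop :: (type) real_normed_algebra_1
begin

lift_definition one_cop :: "'a cop" is id_blinfun by simp
lift_definition times_cop :: "'a cop \<Rightarrow> 'a cop \<Rightarrow> 'a cop" is "(o\<^sub>L)" by simp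
lift_definition norm_cop :: "'a cop \<Rightarrow> real" is norm .
definition dist_cop :: "'a cop \<Rightarrow> 'a cop \<Rightarrow> real" where
  "dist_cop S T = norm (S - T)"
definition sgn_cop :: "'a cop \<Rightarrow> 'a cop" where
  "sgn_cop T = inverse (norm T) *\<^sub>R T"
definition uniformity_cop :: "('a cop \<times> 'a cop) filter" where
  "uniformity_cop = (INF e\<in>{0<..}. principal {(S, T). dist S T < e})"
definition open_cop :: "'a cop set \<Rightarrow> bool" where
  "open_cop U \<longleftrightarrow> (\<forall>x\<in>U. eventually (\<lambda>(x', y). x' = x \<longrightarrow> y \<in> U) uniformity)"

instance
proof
  fix S T U :: "'a cop" and r :: real
  show "S * T * U = S * (T * U)" by transfer (auto intro!: blinfun_eqI)
  show "1 * S = S" by transfer (auto intro!: blinfun_eqI)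
  show "S * 1 = S" by transfer (auto intro!: blinfun_eqI)
  show "(S + T) * U = S * U + T * U"
    by transfer (auto intro!: blinfun_eqI simp: blinfun.add_left)
  show "S * (T + U) = S * T + S * U"
    by transfer (auto intro!: blinfun_eqI simp: blinfun.add_left blinfun.add_right)
  show "r *\<^sub>R S * T = r *\<^sub>R (S * T)"
    by transfer (auto intro!: blinfun_eqI simp: blinfun.scaleR_left)
  show "S * r *\<^sub>R T = r *\<^sub>R (S * T)"
    by transfer (auto intro!: blinfun_eqI simp: blinfun.scaleR_left blinfun.scaleR_right)
  have "id_blinfun \<noteq> (0 :: 'a ell2 \<Rightarrow>\<^sub>L 'a ell2)"
  proof
    assume "id_blinfun = (0 :: 'a ell2 \<Rightarrow>\<^sub>L 'a ell2)"
    then have "blinfun_apply id_blinfun x = blinfun_apply 0 x" for x :: "'a ell2"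
      by simp
    from this[of "ket undefined"]
    show False by (simp add: ket_nonzero)
  qed
  then show "(0 :: 'a cop) \<noteq> 1" by transfer auto
  show "norm S = 0 \<longleftrightarrow> S = 0" by transfer simp
  show "norm (S + T) \<le> norm S + norm T" by transfer (rule norm_triangle_ineq)
  show "norm (r *\<^sub>R S) = \<bar>r\<bar> * norm S" by transfer simp
  show "norm (S * T) \<le> norm S * norm T" by transfer (rule norm_blinfun_compose)
  show "norm (1 :: 'a cop) = 1"
  proof transfer
    have "norm (ket undefined :: 'a ell2) \<le> norm (id_blinfun :: 'a ell2 \<Rightarrow>\<^sub>L 'a ell2) * norm (ket undefined :: 'a ell2)"
      using norm_blinfun[of id_blinfun "ket undefined :: 'a ell2"] by simp
    then have "1 \<le> norm (id_blinfun :: 'a ell2 \<Rightarrow>\<^sub>L 'a ell2)"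
      by (simp add: ket_nonzero)
    moreover have "norm (id_blinfun :: 'a ell2 \<Rightarrow>\<^sub>L 'a ell2) \<le> 1"
      by (rule norm_blinfun_bound) auto
    ultimately show "norm (id_blinfun :: 'a ell2 \<Rightarrow>\<^sub>L 'a ell2) = 1" by simp
  qed
qed (simp_all only: dist_cop_def sgn_cop_def uniformity_cop_def open_cop_def)

end

lemma norm_cop_apply: "norm (T \<cdot> x) \<le> norm T * norm x"
  by transfer (rule norm_blinfun)

lemma scaleC_times_cop: "(c *\<^sub>C S) * T = c *\<^sub>C (S * T)" "S * (c *\<^sub>C T) = c *\<^sub>C (S * T)"
  for S T :: "'a cop"
  by (transfer; auto intro!: blinfun_eqI simp: scaleC_blinfun.rep_eq)+

lemma cop_apply_add: "(S + T) \<cdot> x = S \<cdot> x + T \<cdot> x"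
  by transfer (simp add: blinfun.add_left)

lemma cop_apply_scaleR: "(r *\<^sub>R S) \<cdot> x = r *\<^sub>R (S \<cdot> x)"
  by transfer (simp add: blinfun.scaleR_left)

definition commutator :: "'a::ring \<Rightarrow> 'a \<Rightarrow> 'a" where
  "commutator a b = a * b - b * a"

definition adjoint_cop :: "'a cop \<Rightarrow> 'a cop" where
  "adjoint_cop T = (THE S. \<forall>x y. cinner (T \<cdot> x) y = cinner x (S \<cdot> y))"

definition positive_cop :: "'a cop \<Rightarrow> bool" where
  "positive_cop T \<longleftrightarrow> (\<forall>x. cinner (T \<cdot> x) x \<in> \<real> \<and> 0 \<le> Re (cinner (T \<cdot> x) x))"

definition abs_cop :: "'a cop \<Rightarrow> 'a cop" where
  "abs_cop T = (THE P. positive_cop P \<and> P * P = adjoint_cop T * T)"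

definition trace_class :: "'a cop \<Rightarrow> bool" where
  "trace_class T \<longleftrightarrow> (\<lambda>i. Re (cinner (abs_cop T \<cdot> ket i) (ket i))) summable_on UNIV"

definition trace_norm :: "'a cop \<Rightarrow> real" where
  "trace_norm T = (\<Sum>\<^sub>\<infinity>i. Re (cinner (abs_cop T \<cdot> ket i) (ket i)))"

definition Trace :: "'a cop \<Rightarrow> complex" where
  "Trace T = (\<Sum>\<^sub>\<infinity>i. cinner (T \<cdot> ket i) (ket i))"

definition commutant :: "'a cop set \<Rightarrow> 'a cop set" where
  "commutant A = {T. \<forall>S\<in>A. T * S = S * T}"


section \<open>The semicircular von Neumann algebra\<close>

lift_definition left_creation_blinfun :: "'n \<Rightarrow> 'n fock \<Rightarrow>\<^sub>L 'n fock" is left_creation_fun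
  by (rule bounded_linear_intro[where K = 1])
    (auto simp: left_creation_fun_add left_creation_fun_scaleC scaleR_scaleC norm_left_creation_fun)

lift_definition right_creation_blinfun :: "'n \<Rightarrow> 'n fock \<Rightarrow>\<^sub>L 'n fock" is right_creation_fun
  by (rule bounded_linear_intro[where K = 1])
    (auto simp: right_creation_fun_add right_creation_fun_scaleC scaleR_scaleC norm_right_creation_fun)

lift_definition lcr :: "'n \<Rightarrow> 'n list cop" is left_creation_blinfun
  by (simp add: left_creation_blinfun.rep_eq left_creation_fun_scaleC)

lift_definition rcr :: "'n \<Rightarrow> 'n list cop" is right_creation_blinfun
  by (simp add: right_creation_blinfun.rep_eq right_creation_fun_scaleC)

definition semicircular_op :: "'n \<Rightarrow> 'n list cop" where
  "semicircular_op j = lcr j + adjoint_cop (lcr j)"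

text \<open>\<open>M = W\<^sup>*(s\<^sub>1, \<dots>, s\<^sub>n)\<close> is the bicommutant of the self-adjoint set \<open>{s\<^sub>1, \<dots>, s\<^sub>n}\<close>.\<close>

lifting_forget cop.lifting

typedef 'n scalg = "commutant (commutant (range (semicircular_op :: 'n \<Rightarrow> 'n list cop)))"
  morphisms op Abs_scalg
  by (rule exI[of _ 0]) (auto simp: commutant_def)

setup_lifting type_definition_scalg

instantiation scalg :: (type) complex_vector
begin

lift_definition zero_scalg :: "'a scalg" is 0 by (simp add: commutant_def)
lift_definition plus_scalg :: "'a scalg \<Rightarrow> 'a scalg \<Rightarrow> 'a scalg" is "(+)"
  unfolding commutant_def by (simp add: algebra_simps)
lift_definition minus_scalg :: "'a scalg \<Rightarrow> 'a scalg \<Rightarrow> 'a scalg" is "(-)"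
  unfolding commutant_def by (simp add: algebra_simps)
lift_definition uminus_scalg :: "'a scalg \<Rightarrow> 'a scalg" is uminus
  unfolding commutant_def by simp
lift_definition scaleR_scalg :: "real \<Rightarrow> 'a scalg \<Rightarrow> 'a scalg" is scaleR
  unfolding commutant_def by simp
lift_definition scaleC_scalg :: "complex \<Rightarrow> 'a scalg \<Rightarrow> 'a scalg" is scaleC
  unfolding commutant_def by (simp add: scaleC_times_cop)

instance
  by standard (transfer; simp add: algebra_simps scaleC_add_right scaleC_add_left
      scaleC_scaleC scaleC_one scaleR_scaleC)+

end

instantiation scalg :: (type) real_normed_algebra_1
begin

lift_definition one_scalg :: "'a scalg" is 1 by (simp add: commutant_def)
lift_definition times_scalg :: "'a scalg \<Rightarrow> 'a scalg \<Rightarrow> 'a scalg" is "(*)"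
proof -
  fix S T :: "'a list cop"
  assume S: "S \<in> commutant (commutant (range semicircular_op))"
    and T: "T \<in> commutant (commutant (range semicircular_op))"
  show "S * T \<in> commutant (commutant (range semicircular_op))"
    unfolding commutant_def[of "commutant _"]
  proof safe
    fix X :: "'a list cop"
    assume X: "X \<in> commutant (range semicircular_op)"
    have "S * X = X * S" "T * X = X * T"
      using S T X unfolding commutant_def[of "commutant _"] by auto
    then show "S * T * X = X * (S * T)" by (metis mult.assoc)
  qed
qed
lift_definition norm_scalg :: "'a scalg \<Rightarrow> real" is norm .
definition dist_scalg :: "'a scalg \<Rightarrow> 'a scalg \<Rightarrow> real" where
  "dist_scalg a b = norm (a - b)"
definition sgn_scalg :: "'a scalg \<Rightarrow> 'a scalg" where
  "sgn_scalg a = inverse (norm a) *\<^sub>R a"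
definition uniformity_scalg :: "('a scalg \<times> 'a scalg) filter" where
  "uniformity_scalg = (INF e\<in>{0<..}. principal {(a, b). dist a b < e})"
definition open_scalg :: "'a scalg set \<Rightarrow> bool" where
  "open_scalg U \<longleftrightarrow> (\<forall>x\<in>U. eventually (\<lambda>(x', y). x' = x \<longrightarrow> y \<in> U) uniformity)"

instance
proof
  fix a b c :: "'a scalg" and r :: real
  show "a * b * c = a * (b * c)" by transfer (rule mult.assoc)
  show "1 * a = a" by transfer simp
  show "a * 1 = a" by transfer simp
  show "(a + b) * c = a * c + b * c" by transfer (rule distrib_right)
  show "a * (b + c) = a * b + a * c" by transfer (rule distrib_left)
  show "r *\<^sub>R a * b = r *\<^sub>R (a * b)" by transfer simp
  show "a * r *\<^sub>R b = r *\<^sub>R (a * b)" by transfer simp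
  show "(0 :: 'a scalg) \<noteq> 1" by transfer simp
  show "norm a = 0 \<longleftrightarrow> a = 0" by transfer simp
  show "norm (a + b) \<le> norm a + norm b" by transfer (rule norm_triangle_ineq)
  show "norm (r *\<^sub>R a) = \<bar>r\<bar> * norm a" by transfer simp
  show "norm (a * b) \<le> norm a * norm b" by transfer (rule norm_mult_ineq)
  show "norm (1 :: 'a scalg) = 1" by transfer simp
qed (simp_all only: dist_scalg_def sgn_scalg_def uniformity_scalg_def open_scalg_def)

end

lift_definition sgen :: "'n \<Rightarrow> 'n scalg" is semicircular_op
  by (auto simp: commutant_def)

definition star :: "'n scalg \<Rightarrow> 'n scalg" where
  "star a = Abs_scalg (adjoint_cop (op a))"

definition tau :: "'n scalg \<Rightarrow> complex" where
  "tau a = cinner (op a \<cdot> vacuum) vacuum"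


section \<open>Non-commutative polynomials and cyclic derivatives\<close>

text \<open>The \<open>s\<^sub>j\<close> are algebraically free, so \<open>\<complex>\<^sub>\<langle>\<^sub>n\<^sub>\<rangle>\<close> is the image of the formal polynomials under
  the injective map \<open>ncpoly_eval\<close>; cyclic derivatives are taken formally.\<close>

type_synonym 'n ncpoly = "'n list \<Rightarrow>\<^sub>0 complex"

definition ncpoly_eval :: "'n ncpoly \<Rightarrow> 'n scalg" where
  "ncpoly_eval p = (\<Sum>w\<in>Poly_Mapping.keys p. Poly_Mapping.lookup p w *\<^sub>C prod_list (map sgen w))"

definition ncpolys :: "'n scalg set" where
  "ncpolys = range ncpoly_eval"

definition cyclic_deriv :: "'n \<Rightarrow> 'n ncpoly \<Rightarrow> 'n ncpoly" where
  "cyclic_deriv j p = (\<Sum>w\<in>Poly_Mapping.keys p. \<Sum>k | k < length w \<and> w ! k = j.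
     Poly_Mapping.single (drop (Suc k) w @ take k w) (Poly_Mapping.lookup p w))"


section \<open>The space \<open>L\<^sup>1(M, \<tau>)\<close>\<close>

text \<open>An element \<open>\<xi>\<close> of \<open>L\<^sup>1(M, \<tau>)\<close> is represented by the functional \<open>\<eta> \<mapsto> \<tau>(\<xi>\<eta>)\<close> on \<open>M\<close>.
  As \<open>\<tau>(\<bar>a\<bar>) = sup {\<bar>\<tau>(ab)\<bar> | b \<in> M, \<parallel>b\<parallel> \<le> 1}\<close>, the completion of \<open>M\<close> in the \<open>1\<close>-norm is the norm closure of
  the functionals \<open>\<tau>(a \<cdot>)\<close> in the dual of \<open>M\<close>. The type allows real-linear functionals,
  but those in the closure are complex-linear.\<close>

type_synonym 'n dual = "'n scalg \<Rightarrow>\<^sub>L complex"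

lemma norm_vacuum: "norm (vacuum :: 'n fock) = 1"
proof -
  have "(\<Sum>\<^sub>\<infinity>w. (cmod (coord (vacuum :: 'n fock) w))\<^sup>2) = (\<Sum>\<^sub>\<infinity>w\<in>{[]}. (cmod (coord (vacuum :: 'n fock) w))\<^sup>2)"
    by (rule infsum_cong_neutral) (auto simp: ket.rep_eq)
  then show ?thesis by (simp add: norm_ell2_sum ket.rep_eq)
qed

lemma norm_tau_le: "cmod (tau a) \<le> norm a"
proof -
  have "cmod (tau a) \<le> norm (op a \<cdot> vacuum) * norm (vacuum :: 'a fock)"
    unfolding tau_def by (rule cmod_cinner_le)
  also have "\<dots> \<le> norm (op a)" using norm_cop_apply[of "op a" vacuum] by (simp add: norm_vacuum)
  finally show ?thesis by (simp add: norm_scalg.rep_eq)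
qed

lemma tau_add: "tau (a + b) = tau a + tau b"
  by (simp add: tau_def plus_scalg.rep_eq cop_apply_add cinner_add_left)

lemma tau_scaleR: "tau (r *\<^sub>R a) = r *\<^sub>R tau a"
  unfolding tau_def scaleR_scalg.rep_eq cop_apply_scaleR scaleR_ell2_def cinner_scaleC_left
  by (simp add: scaleR_conv_of_real)

lift_definition toL1 :: "'n scalg \<Rightarrow> 'n dual" is "\<lambda>a b. tau (a * b)"
proof -
  fix a :: "'n scalg"
  have "cmod (tau (a * b)) \<le> norm b * norm a" for b
    using norm_tau_le[of "a * b"] norm_mult_ineq[of a b] by (simp add: mult.commute)
  then show "bounded_linear (\<lambda>b. tau (a * b))"
    by (intro bounded_linear_intro[where K = "norm a"]) (auto simp: distrib_left tau_add tau_scaleR)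
qed

definition L1 :: "'n dual set" where
  "L1 = closure (range toL1)"

text \<open>\<open>\<tau>(\<xi>\<^sup>* a)\<close> is the complex conjugate of \<open>\<tau>(\<xi> a\<^sup>*)\<close>.\<close>

definition L1_star :: "'n dual \<Rightarrow> 'n dual" where
  "L1_star \<xi> = Blinfun (\<lambda>a. cnj (blinfun_apply \<xi> (star a)))"

definition L1_sa :: "'n dual set" where
  "L1_sa = {\<xi> \<in> L1. L1_star \<xi> = \<xi>}"

definition vec_toL1 :: "'n::finite scalg ^ 'n \<Rightarrow> 'n dual ^ 'n" where
  "vec_toL1 v = (\<chi> k. toL1 (v $ k))"

definition div_free :: "'n::finite dual ^ 'n \<Rightarrow> bool" where
  "div_free \<xi> \<longleftrightarrow> (\<forall>R. (\<Sum>j\<in>UNIV. blinfun_apply (\<xi> $ j) (ncpoly_eval (cyclic_deriv j R))) = 0)"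

definition Vect_L1_tau :: "('n::finite dual ^ 'n) set" where
  "Vect_L1_tau = {\<xi>. (\<forall>j. \<xi> $ j \<in> L1) \<and> div_free \<xi>}"

definition Vect_L1_sa_tau :: "('n::finite dual ^ 'n) set" where
  "Vect_L1_sa_tau = {\<xi> \<in> Vect_L1_tau. \<forall>j. \<xi> $ j \<in> L1_sa}"


section \<open>The projections \<open>\<Pi>\<^sub>k\<close>\<close>

text \<open>The subspace of \<open>M\<close> identified with \<open>(\<complex>\<^sup>n)\<^sup>\<otimes>\<^sup>k\<close> via \<open>a \<mapsto> a1\<close>.\<close>

definition tensor_power_alg :: "nat \<Rightarrow> 'n scalg set" where
  "tensor_power_alg k = {a. op a \<cdot> vacuum \<in> tensor_power k}"

definition component :: "nat \<Rightarrow> 'n dual \<Rightarrow> 'n scalg" where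
  "component k \<xi> = (THE a. a \<in> tensor_power_alg k \<and>
     (\<forall>\<eta>\<in>tensor_power_alg k. tau (a * \<eta>) = blinfun_apply \<xi> \<eta>))"

definition Qproj :: "nat \<Rightarrow> 'n::finite dual ^ 'n \<Rightarrow> 'n fock ^ 'n" where
  "Qproj k \<xi> = (\<chi> j. op (component k (\<xi> $ j)) \<cdot> vacuum)"

definition Xspace :: "nat \<Rightarrow> ('n::finite fock ^ 'n) set" where
  "Xspace k = (\<lambda>\<xi>. \<chi> j. (adjoint_cop (lcr j) - adjoint_cop (rcr j)) \<cdot> \<xi>) ` tensor_power (k + 1)"

definition orth_proj :: "('n::finite fock ^ 'n) set \<Rightarrow> 'n fock ^ 'n \<Rightarrow> 'n fock ^ 'n" where
  "orth_proj X x = (THE y. y \<in> X \<and> (\<forall>z\<in>X. (\<Sum>j\<in>UNIV. cinner (x $ j - y $ j) (z $ j)) = 0))"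

definition Piproj :: "nat \<Rightarrow> 'n::finite dual ^ 'n \<Rightarrow> 'n fock ^ 'n" where
  "Piproj k \<xi> = orth_proj (Xspace k) (Qproj k \<xi>)"


section \<open>Smooth algebras, the derivations \<open>\<D>\<^sub>b\<close>, and vorticity\<close>

definition rcomm :: "'n scalg \<Rightarrow> 'n \<Rightarrow> 'n list cop" where
  "rcomm a j = commutator (op a) (rcr j - adjoint_cop (rcr j))"

definition B_infty_1 :: "'n scalg set" where
  "B_infty_1 = {a. \<forall>j. trace_class (rcomm a j)}"

definition B_norm :: "'n::finite scalg \<Rightarrow> real" where
  "B_norm a = norm a + Max (range (\<lambda>j. trace_norm (rcomm a j)))"

definition C_infty_1 :: "'n::finite scalg set" where
  "C_infty_1 = {a \<in> B_infty_1. \<forall>e>0. \<exists>p\<in>ncpolys. B_norm (a - p) < e}"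

definition C_infty_1_sa :: "'n::finite scalg set" where
  "C_infty_1_sa = {a \<in> C_infty_1. star a = a}"

definition Phi :: "'n list cop \<Rightarrow> 'n dual" where
  "Phi X = (THE \<xi>. \<xi> \<in> L1 \<and> (\<forall>a. Trace (X * op a) = blinfun_apply \<xi> a))"

text \<open>\<open>L\<^sup>2(M, \<tau>)\<close> is the Fock space via \<open>a \<mapsto> a1\<close>; vectors \<open>a1\<close> are dense, so right multiplication
  by \<open>b\<close> is the unique bounded operator sending each \<open>a1\<close> to \<open>(ab)1\<close>.\<close>

definition right_mult :: "'n scalg \<Rightarrow> 'n list cop" where
  "right_mult b = (THE X. \<forall>a. X \<cdot> (op a \<cdot> vacuum) = op (a * b) \<cdot> vacuum)"

definition deriv_along :: "'n::finite scalg ^ 'n \<Rightarrow> 'n scalg \<Rightarrow> 'n dual" where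
  "deriv_along b a = Phi ((1/2) *\<^sub>R (\<Sum>j\<in>UNIV. right_mult (b $ j) * rcomm a j))"

definition vorticity :: "'n::finite scalg ^ 'n \<Rightarrow> 'n scalg" where
  "vorticity v = \<i> *\<^sub>C (\<Sum>j\<in>UNIV. commutator (sgen j) (v $ j))"

end

theory Submission
  imports Defs
begin

text \<open>Write \<open>\<D>\<^sub>v\<close> for the derivation along \<open>v\<close>. Since \<open>\<D>\<^sub>v s\<^sub>j = v\<^sub>j\<close>, the terms \<open>[v\<^sub>j, v\<^sub>j]\<close> cancel in
  \<open>\<D>\<^sub>v \<Omega>\<close>, and \<open>\<Pi>\<^sub>k q = 0\<close> for all \<open>k\<close> says that \<open>\<Sum>\<^sub>j [s\<^sub>j, q\<^sub>j] = 0\<close>. So the Euler equations give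
  \<open>d\<Omega>/dt = - \<D>\<^sub>v \<Omega>\<close>: the vorticity moves by the infinitesimal automorphism \<open>\<D>\<^sub>v\<close>, which preserves the
  trace because \<open>v\<close> is divergence free, and the moments are constant.

  Two points need care. Differentiability holds in \<open>L\<^sup>1\<close> only, and nothing bounds \<open>\<parallel>\<Omega>(t)\<parallel>\<close> locally
  in \<open>t\<close>, so \<open>\<tau>(\<Omega>\<^sup>m)\<close> cannot be differentiated directly. The functions that are differentiated are
  \<open>\<tau>(R\<^sub>x(t))\<close> for the resolvents \<open>R\<^sub>x = (1 + i x \<Omega>)\<^sup>-\<^sup>1\<close> with \<open>x\<close> real. As \<open>\<Omega>\<close> is self-adjoint these are
  contractions, and by the resolvent identity
  \<open>d/dt \<tau>(R\<^sub>x) = x \<Sum>\<^sub>j \<langle>dv\<^sub>j/dt, [R\<^sub>x\<^sup>2, s\<^sub>j]\<rangle>\<close> (\<open>resolvent_trace_derivative\<close>).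
  If this vanishes for all \<open>x\<close>, then \<open>\<tau>(R\<^sub>x)\<close> is the same at any two times, and its power series at
  \<open>x = 0\<close> has the moments as coefficients up to powers of \<open>- i\<close> (\<open>moments_eq\<close>).

  Secondly, \<open>\<Omega>\<close> and \<open>R\<^sub>x\<^sup>2\<close> are not polynomials. But \<open>R\<^sub>x\<close> lies in the norm closed algebra generated by
  \<open>\<Omega>\<close>, because the Neumann series extends it from \<open>x = 0\<close> in steps of constant length
  (\<open>is_resolvent_exists\<close>), and the functionals involved are norm continuous. So it suffices to
  replace \<open>R\<^sub>x\<^sup>2\<close> by a power \<open>\<Omega>\<^sup>k\<close>. For the pressure, \<open>\<Omega>\<^sup>k\<close> is a norm limit of polynomials and the claim
  is the cyclic symmetry of the coefficients of \<open>q\<close> (\<open>pressure_commutator\<close>). For the advection term,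
  the Leibniz rule gives \<open>(k + 1) \<tau>(\<D>\<^sub>v p \<cdot> p\<^sup>k) = \<tau>(\<D>\<^sub>v p\<^sup>k\<^sup>+\<^sup>1) = 0\<close> for polynomials \<open>p\<close>, and the vorticities of
  polynomial fields that approximate \<open>v\<close> in the smooth algebra pass this on to \<open>\<Omega>\<close>
  (\<open>advection_vorticity_power\<close>).

  The limit in the last step is controlled by the trace norm. For this, trace class operators are
  identified with the operators \<open>\<Sum>\<^sub>i \<langle>\<cdot>, y\<^sub>i\<rangle> x\<^sub>i\<close> with \<open>\<Sum>\<^sub>i \<parallel>x\<^sub>i\<parallel> \<parallel>y\<^sub>i\<parallel> < \<infinity>\<close> (\<open>trace_class_nuclear\<close>,
  \<open>nuclear_trace_class\<close>), for which linearity of the class, its ideal property and the trace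
  property are elementary.\<close>

section \<open>Square summable families and bounded operators\<close>

lemma coord_simps [simp]:
  "coord (x + y) i = coord x i + coord y i"
  "coord (x - y) i = coord x i - coord y i"
  "coord (- x) i = - coord x i"
  "coord (c *\<^sub>C x) i = c * coord x i"
  "coord 0 i = 0"
  "coord (ket j) i = (if i = j then 1 else 0)"
  by (auto simp: plus_ell2.rep_eq minus_ell2.rep_eq uminus_ell2.rep_eq scaleC_ell2.rep_eq
      zero_ell2.rep_eq ket.rep_eq)

lemma coord_scaleR [simp]: "coord (r *\<^sub>R x) i = complex_of_real r * coord x i"
  by (simp add: scaleR_ell2_def)

lemma coord_sum: "coord (sum f A) i = (\<Sum>a\<in>A. coord (f a) i)"
  by (induction A rule: infinite_finite_induct) auto

lemma ell2_eqI: "(\<And>i. coord x i = coord y i) \<Longrightarrow> x = y"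
  by (intro coord_inject[THEN iffD1] ext)

lemma cinner_coord: "cinner x y = (\<Sum>\<^sub>\<infinity>i. coord x i * cnj (coord y i))"
  by (simp add: cinner.rep_eq)

lemma cinner_zero_left [simp]: "cinner 0 y = 0"
  by (simp add: cinner_coord)
lemma cinner_zero_right [simp]: "cinner x 0 = 0"
  by (simp add: cinner_coord)
lemma cinner_add_right: "cinner x (y + z) = cinner x y + cinner x z"
  by (metis cinner_add_left cinner_commute complex_cnj_add)
lemma cinner_minus_left: "cinner (- x) y = - cinner x y"
  by (simp add: cinner_coord infsum_uminus)
lemma cinner_minus_right: "cinner x (- y) = - cinner x y"
  by (simp add: cinner_coord infsum_uminus)
lemma cinner_diff_left: "cinner (x - y) z = cinner x z - cinner y z"
  using cinner_add_left[of x "-y" z] by (simp add: cinner_minus_left)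
lemma cinner_diff_right: "cinner x (y - z) = cinner x y - cinner x z"
  using cinner_add_right[of x y "-z"] by (simp add: cinner_minus_right)
lemma cinner_scaleC_right: "cinner x (c *\<^sub>C y) = cnj c * cinner x y"
  by (metis cinner_scaleC_left cinner_commute complex_cnj_mult)
lemma cinner_scaleR_left: "cinner (r *\<^sub>R x) y = r *\<^sub>R cinner x y"
  by (simp add: scaleR_ell2_def cinner_scaleC_left scaleR_conv_of_real)
lemma cinner_scaleR_right: "cinner x (r *\<^sub>R y) = r *\<^sub>R cinner x y"
  by (simp add: scaleR_ell2_def cinner_scaleC_right scaleR_conv_of_real)
lemma cinner_sum_left: "cinner (sum f A) y = (\<Sum>a\<in>A. cinner (f a) y)"
  by (induction A rule: infinite_finite_induct) (auto simp: cinner_add_left)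
lemma cinner_sum_right: "cinner y (sum f A) = (\<Sum>a\<in>A. cinner y (f a))"
  by (induction A rule: infinite_finite_induct) (auto simp: cinner_add_right)

lemmas cinner_bilinear = cinner_add_left cinner_add_right cinner_diff_left cinner_diff_right
  cinner_minus_left cinner_minus_right cinner_scaleC_left cinner_scaleC_right
  cinner_scaleR_left cinner_scaleR_right

lemma cinner_self_norm: "cinner x x = complex_of_real ((norm x)\<^sup>2)"
  by (simp add: cinner_self norm_ell2_sum infsum_nonneg)

lemma norm_sq_cinner: "(norm x)\<^sup>2 = Re (cinner x x)"
  by (simp add: cinner_self_norm)

lemma cinner_self_eq_0 [simp]: "cinner x x = 0 \<longleftrightarrow> x = 0"
  by (simp add: cinner_self_norm)

lemma cinner_ket_right [simp]: "cinner x (ket i) = coord x i"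
proof -
  have "cinner x (ket i) = (\<Sum>\<^sub>\<infinity>j\<in>{i}. coord x j * cnj (coord (ket i) j))"
    unfolding cinner_coord by (rule infsum_cong_neutral) auto
  then show ?thesis by simp
qed

lemma cinner_ket_left [simp]: "cinner (ket i) x = cnj (coord x i)"
  by (subst cinner_commute) simp

lemma norm_ket [simp]: "norm (ket i) = 1"
proof -
  have "(norm (ket i))\<^sup>2 = 1" by (simp add: norm_sq_cinner)
  then show ?thesis by (metis norm_ge_zero power2_eq_1_iff le_minus_one_simps(3))
qed

lemma cinner_eqI:
  assumes "\<And>y. cinner x y = cinner z y"
  shows "x = z"
proof -
  have "cinner (x - z) (x - z) = 0" using assms[of "x - z"] by (simp add: cinner_diff_left)
  then show ?thesis by simp
qed

lemma bounded_linear_cinner_left: "bounded_linear (\<lambda>x. cinner x y)"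
  by (rule bounded_linear_intro[where K = "norm y"])
    (auto simp: cinner_bilinear cmod_cinner_le)

lemma coord_norm_has_sum: "((\<lambda>i. (cmod (coord x i))\<^sup>2) has_sum (norm x)\<^sup>2) UNIV"
  using coord[of x] by (simp add: square_summable_def norm_ell2_sum infsum_nonneg)

lemma coord_norm_finite: "finite F \<Longrightarrow> (\<Sum>i\<in>F. (cmod (coord x i))\<^sup>2) \<le> (norm x)\<^sup>2"
  using coord_norm_has_sum[of x] by (intro finite_sum_le_has_sum) auto

lemma ket_expansion: "((\<lambda>i. coord x i *\<^sub>C ket i) has_sum x) UNIV"
proof -
  have *: "(norm (x - (\<Sum>i\<in>F. coord x i *\<^sub>C ket i)))\<^sup>2 =
      (norm x)\<^sup>2 - (\<Sum>i\<in>F. (cmod (coord x i))\<^sup>2)" if "finite F" for F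
  proof -
    define y where "y = (\<Sum>i\<in>F. coord x i *\<^sub>C ket i)"
    have y: "coord y j = (if j \<in> F then coord x j else 0)" for j
      using that by (simp add: y_def coord_sum if_distrib sum.delta cong: if_cong)
    have xy: "cinner x y = (\<Sum>i\<in>F. (cmod (coord x i))\<^sup>2)"
      unfolding y_def
      by (simp add: cinner_sum_right cinner_scaleC_right mult.commute flip: complex_norm_square)
    have yy: "cinner y y = (\<Sum>i\<in>F. (cmod (coord x i))\<^sup>2)"
      unfolding y_def cinner_sum_right
      by (rule trans[OF sum.cong, OF refl, of _ _ "\<lambda>i. complex_of_real ((cmod (coord x i))\<^sup>2)"])
        (auto simp: cinner_scaleC_right y[unfolded y_def] mult.commute simp flip: complex_norm_square)
    have "cinner (x - y) (x - y) = cinner x x - cinner x y - cnj (cinner x y) + cinner y y"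
      by (simp add: cinner_bilinear) (metis cinner_commute)
    then have "complex_of_real ((norm (x - y))\<^sup>2) =
        complex_of_real ((norm x)\<^sup>2 - (\<Sum>i\<in>F. (cmod (coord x i))\<^sup>2))"
      unfolding xy yy unfolding cinner_self_norm by simp
    then show ?thesis unfolding of_real_eq_iff y_def .
  qed
  have "((\<lambda>F. (norm x)\<^sup>2 - (\<Sum>i\<in>F. (cmod (coord x i))\<^sup>2)) \<longlongrightarrow> (norm x)\<^sup>2 - (norm x)\<^sup>2)
      (finite_subsets_at_top UNIV)"
    using coord_norm_has_sum[of x] unfolding has_sum_def by (intro tendsto_intros)
  then have "((\<lambda>F. sqrt ((norm x)\<^sup>2 - (\<Sum>i\<in>F. (cmod (coord x i))\<^sup>2))) \<longlongrightarrow> sqrt 0)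
      (finite_subsets_at_top UNIV)"
    by (intro tendsto_real_sqrt) simp
  moreover have "eventually (\<lambda>F. sqrt ((norm x)\<^sup>2 - (\<Sum>i\<in>F. (cmod (coord x i))\<^sup>2)) =
      norm (x - (\<Sum>i\<in>F. coord x i *\<^sub>C ket i))) (finite_subsets_at_top UNIV)"
    by (rule eventually_finite_subsets_at_top_weakI) (simp flip: *)
  ultimately have "((\<lambda>F. norm (x - (\<Sum>i\<in>F. coord x i *\<^sub>C ket i))) \<longlongrightarrow> 0) (finite_subsets_at_top UNIV)"
    by (simp add: tendsto_cong)
  then show ?thesis
    unfolding has_sum_def
    by (subst Lim_null, subst tendsto_norm_zero_iff[symmetric]) (simp add: norm_minus_commute)
qed

text \<open>Limits of Cauchy sequences and adjoints are first known through their coordinates; a common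
  bound for the finite partial sums makes them vectors.\<close>

lemma ell2_of_bounded_sums:
  assumes "\<And>F. finite F \<Longrightarrow> (\<Sum>i\<in>F. (cmod (f i))\<^sup>2) \<le> C\<^sup>2" "0 \<le> C"
  shows "\<exists>x. (\<forall>i. coord x i = f i) \<and> norm x \<le> C"
proof -
  have s: "(\<lambda>i. (cmod (f i))\<^sup>2) summable_on UNIV"
    by (rule nonneg_bdd_above_summable_on) (use assms in \<open>auto intro!: bdd_aboveI[of _ "C\<^sup>2"]\<close>)
  then have c: "coord (Abs_ell2 f) = f"
    by (intro Abs_ell2_inverse) (simp add: square_summable_def)
  have "(\<Sum>\<^sub>\<infinity>i. (cmod (f i))\<^sup>2) \<le> C\<^sup>2"
    by (rule infsum_le_finite_sums[OF s]) (use assms in auto)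
  then have "norm (Abs_ell2 f) \<le> C"
    using assms(2) by (simp add: norm_ell2_sum c real_le_lsqrt infsum_nonneg)
  then show ?thesis using c by metis
qed

instance ell2 :: (type) complete_space
proof
  fix X :: "nat \<Rightarrow> 'a ell2"
  assume "Cauchy X"
  have co: "cmod (coord x i) \<le> norm x" for x :: "'a ell2" and i
    using cmod_cinner_le[of x "ket i"] by simp
  have "Cauchy (\<lambda>n. coord (X n) i)" for i
  proof (rule metric_CauchyI)
    fix e :: real assume "e > 0"
    then obtain N where N: "\<And>m n. m \<ge> N \<Longrightarrow> n \<ge> N \<Longrightarrow> dist (X m) (X n) < e"
      using metric_CauchyD[OF \<open>Cauchy X\<close>] by metis
    have "dist (coord (X m) i) (coord (X n) i) \<le> dist (X m) (X n)" for m n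
      using co[of "X m - X n" i] by (simp add: dist_norm)
    then show "\<exists>N. \<forall>m\<ge>N. \<forall>n\<ge>N. dist (coord (X m) i) (coord (X n) i) < e"
      using N by (meson le_less_trans)
  qed
  then have "\<forall>i. \<exists>l. (\<lambda>n. coord (X n) i) \<longlonglongrightarrow> l"
    using Cauchy_convergent_iff convergent_def by blast
  then obtain f where f: "\<And>i. (\<lambda>n. coord (X n) i) \<longlonglongrightarrow> f i" by metis
  have key: "(\<Sum>i\<in>F. (cmod (f i - coord (X m) i))\<^sup>2) \<le> e\<^sup>2"
    if F: "finite F" and e: "\<And>n. n \<ge> N \<Longrightarrow> dist (X n) (X m) < e" for e N m F
  proof (rule LIMSEQ_le_const2)
    show "(\<lambda>n. \<Sum>i\<in>F. (cmod (coord (X n) i - coord (X m) i))\<^sup>2) \<longlonglongrightarrow>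
        (\<Sum>i\<in>F. (cmod (f i - coord (X m) i))\<^sup>2)"
      by (intro tendsto_intros f)
    have "(\<Sum>i\<in>F. (cmod (coord (X n) i - coord (X m) i))\<^sup>2) \<le> e\<^sup>2" if "n \<ge> N" for n
    proof -
      have "(\<Sum>i\<in>F. (cmod (coord (X n) i - coord (X m) i))\<^sup>2) \<le> (norm (X n - X m))\<^sup>2"
        using coord_norm_finite[OF F, of "X n - X m"] by simp
      also have "\<dots> \<le> e\<^sup>2" using e[OF that] by (intro power_mono) (auto simp: dist_norm)
      finally show ?thesis .
    qed
    then show "\<exists>N. \<forall>n\<ge>N. (\<Sum>i\<in>F. (cmod (coord (X n) i - coord (X m) i))\<^sup>2) \<le> e\<^sup>2" by blast
  qed
  obtain N1 where N1: "\<And>m n. m \<ge> N1 \<Longrightarrow> n \<ge> N1 \<Longrightarrow> dist (X m) (X n) < 1"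
    using metric_CauchyD[OF \<open>Cauchy X\<close>, of 1] by auto
  have "\<exists>y. (\<forall>i. coord y i = f i - coord (X N1) i) \<and> norm y \<le> 1"
    by (rule ell2_of_bounded_sums) (use key[of _ N1 N1 1] N1 in simp_all)
  then obtain y where y: "\<And>i. coord y i = f i - coord (X N1) i" by blast
  define x where "x = y + X N1"
  have x: "coord x i = f i" for i by (simp add: x_def y)
  have "X \<longlonglongrightarrow> x"
  proof (rule metric_LIMSEQ_I)
    fix e :: real assume "e > 0"
    then obtain N where N: "\<And>m n. m \<ge> N \<Longrightarrow> n \<ge> N \<Longrightarrow> dist (X m) (X n) < e/2"
      using metric_CauchyD[OF \<open>Cauchy X\<close>, of "e/2"] by auto
    have "dist (X m) x < e" if "m \<ge> N" for m
    proof -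
      have "\<exists>z. (\<forall>i. coord z i = f i - coord (X m) i) \<and> norm z \<le> e/2"
      proof (rule ell2_of_bounded_sums)
        show "(\<Sum>i\<in>F. (cmod (f i - coord (X m) i))\<^sup>2) \<le> (e/2)\<^sup>2" if "finite F" for F
          by (rule key[OF that, of N]) (use N \<open>m \<ge> N\<close> in auto)
      qed (use \<open>e > 0\<close> in auto)
      then obtain z where z: "\<And>i. coord z i = f i - coord (X m) i" "norm z \<le> e/2" by blast
      have "z = x - X m" by (rule ell2_eqI) (simp add: z x)
      then show ?thesis using z(2) \<open>e > 0\<close> by (simp add: dist_norm norm_minus_commute)
    qed
    then show "\<exists>N. \<forall>n\<ge>N. dist (X n) x < e" by blast
  qed
  then show "convergent X" by (auto simp: convergent_def)
qed

instance ell2 :: (type) banach ..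

lemma cop_apply_simps [simp]:
  "(S + T) \<cdot> x = S \<cdot> x + T \<cdot> x" "(S - T) \<cdot> x = S \<cdot> x - T \<cdot> x" "(- T) \<cdot> x = - (T \<cdot> x)"
  "(r *\<^sub>R T) \<cdot> x = r *\<^sub>R (T \<cdot> x)" "(c *\<^sub>C T) \<cdot> x = c *\<^sub>C (T \<cdot> x)" "(S * T) \<cdot> x = S \<cdot> T \<cdot> x"
  "1 \<cdot> x = x" "0 \<cdot> x = 0"
  by (simp_all add: cop_apply.rep_eq plus_cop.rep_eq minus_cop.rep_eq uminus_cop.rep_eq
      scaleR_cop.rep_eq scaleC_cop.rep_eq times_cop.rep_eq one_cop.rep_eq zero_cop.rep_eq
      blinfun.bilinear_simps scaleC_blinfun.rep_eq)

lemma cop_apply_sum: "sum f A \<cdot> x = (\<Sum>a\<in>A. f a \<cdot> x)"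
  by (induction A rule: infinite_finite_induct) auto

lemma cop_apply_linear [simp]:
  "T \<cdot> (x + y) = T \<cdot> x + T \<cdot> y" "T \<cdot> (x - y) = T \<cdot> x - T \<cdot> y" "T \<cdot> (- x) = - (T \<cdot> x)"
  "T \<cdot> (c *\<^sub>C x) = c *\<^sub>C (T \<cdot> x)" "T \<cdot> (r *\<^sub>R x) = r *\<^sub>R (T \<cdot> x)" "T \<cdot> 0 = 0"
  using blinfun_of_cop[of T]
  by (simp_all add: cop_apply.rep_eq blinfun.bilinear_simps)

lemma cop_apply_sum_right: "T \<cdot> (sum f A) = (\<Sum>a\<in>A. T \<cdot> f a)"
  by (induction A rule: infinite_finite_induct) auto

lemma bounded_linear_cop_apply: "bounded_linear (\<lambda>x. T \<cdot> x)"
  by (rule bounded_linear_intro[where K = "norm T"])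
    (use norm_cop_apply[of T] in \<open>auto simp: mult.commute\<close>)

lemma bounded_linear_cop_apply_left: "bounded_linear (\<lambda>T. T \<cdot> x)"
  by (rule bounded_linear_intro[where K = "norm x"])
    (use norm_cop_apply[of _ x] in \<open>auto\<close>)

lemma cop_eqI: "(\<And>x. S \<cdot> x = T \<cdot> x) \<Longrightarrow> S = T"
  by (metis blinfun_eqI blinfun_of_cop_inject cop_apply.rep_eq)

lemma norm_cop_bound:
  assumes "0 \<le> b" "\<And>x. norm (T \<cdot> x) \<le> b * norm x"
  shows "norm T \<le> b"
  using assms by (simp add: norm_cop.rep_eq norm_blinfun_bound cop_apply.rep_eq)

lemma cop_exists:
  assumes "bounded_linear f" "\<And>c x. f (c *\<^sub>C x) = c *\<^sub>C f x"
  shows "\<exists>T. \<forall>x. T \<cdot> x = f x"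
proof (intro exI allI)
  fix x
  have "blinfun_of_cop (Abs_cop (Blinfun f)) = Blinfun f"
    by (rule Abs_cop_inverse) (simp add: bounded_linear_Blinfun_apply assms)
  then show "Abs_cop (Blinfun f) \<cdot> x = f x"
    by (simp add: cop_apply.rep_eq bounded_linear_Blinfun_apply assms)
qed

instance cop :: (type) complete_space
proof
  fix X :: "nat \<Rightarrow> 'a cop"
  assume "Cauchy X"
  then have "Cauchy (\<lambda>n. blinfun_of_cop (X n))"
    by (simp add: Cauchy_def dist_norm norm_cop.rep_eq minus_cop.rep_eq)
  then obtain B where B: "(\<lambda>n. blinfun_of_cop (X n)) \<longlonglongrightarrow> B"
    using Cauchy_convergent_iff convergent_def by blast
  have app: "(\<lambda>n. X n \<cdot> x) \<longlonglongrightarrow> blinfun_apply B x" for x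
    unfolding cop_apply.rep_eq by (intro tendsto_intros B)
  have "blinfun_apply B (c *\<^sub>C x) = c *\<^sub>C blinfun_apply B x" for c x
    using app[of "c *\<^sub>C x"] bounded_linear.tendsto[OF bounded_linear_scaleC_ell2 app[of x], of c]
    by (simp add: LIMSEQ_unique)
  then have "blinfun_of_cop (Abs_cop B) = B" by (intro Abs_cop_inverse) simp
  then have "X \<longlonglongrightarrow> Abs_cop B"
    using B by (simp add: LIMSEQ_iff norm_cop.rep_eq minus_cop.rep_eq)
  then show "convergent X" by (auto simp: convergent_def)
qed

instance cop :: (type) banach ..

lemma cop_apply_has_sum: "((\<lambda>i. coord x i *\<^sub>C (T \<cdot> ket i)) has_sum T \<cdot> x) UNIV"
  using has_sum_bounded_linear[OF bounded_linear_cop_apply ket_expansion, of T x]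
  by (simp add: o_def)

lemma cinner_has_sum: "((\<lambda>i. coord x i * cnj (coord y i)) has_sum cinner x y) UNIV"
  using has_sum_bounded_linear[OF bounded_linear_cinner_left ket_expansion, of x y]
  by (simp add: o_def cinner_scaleC_left)

lemma cop_eq_ketI:
  assumes "\<And>i. S \<cdot> ket i = T \<cdot> ket i"
  shows "S = T"
  using cop_apply_has_sum[of _ S] cop_apply_has_sum[of _ T] assms
  by (metis (no_types, lifting) cop_eqI has_sum_cong has_sum_unique)

lemma adjoint_exists: "\<exists>S. \<forall>x y. cinner (T \<cdot> x) y = cinner x (S \<cdot> y)"
proof -
  have "\<exists>z. (\<forall>i. coord z i = cinner y (T \<cdot> ket i)) \<and> norm z \<le> norm T * norm y" for y
  proof -
    have "(\<Sum>i\<in>F. (cmod (cinner y (T \<cdot> ket i)))\<^sup>2) \<le> (norm T * norm y)\<^sup>2" if F: "finite F" for F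
    proof -
      \<comment> \<open>The truncation \<open>z\<close> of the wanted vector satisfies \<open>\<parallel>z\<parallel>\<^sup>2 = \<langle>T z, y\<rangle>\<close>.\<close>
      define S where "S = (\<Sum>i\<in>F. (cmod (cinner y (T \<cdot> ket i)))\<^sup>2)"
      define z where "z = (\<Sum>i\<in>F. cinner y (T \<cdot> ket i) *\<^sub>C ket i)"
      have S0: "0 \<le> S" by (simp add: S_def sum_nonneg)
      have z: "coord z j = (if j \<in> F then cinner y (T \<cdot> ket j) else 0)" for j
        using F by (simp add: z_def coord_sum if_distrib sum.delta cong: if_cong)
      have "cinner z z = (\<Sum>i\<in>F. cnj (cinner y (T \<cdot> ket i)) * coord z i)"
        by (subst (2) z_def) (simp add: cinner_sum_right cinner_scaleC_right)
      also have "\<dots> = S"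
        unfolding S_def of_real_sum complex_norm_square
        by (intro sum.cong) (auto simp: z mult.commute)
      finally have zz: "(norm z)\<^sup>2 = S" by (simp add: norm_sq_cinner)
      have "cinner (T \<cdot> z) y = (\<Sum>i\<in>F. cinner y (T \<cdot> ket i) * cinner (T \<cdot> ket i) y)"
        by (simp add: z_def cop_apply_sum_right cinner_sum_left cinner_scaleC_left)
      also have "\<dots> = S"
        unfolding S_def of_real_sum complex_norm_square
        by (intro sum.cong refl arg_cong2[of _ _ _ _ "(*)"]) (metis cinner_commute)
      finally have "S = cmod (cinner (T \<cdot> z) y)" using S0 by simp
      also have "\<dots> \<le> (norm T * norm z) * norm y"
        by (rule order_trans[OF cmod_cinner_le]) (intro mult_right_mono norm_cop_apply norm_ge_zero)
      finally have *: "(norm z)\<^sup>2 \<le> norm z * (norm T * norm y)" by (simp add: zz mult_ac)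
      have "norm z \<le> norm T * norm y"
      proof (cases "norm z = 0")
        case False
        then show ?thesis using * by (simp add: power2_eq_square)
      qed simp
      then have "(norm z)\<^sup>2 \<le> (norm T * norm y)\<^sup>2" by (intro power_mono) auto
      then show ?thesis by (simp add: zz S_def)
    qed
    then show ?thesis by (rule ell2_of_bounded_sums) auto
  qed
  then obtain f where f: "\<And>y i. coord (f y) i = cinner y (T \<cdot> ket i)"
    and nf: "\<And>y. norm (f y) \<le> norm T * norm y" by metis
  have "\<exists>S. \<forall>y. S \<cdot> y = f y"
  proof (rule cop_exists)
    show "bounded_linear f"
      by (rule bounded_linear_intro[where K = "norm T"])
        (auto intro!: ell2_eqI simp: f cinner_bilinear nf mult.commute scaleR_conv_of_real)
    show "f (c *\<^sub>C x) = c *\<^sub>C f x" for c x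
      by (auto intro!: ell2_eqI simp: f cinner_bilinear)
  qed
  then obtain S where S: "\<And>y. S \<cdot> y = f y" by blast
  have "cinner (T \<cdot> x) y = cinner x (S \<cdot> y)" for x y
  proof -
    have "((\<lambda>i. coord x i * cinner (T \<cdot> ket i) y) has_sum cinner (T \<cdot> x) y) UNIV"
      using has_sum_bounded_linear[OF bounded_linear_cinner_left[of y] cop_apply_has_sum[of x T]]
      by (simp add: o_def cinner_scaleC_left)
    moreover have "cnj (coord (S \<cdot> y) i) = cinner (T \<cdot> ket i) y" for i
      by (simp add: S f) (metis cinner_commute)
    ultimately show ?thesis
      using cinner_has_sum[of x "S \<cdot> y"] by (simp add: has_sum_unique)
  qed
  then show ?thesis by blast
qed

lemma adjoint_cop_eqI:
  assumes "\<And>x y. cinner (T \<cdot> x) y = cinner x (S \<cdot> y)"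
  shows "adjoint_cop T = S"
  unfolding adjoint_cop_def
proof (rule the_equality)
  show "\<forall>x y. cinner (T \<cdot> x) y = cinner x (S \<cdot> y)" using assms by blast
  fix S' assume "\<forall>x y. cinner (T \<cdot> x) y = cinner x (S' \<cdot> y)"
  then have "cinner (S' \<cdot> y) x = cinner (S \<cdot> y) x" for x y
    using assms by (metis cinner_commute)
  then show "S' = S" by (intro cop_eqI cinner_eqI)
qed

lemma adjoint_right: "cinner (T \<cdot> x) y = cinner x (adjoint_cop T \<cdot> y)"
  using adjoint_exists[of T] adjoint_cop_eqI[of T] by metis

lemma adjoint_left: "cinner (adjoint_cop T \<cdot> x) y = cinner x (T \<cdot> y)"
  by (metis adjoint_right cinner_commute)

lemma adjoint_adjoint [simp]: "adjoint_cop (adjoint_cop T) = T"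
  by (intro adjoint_cop_eqI adjoint_left)

lemma adjoint_simps [simp]:
  "adjoint_cop (S + T) = adjoint_cop S + adjoint_cop T"
  "adjoint_cop (S - T) = adjoint_cop S - adjoint_cop T"
  "adjoint_cop (- T) = - adjoint_cop T"
  "adjoint_cop (c *\<^sub>C T) = cnj c *\<^sub>C adjoint_cop T"
  "adjoint_cop (r *\<^sub>R T) = r *\<^sub>R adjoint_cop T"
  "adjoint_cop (S * T) = adjoint_cop T * adjoint_cop S"
  "adjoint_cop 1 = 1" "adjoint_cop 0 = 0"
  by (rule adjoint_cop_eqI; simp add: cinner_bilinear adjoint_right)+

lemma norm_adjoint [simp]: "norm (adjoint_cop T) = norm T"
proof -
  have *: "norm (adjoint_cop T) \<le> norm T" for T :: "'a cop"
  proof (rule norm_cop_bound)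
    fix x
    have "(norm (adjoint_cop T \<cdot> x))\<^sup>2 = cmod (cinner (T \<cdot> adjoint_cop T \<cdot> x) x)"
      by (simp add: adjoint_right cinner_self_norm del: of_real_power)
    also have "\<dots> \<le> (norm T * norm (adjoint_cop T \<cdot> x)) * norm x"
      by (rule order_trans[OF cmod_cinner_le]) (intro mult_right_mono norm_cop_apply norm_ge_zero)
    finally have "norm (adjoint_cop T \<cdot> x) * norm (adjoint_cop T \<cdot> x) \<le>
        norm (adjoint_cop T \<cdot> x) * (norm T * norm x)"
      by (simp add: mult_ac power2_eq_square)
    then show "norm (adjoint_cop T \<cdot> x) \<le> norm T * norm x"
      by (cases "norm (adjoint_cop T \<cdot> x) = 0") auto
  qed simp
  show ?thesis using *[of T] *[of "adjoint_cop T"] by simp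
qed

section \<open>Positive operators, square roots and resolvents\<close>

lemma tendsto_cop_apply: "(f \<longlongrightarrow> T) F \<Longrightarrow> ((\<lambda>n. f n \<cdot> x) \<longlongrightarrow> T \<cdot> x) F"
  by (rule bounded_linear.tendsto[OF bounded_linear_cop_apply_left])

text \<open>Polarization over the complex numbers.\<close>

lemma cop_eq_0I:
  assumes "\<And>x. cinner (D \<cdot> x) x = 0"
  shows "D = 0"
proof (intro cop_eqI cinner_eqI)
  fix x y
  have "cinner (D \<cdot> x) y + cinner (D \<cdot> y) x = 0"
    using assms[of "x + y"] by (simp add: cinner_bilinear assms add.commute)
  moreover have "- \<i> * cinner (D \<cdot> x) y + \<i> * cinner (D \<cdot> y) x = 0"
    using assms[of "x + \<i> *\<^sub>C y"] assms[of y] by (simp add: cinner_bilinear assms)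
  then have "\<i> * (cinner (D \<cdot> y) x - cinner (D \<cdot> x) y) = 0" by (simp add: algebra_simps)
  ultimately show "cinner (D \<cdot> x) y = cinner (0 \<cdot> x) y" by simp
qed

lemma positive_cop_selfadjoint: "positive_cop P \<Longrightarrow> adjoint_cop P = P"
proof -
  assume P: "positive_cop P"
  have "cinner ((P - adjoint_cop P) \<cdot> x) x = 0" for x
  proof -
    have "cinner (P \<cdot> x) x = cnj (cinner (P \<cdot> x) x)"
      using P by (simp add: positive_cop_def Reals_cnj_iff)
    then show ?thesis by (simp add: cinner_bilinear adjoint_left) (metis cinner_commute)
  qed
  then have "P - adjoint_cop P = 0" by (rule cop_eq_0I)
  then show ?thesis by simp
qed

lemma selfadjoint_cinner_real:
  assumes "adjoint_cop P = P"
  shows "cinner (P \<cdot> x) x \<in> \<real>"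
  using adjoint_right[of P x x] assms by (metis Reals_cnj_iff cinner_commute)

lemma positive_copI: "adjoint_cop P = P \<Longrightarrow> (\<And>x. 0 \<le> Re (cinner (P \<cdot> x) x)) \<Longrightarrow> positive_cop P"
  by (simp add: positive_cop_def selfadjoint_cinner_real)

lemma positive_copD: "positive_cop P \<Longrightarrow> 0 \<le> Re (cinner (P \<cdot> x) x)"
  by (simp add: positive_cop_def)

lemma positive_adjoint_times: "positive_cop (adjoint_cop T * T)"
  by (intro positive_copI) (simp_all add: adjoint_left cinner_self_norm flip: of_real_power)

lemma norm_sq_diff: "(norm (x - y :: 'a ell2))\<^sup>2 = (norm x)\<^sup>2 - 2 * Re (cinner y x) + (norm y)\<^sup>2"
proof -
  have "Re (cinner x y) = Re (cinner y x)" by (subst cinner_commute) simp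
  then show ?thesis by (simp add: norm_sq_cinner cinner_bilinear)
qed

lemma norm_sq_add: "(norm (x + y :: 'a ell2))\<^sup>2 = (norm x)\<^sup>2 + 2 * Re (cinner y x) + (norm y)\<^sup>2"
proof -
  have "Re (cinner x y) = Re (cinner y x)" by (subst cinner_commute) simp
  then show ?thesis by (simp add: norm_sq_cinner cinner_bilinear)
qed

text \<open>The Cauchy--Schwarz inequality for the form \<open>\<langle>P x, y\<rangle>\<close>, taken at \<open>y = P x\<close>; the proof
  evaluates the form at \<open>x - c\<^sup>-\<^sup>1 P x\<close>.\<close>

lemma positive_cop_norm_sq:
  assumes P: "positive_cop P" and c: "norm P \<le> c"
  shows "(norm (P \<cdot> x))\<^sup>2 \<le> c * Re (cinner (P \<cdot> x) x)"
proof (cases "c = 0")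
  case True
  then show ?thesis using c by simp
next
  case False
  then have c0: "c > 0" using c norm_ge_zero[of P] by linarith
  define y where "y = x - (1/c) *\<^sub>R (P \<cdot> x)"
  have a: "cinner (P \<cdot> P \<cdot> x) x = cinner (P \<cdot> x) (P \<cdot> x)"
    using positive_cop_selfadjoint[OF P] adjoint_right[of P "P \<cdot> x" x] by simp
  have "0 \<le> Re (cinner (P \<cdot> y) y)" by (rule positive_copD[OF P])
  also have "\<dots> = Re (cinner (P \<cdot> x) x) - 2 / c * (norm (P \<cdot> x))\<^sup>2
      + (1/c)\<^sup>2 * Re (cinner (P \<cdot> P \<cdot> x) (P \<cdot> x))"
    by (simp add: y_def cinner_bilinear a cinner_self_norm power2_eq_square algebra_simps)
  also have "Re (cinner (P \<cdot> P \<cdot> x) (P \<cdot> x)) \<le> c * (norm (P \<cdot> x))\<^sup>2"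
  proof -
    have "Re (cinner (P \<cdot> P \<cdot> x) (P \<cdot> x)) \<le> norm (P \<cdot> P \<cdot> x) * norm (P \<cdot> x)"
      by (rule order_trans[OF complex_Re_le_cmod cmod_cinner_le])
    also have "\<dots> \<le> (c * norm (P \<cdot> x)) * norm (P \<cdot> x)"
      by (intro mult_right_mono order_trans[OF norm_cop_apply]) (use c in auto)
    finally show ?thesis by (simp add: power2_eq_square mult_ac)
  qed
  finally have "0 \<le> Re (cinner (P \<cdot> x) x) - 2 / c * (norm (P \<cdot> x))\<^sup>2 + (1/c)\<^sup>2 * (c * (norm (P \<cdot> x))\<^sup>2)"
    by (simp add: mult_left_mono)
  also have "(1/c)\<^sup>2 * (c * (norm (P \<cdot> x))\<^sup>2) = 1 / c * (norm (P \<cdot> x))\<^sup>2"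
    using c0 by (simp add: power2_eq_square)
  finally have "1 / c * (norm (P \<cdot> x))\<^sup>2 \<le> Re (cinner (P \<cdot> x) x)" by linarith
  then show ?thesis using c0 by (simp add: field_simps)
qed

lemma positive_cop_form_0:
  assumes "positive_cop P" "Re (cinner (P \<cdot> x) x) = 0"
  shows "P \<cdot> x = 0"
  using positive_cop_norm_sq[OF assms(1) order_refl, of x] assms(2) by simp

text \<open>This makes \<open>P\<close> accessible to power series in \<open>1 - c\<^sup>-\<^sup>1 P\<close>, both for the square root and, with
  \<open>c\<close> enlarged by \<open>\<epsilon>\<close>, for the Neumann series of \<open>(P + \<epsilon>)\<^sup>-\<^sup>1\<close>.\<close>

lemma norm_scalar_minus_positive:
  assumes P: "positive_cop P" and c: "norm P \<le> c"
  shows "norm (c *\<^sub>R 1 - P) \<le> c"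
proof (rule norm_cop_bound)
  show c0: "0 \<le> c" using c norm_ge_zero[of P] by linarith
  fix x
  have "(norm ((c *\<^sub>R 1 - P) \<cdot> x))\<^sup>2 = c\<^sup>2 * (norm x)\<^sup>2 - 2 * (c * Re (cinner (P \<cdot> x) x)) + (norm (P \<cdot> x))\<^sup>2"
    using c0 by (simp add: norm_sq_diff cinner_bilinear power_mult_distrib)
  also have "\<dots> \<le> c\<^sup>2 * (norm x)\<^sup>2 - c * Re (cinner (P \<cdot> x) x)"
    using positive_cop_norm_sq[OF P c, of x] by simp
  also have "\<dots> \<le> (c * norm x)\<^sup>2"
    using c0 positive_copD[OF P, of x] by (simp add: power_mult_distrib)
  finally show "norm ((c *\<^sub>R 1 - P) \<cdot> x) \<le> c * norm x"
    using c0 by (simp add: power2_le_iff_abs_le)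
qed

lemma neumann_series:
  fixes b :: "'a :: {real_normed_algebra_1, banach}"
  assumes "norm b < 1"
  shows "(1 - b) * suminf (\<lambda>n. b ^ n) = 1" "suminf (\<lambda>n. b ^ n) * (1 - b) = 1"
proof -
  have s: "summable (\<lambda>n. b ^ n)" using assms by (rule complete_algebra_summable_geometric)
  then have h: "suminf (\<lambda>n. b ^ Suc n) = suminf (\<lambda>n. b ^ n) - 1"
    by (simp only: suminf_split_head power_0)
  have "b * suminf (\<lambda>n. b ^ n) = suminf (\<lambda>n. b ^ Suc n)"
    using suminf_mult[OF s, of b] by simp
  then show "(1 - b) * suminf (\<lambda>n. b ^ n) = 1" by (simp add: left_diff_distrib h del: power_Suc)
  have "suminf (\<lambda>n. b ^ n) * b = suminf (\<lambda>n. b ^ Suc n)"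
    using suminf_mult2[OF s, of b] by (simp add: power_commutes)
  then show "suminf (\<lambda>n. b ^ n) * (1 - b) = 1" by (simp add: right_diff_distrib h del: power_Suc)
qed

definition resolvent_of :: "'a cop \<Rightarrow> real \<Rightarrow> 'a cop \<Rightarrow> bool" where
  "resolvent_of P e A \<longleftrightarrow> A * (P + e *\<^sub>R 1) = 1 \<and> (P + e *\<^sub>R 1) * A = 1"

lemma resolvent_exists:
  assumes P: "positive_cop P" and e: "e > 0"
  shows "\<exists>A. resolvent_of P e A"
proof -
  define c where "c = norm P"
  define b where "b = (1 / (c + e)) *\<^sub>R (c *\<^sub>R 1 - P)"
  have ce: "c + e > 0" using e by (simp add: c_def add_nonneg_pos)
  have "norm b \<le> 1 / (c + e) * c"
    using norm_scalar_minus_positive[OF P order_refl] ce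
    by (simp add: b_def c_def divide_right_mono)
  also have "\<dots> < 1" using e ce by simp
  finally have b: "norm b < 1" .
  have "1 - b = (1 / (c + e)) *\<^sub>R ((c + e) *\<^sub>R 1 - (c *\<^sub>R 1 - P))"
    unfolding b_def scaleR_diff_right[of _ "_ *\<^sub>R 1"] using ce by simp
  also have "\<dots> = (1 / (c + e)) *\<^sub>R (P + e *\<^sub>R 1)" by (simp add: scaleR_left_distrib)
  finally have eq: "1 - b = (1 / (c + e)) *\<^sub>R (P + e *\<^sub>R 1)" .
  then have "resolvent_of P e ((1 / (c + e)) *\<^sub>R suminf (\<lambda>n. b ^ n))"
    using neumann_series[OF b] by (simp add: resolvent_of_def)
  then show ?thesis by blast
qed

lemma resolvent_apply:
  assumes "resolvent_of P e A"
  shows "P \<cdot> A \<cdot> x + e *\<^sub>R (A \<cdot> x) = x" "A \<cdot> P \<cdot> x + e *\<^sub>R (A \<cdot> x) = x"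
proof -
  have "((P + e *\<^sub>R 1) * A) \<cdot> x = 1 \<cdot> x" "(A * (P + e *\<^sub>R 1)) \<cdot> x = 1 \<cdot> x"
    using assms by (simp_all only: resolvent_of_def)
  then show "P \<cdot> A \<cdot> x + e *\<^sub>R (A \<cdot> x) = x" "A \<cdot> P \<cdot> x + e *\<^sub>R (A \<cdot> x) = x" by simp_all
qed

lemma resolvent_selfadjoint:
  assumes P: "positive_cop P" and A: "resolvent_of P e A"
  shows "adjoint_cop A = A"
proof -
  have "adjoint_cop ((P + e *\<^sub>R 1) * A) = adjoint_cop 1"
    using A by (simp only: resolvent_of_def)
  then have "adjoint_cop A * (P + e *\<^sub>R 1) = 1"
    by (simp add: positive_cop_selfadjoint[OF P])
  then have "adjoint_cop A * ((P + e *\<^sub>R 1) * A) = A" by (simp flip: mult.assoc)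
  then show ?thesis using A by (simp add: resolvent_of_def)
qed

text \<open>Applied to \<open>P = \<bar>T\<bar>\<close>, where \<open>\<parallel>T z\<parallel> = \<parallel>P z\<parallel>\<close>, this bounds the approximations \<open>T (P + \<epsilon>)\<^sup>-\<^sup>1\<close> of the
  polar part of \<open>T\<close>.\<close>

lemma resolvent_contraction:
  assumes P: "positive_cop P" and e: "e > 0" and A: "resolvent_of P e A"
  shows "norm (P \<cdot> A \<cdot> x) \<le> norm x"
proof -
  let ?y = "A \<cdot> x"
  have "(norm (P \<cdot> ?y))\<^sup>2 \<le> (norm (P \<cdot> ?y))\<^sup>2 + 2 * Re (cinner (e *\<^sub>R ?y) (P \<cdot> ?y)) + (norm (e *\<^sub>R ?y))\<^sup>2"
  proof -
    have "Re (cinner ?y (P \<cdot> ?y)) = Re (cinner (P \<cdot> ?y) ?y)" by (subst cinner_commute) simp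
    then show ?thesis using positive_copD[OF P, of ?y] e by (simp add: cinner_bilinear)
  qed
  also have "\<dots> = (norm x)\<^sup>2"
    unfolding norm_sq_add[symmetric] resolvent_apply(1)[OF A] ..
  finally show ?thesis by (simp add: power2_le_iff_abs_le)
qed

text \<open>The bound \<open>\<parallel>(P + \<epsilon>)\<^sup>-\<^sup>1 P\<^sup>1\<^sup>/\<^sup>2\<parallel> \<le> \<epsilon>\<^sup>-\<^sup>1\<^sup>/\<^sup>2\<close>, obtained without functional calculus from the quadratic
  form of \<open>P + \<epsilon>\<close> at \<open>y = (P + \<epsilon>)\<^sup>-\<^sup>1 P\<^sup>1\<^sup>/\<^sup>2 x\<close>.\<close>

lemma resolvent_root_bound:
  assumes Q: "adjoint_cop Q = Q" and e: "e > 0" and A: "resolvent_of (Q * Q) e A"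
  shows "sqrt e * norm (A \<cdot> Q \<cdot> x) \<le> norm x"
proof -
  let ?y = "A \<cdot> Q \<cdot> x"
  have sym: "cinner (Q \<cdot> u) w = cinner u (Q \<cdot> w)" for u w
    using adjoint_right[of Q u w] Q by simp
  have "Re (cinner ((Q * Q) \<cdot> ?y + e *\<^sub>R ?y) ?y) = Re (cinner (Q \<cdot> x) ?y)"
    unfolding resolvent_apply(1)[OF A] ..
  then have "(norm (Q \<cdot> ?y))\<^sup>2 + e * (norm ?y)\<^sup>2 = Re (cinner x (Q \<cdot> ?y))"
    by (simp add: cinner_bilinear sym norm_sq_cinner)
  also have "\<dots> \<le> norm x * norm (Q \<cdot> ?y)"
    by (rule order_trans[OF complex_Re_le_cmod cmod_cinner_le])
  also have "\<dots> \<le> (norm x)\<^sup>2 + (norm (Q \<cdot> ?y))\<^sup>2"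
    using sum_squares_bound[of "norm x" "norm (Q \<cdot> ?y)"]
      mult_nonneg_nonneg[OF norm_ge_zero[of x] norm_ge_zero[of "Q \<cdot> ?y"]] by linarith
  finally have "(sqrt e * norm ?y)\<^sup>2 \<le> (norm x)\<^sup>2" using e by (simp add: power_mult_distrib)
  then show ?thesis using e by (simp add: power2_le_iff_abs_le abs_mult)
qed

text \<open>The Taylor coefficients of \<open>(1 - x)\<^sup>1\<^sup>/\<^sup>2\<close>.\<close>

definition sqrt_coeff :: "nat \<Rightarrow> real" where
  "sqrt_coeff n = (1/2 gchoose n) * (-1) ^ n"

lemma sqrt_coeff_poch: "sqrt_coeff n = pochhammer (-1/2) n / fact n"
  by (simp add: sqrt_coeff_def gbinomial_pochhammer flip: power_mult_distrib)

lemma sqrt_coeff_0 [simp]: "sqrt_coeff 0 = 1"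
  by (simp add: sqrt_coeff_def)

lemma sqrt_coeff_Suc: "sqrt_coeff (Suc n) \<le> 0"
  by (simp add: sqrt_coeff_poch pochhammer_rec pochhammer_nonneg mult_nonneg_nonneg)

lemma sqrt_coeff_sum: "(\<Sum>n<m. \<bar>sqrt_coeff (Suc n)\<bar>) \<le> 1"
proof -
  have "(\<Sum>n\<le>m. sqrt_coeff n) = (-1) ^ m * (1/2 - 1 gchoose m)"
    unfolding sqrt_coeff_def by (rule gbinomial_sum_lower_neg)
  also have "\<dots> = pochhammer (1/2) m / fact m"
    by (simp add: gbinomial_pochhammer flip: power_mult_distrib)
  also have "\<dots> \<ge> 0" by (simp add: pochhammer_nonneg)
  finally have "0 \<le> (\<Sum>n\<le>m. sqrt_coeff n)" .
  also have "\<dots> = 1 + (\<Sum>n<m. sqrt_coeff (Suc n))"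
    by (simp add: sum.atMost_shift)
  also have "(\<Sum>n<m. sqrt_coeff (Suc n)) = - (\<Sum>n<m. \<bar>sqrt_coeff (Suc n)\<bar>)"
    unfolding sum_negf[symmetric] using sqrt_coeff_Suc by (intro sum.cong) auto
  finally show ?thesis by simp
qed

lemma sqrt_coeff_summable: "summable (\<lambda>n. \<bar>sqrt_coeff n\<bar>)"
  "suminf (\<lambda>n. \<bar>sqrt_coeff (Suc n)\<bar>) \<le> 1"
proof -
  have "summable (\<lambda>n. \<bar>sqrt_coeff (Suc n)\<bar>)"
    by (rule summableI_nonneg_bounded[of _ 1]) (use sqrt_coeff_sum in auto)
  then show "summable (\<lambda>n. \<bar>sqrt_coeff n\<bar>)" by (subst (asm) summable_Suc_iff)
  show "suminf (\<lambda>n. \<bar>sqrt_coeff (Suc n)\<bar>) \<le> 1"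
    by (rule suminf_le_const[OF \<open>summable (\<lambda>n. \<bar>sqrt_coeff (Suc n)\<bar>)\<close> sqrt_coeff_sum])
qed

lemma sqrt_coeff_convolution:
  "(\<Sum>k\<le>n. sqrt_coeff k * sqrt_coeff (n - k)) = (if n = 0 then 1 else if n = 1 then -1 else 0)"
proof -
  have "(\<Sum>k\<le>n. sqrt_coeff k * sqrt_coeff (n - k)) =
      (\<Sum>k\<le>n. (1/2 gchoose k) * (1/2 gchoose (n - k)) * (-1) ^ n)"
    by (intro sum.cong refl) (auto simp: sqrt_coeff_def power_add[symmetric] mult_ac)
  also have "\<dots> = (\<Sum>k\<le>n. (1/2 gchoose k) * (1/2 gchoose (n - k))) * (-1) ^ n"
    by (simp add: sum_distrib_right)
  also have "\<dots> = (1/2 + 1/2 gchoose n) * (-1 :: real) ^ n"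
    by (simp only: atMost_atLeast0 gbinomial_Vandermonde)
  also have "(1/2 + 1/2 gchoose n) = real (1 choose n)" by (simp add: binomial_gbinomial)
  finally show ?thesis by (auto simp: binomial_eq_0)
qed

lemma bounded_linear_adjoint: "bounded_linear (adjoint_cop :: 'a cop \<Rightarrow> 'a cop)"
  by (rule bounded_linear_intro[where K = 1]) auto

lemma adjoint_power: "adjoint_cop (T ^ n) = adjoint_cop T ^ n"
  by (induction n) (simp_all add: power_commutes)

text \<open>The square root of \<open>A = c (1 - B)\<close> with \<open>\<parallel>B\<parallel> \<le> 1\<close> is the binomial series of \<open>(1 - B)\<^sup>1\<^sup>/\<^sup>2\<close>. It
  converges at the boundary because the coefficients after the first are negative with sum at
  least \<open>-1\<close>, which also gives positivity.\<close>

lemma positive_sqrt_exists: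
  assumes A: "positive_cop A"
  shows "\<exists>Q. positive_cop Q \<and> Q * Q = A \<and> (\<forall>S. S * A = A * S \<longrightarrow> S * Q = Q * S)"
proof (cases "A = 0")
  case True
  then show ?thesis by (intro exI[of _ 0]) (auto simp: positive_cop_def)
next
  case False
  define c where "c = norm A"
  define b where "b = (1 / c) *\<^sub>R (c *\<^sub>R 1 - A)"
  have c: "c > 0" using False by (simp add: c_def)
  have "norm b \<le> 1"
    using norm_scalar_minus_positive[OF A order_refl] c by (simp add: b_def c_def)
  then have bn: "norm (b ^ n) \<le> 1" for n
    by (metis norm_power_ineq order_trans power_le_one norm_ge_zero)
  have Ab: "A = c *\<^sub>R (1 - b)" using c by (simp add: b_def scaleR_diff_right)
  have badj: "adjoint_cop b = b" by (simp add: b_def positive_cop_selfadjoint[OF A])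
  define f where "f n = sqrt_coeff n *\<^sub>R b ^ n" for n
  have nf: "norm (f n) \<le> \<bar>sqrt_coeff n\<bar>" for n
    using mult_left_mono[OF bn[of n], of "\<bar>sqrt_coeff n\<bar>"] by (simp add: f_def)
  have sn: "summable (\<lambda>n. norm (f n))"
    by (rule summable_comparison_test[OF _ sqrt_coeff_summable(1)]) (use nf in auto)
  then have sf: "summable f" by (rule summable_norm_cancel)
  define R where "R = suminf f"
  have "R * R = suminf (\<lambda>n. \<Sum>i\<le>n. f i * f (n - i))"
    unfolding R_def using Cauchy_product[OF sn sn] .
  also have "(\<lambda>n. \<Sum>i\<le>n. f i * f (n - i)) =
      (\<lambda>n. (if n = 0 then 1 else if n = 1 then -1 else 0) *\<^sub>R b ^ n)"
  proof
    fix n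
    have "(\<Sum>i\<le>n. f i * f (n - i)) = (\<Sum>i\<le>n. (sqrt_coeff i * sqrt_coeff (n - i)) *\<^sub>R b ^ n)"
      by (intro sum.cong refl) (auto simp: f_def power_add[symmetric] mult_ac)
    then show "(\<Sum>i\<le>n. f i * f (n - i)) = (if n = 0 then 1 else if n = 1 then -1 else 0) *\<^sub>R b ^ n"
      by (simp only: sqrt_coeff_convolution flip: scaleR_sum_left)
  qed
  also have "suminf \<dots> = (\<Sum>n\<in>{0, 1}. (if n = 0 then 1 else if n = 1 then -1 else 0) *\<^sub>R b ^ n)"
    by (rule suminf_finite) auto
  also have "\<dots> = 1 - b" by simp
  finally have RR: "R * R = 1 - b" .
  have Radj: "adjoint_cop R = R"
    unfolding R_def bounded_linear.suminf[OF bounded_linear_adjoint sf]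
    by (simp add: f_def[abs_def] adjoint_power badj)
  have "R = f 0 + suminf (\<lambda>n. f (Suc n))" unfolding R_def using suminf_split_head[OF sf] by simp
  then have R1: "R - 1 = suminf (\<lambda>n. f (Suc n))" by (simp add: f_def)
  have "norm (R - 1) \<le> suminf (\<lambda>n. \<bar>sqrt_coeff (Suc n)\<bar>)"
    unfolding R1
  proof (rule norm_suminf_le[OF nf])
    show "summable (\<lambda>n. \<bar>sqrt_coeff (Suc n)\<bar>)"
      using sqrt_coeff_summable(1) by (subst summable_Suc_iff)
  qed
  then have R2: "norm (R - 1) \<le> 1" using sqrt_coeff_summable(2) by linarith
  have Rpos: "positive_cop R"
  proof (rule positive_copI[OF Radj])
    fix x
    have "cmod (cinner ((R - 1) \<cdot> x) x) \<le> norm ((R - 1) \<cdot> x) * norm x" by (rule cmod_cinner_le)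
    also have "\<dots> \<le> (1 * norm x) * norm x"
      by (intro mult_right_mono order_trans[OF norm_cop_apply]) (use R2 in auto)
    finally have "\<bar>Re (cinner ((R - 1) \<cdot> x) x)\<bar> \<le> (norm x)\<^sup>2"
      using abs_Re_le_cmod order_trans by (fastforce simp: power2_eq_square)
    then show "0 \<le> Re (cinner (R \<cdot> x) x)" by (simp add: cinner_bilinear norm_sq_cinner)
  qed
  have comm: "S * R = R * S" if "S * A = A * S" for S
  proof -
    have "S * b = b * S" using that by (simp add: b_def algebra_simps)
    then have "S * b ^ n = b ^ n * S" for n by (metis power_commuting_commutes)
    then have "S * f n = f n * S" for n by (simp add: f_def)
    then show ?thesis
      unfolding R_def using suminf_mult[OF sf, of S] suminf_mult2[OF sf, of S] by simp
  qed
  have "positive_cop (sqrt c *\<^sub>R R)"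
    using Rpos c by (intro positive_copI) (auto simp: Radj cinner_bilinear positive_copD)
  moreover have "(sqrt c *\<^sub>R R) * (sqrt c *\<^sub>R R) = A" using c by (simp add: RR Ab)
  moreover have "\<forall>S. S * A = A * S \<longrightarrow> S * (sqrt c *\<^sub>R R) = (sqrt c *\<^sub>R R) * S"
    using comm by simp
  ultimately show ?thesis by blast
qed

text \<open>The root \<open>R\<close> given by the power series commutes with every positive root \<open>S\<close>. So
  \<open>(S + R) (S - R) = 0\<close>, and positivity separates this into \<open>S y = 0\<close> and \<open>R y = 0\<close> on the range of
  \<open>S - R\<close>.\<close>

lemma positive_sqrt_unique:
  assumes "positive_cop P" "positive_cop Q" "P * P = Q * Q"
  shows "P = Q"
proof -
  obtain R where R: "positive_cop R" "R * R = P * P" "\<And>S. S * (P * P) = P * P * S \<Longrightarrow> S * R = R * S"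
    using positive_sqrt_exists[OF positive_adjoint_times[of P]]
    unfolding positive_cop_selfadjoint[OF assms(1)] by blast
  have *: "S = R" if S: "positive_cop S" "S * S = P * P" for S
  proof (rule cop_eqI)
    fix x
    define y where "y = S \<cdot> x - R \<cdot> x"
    have "S * R = R * S" by (rule R(3)) (metis S(2) mult.assoc)
    then have "(S + R) * (S - R) = 0" by (simp add: algebra_simps S(2) R(2))
    moreover have "S \<cdot> y + R \<cdot> y = ((S + R) * (S - R)) \<cdot> x" by (simp add: y_def)
    ultimately have 0: "S \<cdot> y + R \<cdot> y = 0" by simp
    then have "Re (cinner (S \<cdot> y) y) + Re (cinner (R \<cdot> y) y) = 0"
      by (metis cinner_add_left cinner_zero_left plus_complex.sel(1) zero_complex.sel(1))
    then have "S \<cdot> y = 0" "R \<cdot> y = 0"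
      using positive_copD[OF S(1), of y] positive_copD[OF R(1), of y]
        positive_cop_form_0[OF S(1), of y] positive_cop_form_0[OF R(1), of y] by linarith+
    then have "cinner (S \<cdot> x - R \<cdot> x) y = 0"
      using adjoint_right[of S x y] adjoint_right[of R x y] positive_cop_selfadjoint[OF S(1)]
        positive_cop_selfadjoint[OF R(1)] by (simp add: cinner_bilinear)
    then show "S \<cdot> x = R \<cdot> x" by (simp flip: y_def) (simp add: y_def)
  qed
  show ?thesis using *[of P] *[of Q] assms by simp
qed

lemma abs_cop: "positive_cop (abs_cop T)" "abs_cop T * abs_cop T = adjoint_cop T * T"
proof -
  have "\<exists>!P. positive_cop P \<and> P * P = adjoint_cop T * T"
    using positive_sqrt_exists[OF positive_adjoint_times[of T]] positive_sqrt_unique by metis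
  from theI'[OF this] show "positive_cop (abs_cop T)" "abs_cop T * abs_cop T = adjoint_cop T * T"
    unfolding abs_cop_def by blast+
qed

lemma norm_abs_cop_apply: "norm (abs_cop T \<cdot> x) = norm (T \<cdot> x)"
proof -
  have "(norm (abs_cop T \<cdot> x))\<^sup>2 = Re (cinner ((abs_cop T * abs_cop T) \<cdot> x) x)"
    using adjoint_right[of "abs_cop T" "abs_cop T \<cdot> x" x]
    unfolding positive_cop_selfadjoint[OF abs_cop(1)] by (simp add: norm_sq_cinner)
  also have "\<dots> = (norm (T \<cdot> x))\<^sup>2"
    unfolding abs_cop(2) by (simp add: norm_sq_cinner adjoint_left)
  finally show ?thesis by simp
qed

section \<open>Nuclear operators\<close>

text \<open>Trace class operators are handled through expansions \<open>\<Sum>\<^sub>i \<langle>\<cdot>, y\<^sub>i\<rangle> x\<^sub>i\<close> with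
  \<open>\<Sum>\<^sub>i \<parallel>x\<^sub>i\<parallel> \<parallel>y\<^sub>i\<parallel> \<le> c\<close>. With the sum of two expansions as a separate generating rule, the index
  type stays fixed, and each property is proved for one expansion and for sums.\<close>

inductive nuclear :: "real \<Rightarrow> 'a cop \<Rightarrow> bool" where
  expansion: "(\<lambda>i :: 'a. norm (x i :: 'a ell2) * norm (y i :: 'a ell2)) summable_on UNIV \<Longrightarrow>
    (\<Sum>\<^sub>\<infinity>i. norm (x i) * norm (y i)) \<le> c \<Longrightarrow>
    (\<And>u. ((\<lambda>i. cinner u (y i) *\<^sub>C x i) has_sum X \<cdot> u) UNIV) \<Longrightarrow> nuclear c X"
| plus: "nuclear c X \<Longrightarrow> nuclear d Y \<Longrightarrow> nuclear (c + d) (X + Y)"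

lemma nuclear_mono: "nuclear c X \<Longrightarrow> c \<le> d \<Longrightarrow> nuclear d X"
proof (induction arbitrary: d rule: nuclear.induct)
  case (expansion x y c X)
  then show ?case by (intro nuclear.expansion[of x y]) auto
next
  case (plus c X c' Y)
  then show ?case using nuclear.plus[of "d - c'" X c' Y] by simp
qed

lemma nuclear_nonneg: "nuclear c X \<Longrightarrow> 0 \<le> c"
proof (induction rule: nuclear.induct)
  case (expansion x y c X)
  have "0 \<le> (\<Sum>\<^sub>\<infinity>i. norm (x i) * norm (y i))" by (intro infsum_nonneg) auto
  then show ?case using expansion(2) by linarith
qed auto

lemma infsum_bounded_le:
  fixes f g :: "'i \<Rightarrow> real"
  assumes "f summable_on UNIV" "\<And>i. 0 \<le> g i" "\<And>i. g i \<le> K * f i"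
  shows "g summable_on UNIV" "infsum g UNIV \<le> K * infsum f UNIV"
proof -
  have s: "(\<lambda>i. K * f i) summable_on UNIV" using assms(1) by (rule summable_on_cmult_right)
  show "g summable_on UNIV" by (rule summable_on_comparison_test[OF s]) (use assms in auto)
  then have "infsum g UNIV \<le> infsum (\<lambda>i. K * f i) UNIV"
    by (intro infsum_mono s) (use assms in auto)
  then show "infsum g UNIV \<le> K * infsum f UNIV" by (simp add: infsum_cmult_right')
qed

lemma norm_apply_mult_le: "norm (A \<cdot> x) * norm y \<le> norm A * (norm x * norm y)"
  using mult_right_mono[OF norm_cop_apply[of A x] norm_ge_zero[of y]] by (simp add: mult_ac)

lemma norm_mult_adjoint_le: "norm x * norm (adjoint_cop A \<cdot> y) \<le> norm A * (norm x * norm y)"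
  using norm_apply_mult_le[of "adjoint_cop A" y x] by (simp add: mult_ac)

lemma nuclear_mult_left: "nuclear c X \<Longrightarrow> nuclear (norm A * c) (A * X)"
proof (induction rule: nuclear.induct)
  case (expansion x y c X)
  note b = infsum_bounded_le[OF expansion(1) _ norm_apply_mult_le]
  show ?case
  proof (rule nuclear.expansion)
    show "(\<lambda>i. norm (A \<cdot> x i) * norm (y i)) summable_on UNIV" by (rule b) auto
    have "(\<Sum>\<^sub>\<infinity>i. norm (A \<cdot> x i) * norm (y i)) \<le> norm A * (\<Sum>\<^sub>\<infinity>i. norm (x i) * norm (y i))"
      by (rule b) auto
    also have "\<dots> \<le> norm A * c" using expansion(2) by (intro mult_left_mono) auto
    finally show "(\<Sum>\<^sub>\<infinity>i. norm (A \<cdot> x i) * norm (y i)) \<le> norm A * c" .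
    show "((\<lambda>i. cinner u (y i) *\<^sub>C A \<cdot> x i) has_sum (A * X) \<cdot> u) UNIV" for u
      using has_sum_bounded_linear[OF bounded_linear_cop_apply[of A] expansion(3)[of u]]
      by (simp add: o_def)
  qed
next
  case (plus c X d Y)
  show ?case using nuclear.plus[OF plus.IH] by (simp add: distrib_left distrib_right)
qed

lemma nuclear_mult_right: "nuclear c X \<Longrightarrow> nuclear (c * norm A) (X * A)"
proof (induction rule: nuclear.induct)
  case (expansion x y c X)
  note b = infsum_bounded_le[OF expansion(1) _ norm_mult_adjoint_le]
  show ?case
  proof (rule nuclear.expansion)
    show "(\<lambda>i. norm (x i) * norm (adjoint_cop A \<cdot> y i)) summable_on UNIV" by (rule b) auto
    have "(\<Sum>\<^sub>\<infinity>i. norm (x i) * norm (adjoint_cop A \<cdot> y i)) \<le> norm A * (\<Sum>\<^sub>\<infinity>i. norm (x i) * norm (y i))"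
      by (rule b) auto
    also have "\<dots> \<le> norm A * c" using expansion(2) by (intro mult_left_mono) auto
    finally show "(\<Sum>\<^sub>\<infinity>i. norm (x i) * norm (adjoint_cop A \<cdot> y i)) \<le> c * norm A"
      by (simp add: mult.commute)
    show "((\<lambda>i. cinner u (adjoint_cop A \<cdot> y i) *\<^sub>C x i) has_sum (X * A) \<cdot> u) UNIV" for u
      using expansion(3)[of "A \<cdot> u"] by (simp add: adjoint_right)
  qed
next
  case (plus c X d Y)
  show ?case using nuclear.plus[OF plus.IH] by (simp add: distrib_left distrib_right)
qed

lemma nuclear_minus: "nuclear c X \<Longrightarrow> nuclear c (- X)"
  using nuclear_mult_left[of c X "-1"] by simp

lemma nuclear_diff: "nuclear c X \<Longrightarrow> nuclear d Y \<Longrightarrow> nuclear (c + d) (X - Y)"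
  using nuclear.plus[OF _ nuclear_minus, of c X d Y] by simp

lemma nuclear_scaleC: "nuclear c X \<Longrightarrow> nuclear (cmod k * c) (k *\<^sub>C X)"
proof -
  assume X: "nuclear c X"
  have "norm (k *\<^sub>C 1 :: 'a cop) \<le> cmod k"
    by (rule norm_cop_bound) (simp_all add: norm_scaleC_ell2)
  then have le: "norm (k *\<^sub>C 1 :: 'a cop) * c \<le> cmod k * c"
    using nuclear_nonneg[OF X] by (rule mult_right_mono)
  have "nuclear (cmod k * c) ((k *\<^sub>C 1) * X)"
    by (rule nuclear_mono[OF nuclear_mult_left[OF X] le])
  also have "(k *\<^sub>C 1) * X = k *\<^sub>C X" by (simp add: scaleC_times_cop(1))
  finally show ?thesis .
qed

lemma nuclear_0: "nuclear 0 0"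
  by (rule nuclear.expansion[of "\<lambda>_. 0" "\<lambda>_. 0"]) (simp_all add: scaleC_zero_ell2)

lemma nuclear_sum:
  assumes "finite F" "\<And>k. k \<in> F \<Longrightarrow> nuclear (c k) (X k)"
  shows "nuclear (sum c F) (sum X F)"
  using assms
proof (induction F rule: finite_induct)
  case (insert a F)
  then show ?case using nuclear.plus[of "c a" "X a" "sum c F" "sum X F"] by simp
qed (simp add: nuclear_0)

lemma nuclear_rank_one:
  assumes X: "\<And>u. X \<cdot> u = cinner u b *\<^sub>C a"
  shows "nuclear (norm a * norm b) X"
proof (rule nuclear.expansion)
  fix k :: 'a
  define y where "y i = (if i = k then b else 0)" for i :: 'a
  have s: "((\<lambda>i. norm a * norm (y i)) has_sum norm a * norm b) UNIV"
    by (rule has_sum_finite_neutralI[of "{k}"]) (auto simp: y_def)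
  show "(\<lambda>i. norm a * norm (y i)) summable_on UNIV" using s by (rule has_sum_imp_summable)
  show "(\<Sum>\<^sub>\<infinity>i. norm a * norm (y i)) \<le> norm a * norm b" using infsumI[OF s] by simp
  show "((\<lambda>i. cinner u (y i) *\<^sub>C a) has_sum X \<cdot> u) UNIV" for u
    by (rule has_sum_finite_neutralI[of "{k}"]) (auto simp: y_def X intro!: ell2_eqI)
qed

lemma has_sum_sum:
  assumes "\<And>k. k \<in> F \<Longrightarrow> (f k has_sum g k) A"
  shows "((\<lambda>i. \<Sum>k\<in>F. f k i :: 'b :: {topological_comm_monoid_add}) has_sum (\<Sum>k\<in>F. g k)) A"
  using assms by (induction F rule: infinite_finite_induct) (auto intro: has_sum_add)

lemma sum_coord_product_le:
  assumes "finite F"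
  shows "(\<Sum>k\<in>F. cmod (coord x k) * cmod (coord y k)) \<le> norm x * norm y"
proof -
  have "(\<Sum>k\<in>F. cmod (coord x k) * cmod (coord y k)) \<le>
      L2_set (\<lambda>k. cmod (coord x k)) F * L2_set (\<lambda>k. cmod (coord y k)) F"
    using L2_set_mult_ineq[of "\<lambda>k. cmod (coord x k)" "\<lambda>k. cmod (coord y k)" F] by simp
  also have "\<dots> \<le> norm x * norm y"
    unfolding L2_set_def
    by (intro mult_mono real_le_lsqrt coord_norm_finite assms) (auto simp: sum_nonneg)
  finally show ?thesis .
qed

lemma coord_product_summable:
  "(\<lambda>k. cmod (coord x k * cnj (coord y k))) summable_on UNIV"
  "(\<Sum>\<^sub>\<infinity>k. cmod (coord x k * cnj (coord y k))) \<le> norm x * norm y"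
proof -
  show s: "(\<lambda>k. cmod (coord x k * cnj (coord y k))) summable_on UNIV"
    by (rule nonneg_bdd_above_summable_on)
      (auto intro!: bdd_aboveI2[where M = "norm x * norm y"] simp: norm_mult sum_coord_product_le)
  show "(\<Sum>\<^sub>\<infinity>k. cmod (coord x k * cnj (coord y k))) \<le> norm x * norm y"
    by (rule infsum_le_finite_sums[OF s]) (simp add: norm_mult sum_coord_product_le)
qed

lemma coord_expansion:
  assumes "((\<lambda>i. cinner u (y i) *\<^sub>C x i) has_sum z) UNIV"
  shows "((\<lambda>i. cinner u (y i) * coord (x i) k) has_sum coord z k) UNIV"
  using has_sum_bounded_linear[OF bounded_linear_cinner_left[of "ket k"] assms]
  by (simp add: o_def)

lemma nuclear_diagonal_le:
  assumes "nuclear c X" "finite F"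
  shows "(\<Sum>k\<in>F. cmod (coord (X \<cdot> ket k) k)) \<le> c"
  using assms(1)
proof (induction rule: nuclear.induct)
  case (expansion x y c X)
  define h where "h k i = cmod (cinner (ket k) (y i) * coord (x i) k)" for k i
  have hle: "h k i \<le> 1 * (norm (x i) * norm (y i))" for k i
    using sum_coord_product_le[of "{k}" "x i" "y i"] by (simp add: h_def norm_mult mult.commute)
  have hs: "h k summable_on UNIV" for k
    by (rule infsum_bounded_le[OF expansion(1) _ hle]) (simp add: h_def)
  have "(\<Sum>k\<in>F. cmod (coord (X \<cdot> ket k) k)) \<le> (\<Sum>k\<in>F. infsum (h k) UNIV)"
  proof (rule sum_mono)
    fix k
    have "coord (X \<cdot> ket k) k = (\<Sum>\<^sub>\<infinity>i. cinner (ket k) (y i) * coord (x i) k)"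
      using infsumI[OF coord_expansion[OF expansion(3)[of "ket k"], of k]] by simp
    also have "cmod \<dots> \<le> infsum (h k) UNIV"
      unfolding h_def by (rule norm_infsum_bound) (use hs[of k] in \<open>simp add: h_def[abs_def]\<close>)
    finally show "cmod (coord (X \<cdot> ket k) k) \<le> infsum (h k) UNIV" .
  qed
  also have s: "((\<lambda>i. \<Sum>k\<in>F. h k i) has_sum (\<Sum>k\<in>F. infsum (h k) UNIV)) UNIV"
    by (intro has_sum_sum has_sum_infsum hs)
  have "(\<Sum>k\<in>F. infsum (h k) UNIV) \<le> (\<Sum>\<^sub>\<infinity>i. norm (x i) * norm (y i))"
  proof (rule has_sum_mono[OF s has_sum_infsum[OF expansion(1)]])
    show "(\<Sum>k\<in>F. h k i) \<le> norm (x i) * norm (y i)" for i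
      using sum_coord_product_le[OF assms(2), of "x i" "y i"] by (simp add: h_def norm_mult mult.commute)
  qed
  also have "\<dots> \<le> c" by (rule expansion(2))
  finally show ?case .
next
  case (plus c X d Y)
  have "(\<Sum>k\<in>F. cmod (coord ((X + Y) \<cdot> ket k) k)) \<le>
      (\<Sum>k\<in>F. cmod (coord (X \<cdot> ket k) k) + cmod (coord (Y \<cdot> ket k) k))"
    by (intro sum_mono) (simp add: norm_triangle_ineq)
  then show ?case using plus by (simp add: sum.distrib)
qed

lemma nuclear_Trace:
  assumes "nuclear c X"
  shows "(\<lambda>k. coord (X \<cdot> ket k) k) summable_on UNIV" "cmod (Trace X) \<le> c"
proof -
  have s: "(\<lambda>k. cmod (coord (X \<cdot> ket k) k)) summable_on UNIV"
    by (rule nonneg_bdd_above_summable_on)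
      (auto intro!: bdd_aboveI2[where M = c] nuclear_diagonal_le[OF assms])
  then show "(\<lambda>k. coord (X \<cdot> ket k) k) summable_on UNIV" by (rule abs_summable_summable)
  have "cmod (Trace X) \<le> (\<Sum>\<^sub>\<infinity>k. cmod (coord (X \<cdot> ket k) k))"
    unfolding Trace_def using norm_infsum_bound[OF s] by simp
  also have "\<dots> \<le> c"
    by (rule infsum_le_finite_sums[OF s]) (rule nuclear_diagonal_le[OF assms])
  finally show "cmod (Trace X) \<le> c" .
qed

lemma Trace_add: "nuclear c X \<Longrightarrow> nuclear d Y \<Longrightarrow> Trace (X + Y) = Trace X + Trace Y"
  unfolding Trace_def using infsum_add[OF nuclear_Trace(1) nuclear_Trace(1)] by simp

lemma Trace_scaleC: "Trace (k *\<^sub>C X) = k * Trace X"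
  unfolding Trace_def by (simp add: infsum_cmult_right')

lemma Trace_minus: "Trace (- X) = - Trace X"
  unfolding Trace_def by (simp add: infsum_uminus)

lemma Trace_diff: "nuclear c X \<Longrightarrow> nuclear d Y \<Longrightarrow> Trace (X - Y) = Trace X - Trace Y"
  using Trace_add[OF _ nuclear_minus, of c X d Y] by (simp add: Trace_minus)

lemma Trace_0 [simp]: "Trace 0 = 0"
  by (simp add: Trace_def)

text \<open>In coordinates both sides are the two iterated sums of one absolutely summable double
  family.\<close>

lemma Trace_expansion:
  fixes x y :: "'a \<Rightarrow> 'a ell2"
  assumes s: "(\<lambda>i. norm (x i) * norm (y i)) summable_on UNIV"
    and X: "\<And>u. ((\<lambda>i. cinner u (y i) *\<^sub>C x i) has_sum X \<cdot> u) UNIV"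
  shows "Trace X = (\<Sum>\<^sub>\<infinity>i. cinner (x i) (y i))"
proof -
  let ?h = "\<lambda>(i, k). coord (x i) k * cnj (coord (y i) k)"
  have "(\<lambda>p. cmod (?h p)) summable_on UNIV \<times> UNIV"
    unfolding Infinite_Sum.abs_summable_on_Sigma_iff
  proof (intro conjI ballI)
    show "(\<lambda>k. cmod (?h (i, k))) summable_on UNIV" for i
      using coord_product_summable(1) by simp
    have "(\<lambda>i. \<Sum>\<^sub>\<infinity>k. cmod (?h (i, k))) summable_on UNIV"
      by (rule summable_on_comparison_test[OF s]) (use coord_product_summable(2) in \<open>auto intro: infsum_nonneg\<close>)
    then show "(\<lambda>i. norm (\<Sum>\<^sub>\<infinity>k. cmod (?h (i, k)))) summable_on UNIV"
      by (simp add: infsum_nonneg)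
  qed
  then have "?h summable_on UNIV \<times> UNIV" by (rule abs_summable_summable)
  then have "(\<Sum>\<^sub>\<infinity>i. \<Sum>\<^sub>\<infinity>k. coord (x i) k * cnj (coord (y i) k)) =
      (\<Sum>\<^sub>\<infinity>k. \<Sum>\<^sub>\<infinity>i. coord (x i) k * cnj (coord (y i) k))"
    by (rule infsum_swap_banach)
  moreover have "coord (X \<cdot> ket k) k = (\<Sum>\<^sub>\<infinity>i. coord (x i) k * cnj (coord (y i) k))" for k
    using infsumI[OF coord_expansion[OF X[of "ket k"], of k]] by (simp add: mult.commute)
  ultimately show ?thesis unfolding Trace_def cinner_ket_right by (simp add: cinner_coord)
qed

lemma Trace_commute: "nuclear c X \<Longrightarrow> Trace (X * A) = Trace (A * X)"
proof (induction rule: nuclear.induct)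
  case (expansion x y c X)
  have "Trace (X * A) = (\<Sum>\<^sub>\<infinity>i. cinner (x i) (adjoint_cop A \<cdot> y i))"
  proof (rule Trace_expansion)
    show "(\<lambda>i. norm (x i) * norm (adjoint_cop A \<cdot> y i)) summable_on UNIV"
      by (rule infsum_bounded_le[OF expansion(1) _ norm_mult_adjoint_le]) auto
    show "((\<lambda>i. cinner u (adjoint_cop A \<cdot> y i) *\<^sub>C x i) has_sum (X * A) \<cdot> u) UNIV" for u
      using expansion(3)[of "A \<cdot> u"] by (simp add: adjoint_right)
  qed
  also have "\<dots> = (\<Sum>\<^sub>\<infinity>i. cinner (A \<cdot> x i) (y i))" by (simp add: adjoint_right)
  also have "\<dots> = Trace (A * X)"
  proof (rule Trace_expansion[symmetric])
    show "(\<lambda>i. norm (A \<cdot> x i) * norm (y i)) summable_on UNIV"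
      by (rule infsum_bounded_le[OF expansion(1) _ norm_apply_mult_le]) auto
    show "((\<lambda>i. cinner u (y i) *\<^sub>C A \<cdot> x i) has_sum (A * X) \<cdot> u) UNIV" for u
      using has_sum_bounded_linear[OF bounded_linear_cop_apply[of A] expansion(3)[of u]]
      by (simp add: o_def)
  qed
  finally show ?case .
next
  case (plus c X d Y)
  have "Trace ((X + Y) * A) = Trace (X * A) + Trace (Y * A)"
    unfolding distrib_right
    by (rule Trace_add[OF nuclear_mult_right[OF plus.hyps(1)] nuclear_mult_right[OF plus.hyps(2)]])
  also have "\<dots> = Trace (A * (X + Y))"
    unfolding plus.IH distrib_left
    by (rule Trace_add[OF nuclear_mult_left[OF plus.hyps(1)] nuclear_mult_left[OF plus.hyps(2)], symmetric])
  finally show ?case .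
qed

section \<open>Trace class operators are the nuclear operators\<close>

text \<open>With \<open>P = \<bar>T\<bar>\<close> and \<open>Q = P\<^sup>1\<^sup>/\<^sup>2\<close>, the factor \<open>W\<close> plays the role of \<open>V Q\<close> for the polar
  decomposition \<open>T = V P\<close>; it is the norm limit of \<open>T (P + \<epsilon>)\<^sup>-\<^sup>1 Q\<close>, so that no partial isometry has
  to be constructed.\<close>

lemma trace_class_factor:
  assumes Q: "positive_cop Q" "Q * Q = abs_cop T"
  shows "\<exists>W. T = W * Q \<and> (\<forall>x. norm (W \<cdot> x) \<le> norm (Q \<cdot> x))"
proof -
  define P where "P = abs_cop T"
  have P: "positive_cop P" "\<And>z. norm (T \<cdot> z) = norm (P \<cdot> z)"
    by (simp_all add: P_def abs_cop norm_abs_cop_apply)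
  define e where "e n = inverse (real (Suc n))" for n
  have e0: "e n > 0" for n by (simp add: e_def)
  have "\<forall>n. \<exists>A. resolvent_of P (e n) A" using resolvent_exists[OF P(1) e0] by blast
  then obtain A where A: "\<And>n. resolvent_of P (e n) (A n)" by metis
  define W where "W n = T * A n * Q" for n
  have sqe: "(\<lambda>n. sqrt (e n)) \<longlonglongrightarrow> 0"
    unfolding e_def using tendsto_real_sqrt[OF LIMSEQ_inverse_real_of_nat] by simp
  have diff: "norm (W m - W n) \<le> sqrt (e n)" if mn: "n \<le> m" for m n
  proof (rule norm_cop_bound)
    show "0 \<le> sqrt (e n)" using e0[of n] by simp
    fix x
    let ?y = "A n \<cdot> Q \<cdot> x"
    have emn: "e m \<le> e n" using mn by (simp add: e_def field_simps)
    have "A m \<cdot> (P \<cdot> ?y + e n *\<^sub>R ?y) - (A m \<cdot> P \<cdot> ?y + e m *\<^sub>R (A m \<cdot> ?y)) = (e n - e m) *\<^sub>R (A m \<cdot> ?y)"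
      by (simp add: algebra_simps)
    then have "A m \<cdot> Q \<cdot> x - ?y = (e n - e m) *\<^sub>R (A m \<cdot> ?y)"
      unfolding resolvent_apply[OF A] .
    then have "(W m - W n) \<cdot> x = (e n - e m) *\<^sub>R (T \<cdot> A m \<cdot> ?y)"
      unfolding W_def by (simp flip: cop_apply_linear(2,5))
    then have "norm ((W m - W n) \<cdot> x) = (e n - e m) * norm (P \<cdot> A m \<cdot> ?y)"
      using emn by (simp add: P(2))
    also have "\<dots> \<le> e n * norm ?y"
      using e0[of m] emn by (intro mult_mono resolvent_contraction[OF P(1) e0 A]) auto
    also have "\<dots> = sqrt (e n) * (sqrt (e n) * norm ?y)"
      using e0[of n] by (simp flip: mult.assoc)
    also have "\<dots> \<le> sqrt (e n) * norm x"
    proof (rule mult_left_mono)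
      show "sqrt (e n) * norm ?y \<le> norm x"
        by (rule resolvent_root_bound) (use Q A e0 in \<open>auto simp: P_def positive_cop_selfadjoint\<close>)
    qed (use e0[of n] in auto)
    finally show "norm ((W m - W n) \<cdot> x) \<le> sqrt (e n) * norm x" .
  qed
  have "Cauchy W"
  proof (rule metric_CauchyI)
    fix d :: real assume "d > 0"
    then obtain N where N: "\<And>n. n \<ge> N \<Longrightarrow> sqrt (e n) < d"
      using order_tendstoD(2)[OF sqe] by (auto simp: eventually_sequentially)
    have "dist (W m) (W n) < d" if "m \<ge> N" "n \<ge> N" for m n
    proof (cases "n \<le> m")
      case True
      then show ?thesis using diff[OF True] N[OF that(2)] by (simp add: dist_norm)
    next
      case False
      then show ?thesis using diff[of m n] N[OF that(1)] by (simp add: dist_norm norm_minus_commute)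
    qed
    then show "\<exists>M. \<forall>m\<ge>M. \<forall>n\<ge>M. dist (W m) (W n) < d" by blast
  qed
  then obtain V where V: "W \<longlonglongrightarrow> V" using Cauchy_convergent_iff convergent_def by blast
  note Vx = tendsto_cop_apply[OF V]
  have "T \<cdot> x = V \<cdot> Q \<cdot> x" for x
  proof -
    have "(\<lambda>n. T \<cdot> x - W n \<cdot> Q \<cdot> x) \<longlonglongrightarrow> 0"
    proof (rule Lim_null_comparison)
      show "eventually (\<lambda>n. norm (T \<cdot> x - W n \<cdot> Q \<cdot> x) \<le> e n * norm x) sequentially"
      proof (intro always_eventually allI)
        fix n
        have "Q \<cdot> Q \<cdot> x = P \<cdot> x" unfolding P_def Q(2)[symmetric] by simp
        then have "T \<cdot> x - W n \<cdot> Q \<cdot> x = T \<cdot> (A n \<cdot> P \<cdot> x + e n *\<^sub>R (A n \<cdot> x)) - T \<cdot> A n \<cdot> P \<cdot> x"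
          unfolding resolvent_apply[OF A] by (simp add: W_def)
        also have "\<dots> = e n *\<^sub>R (T \<cdot> A n \<cdot> x)" by simp
        finally have "norm (T \<cdot> x - W n \<cdot> Q \<cdot> x) = e n * norm (P \<cdot> A n \<cdot> x)"
          using e0[of n] by (simp add: P(2))
        also have "\<dots> \<le> e n * norm x"
          using e0[of n] by (intro mult_left_mono resolvent_contraction[OF P(1) e0 A]) auto
        finally show "norm (T \<cdot> x - W n \<cdot> Q \<cdot> x) \<le> e n * norm x" .
      qed
      show "(\<lambda>n. e n * norm x) \<longlonglongrightarrow> 0"
        using tendsto_mult_right[OF LIMSEQ_inverse_real_of_nat, of "norm x"]
        by (simp add: e_def)
    qed
    from tendsto_minus[OF this] have "(\<lambda>n. W n \<cdot> Q \<cdot> x - T \<cdot> x) \<longlonglongrightarrow> 0"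
      by simp
    then have "(\<lambda>n. W n \<cdot> Q \<cdot> x) \<longlonglongrightarrow> T \<cdot> x" by (rule LIM_zero_cancel)
    then show ?thesis using Vx[of "Q \<cdot> x"] by (rule LIMSEQ_unique)
  qed
  then have "T = V * Q" by (intro cop_eqI) simp
  moreover have "norm (V \<cdot> x) \<le> norm (Q \<cdot> x)" for x
  proof (rule LIMSEQ_le_const2[OF tendsto_norm[OF Vx]])
    have "norm (W n \<cdot> x) \<le> norm (Q \<cdot> x)" for n
      using resolvent_contraction[OF P(1) e0 A, of n "Q \<cdot> x"] by (simp add: W_def P(2))
    then show "\<exists>N. \<forall>n\<ge>N. norm (W n \<cdot> x) \<le> norm (Q \<cdot> x)" by blast
  qed
  ultimately show ?thesis by blast
qed

lemma trace_class_nuclear: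
  assumes T: "trace_class T"
  shows "nuclear (trace_norm T) T"
proof -
  obtain Q where Q: "positive_cop Q" "Q * Q = abs_cop T"
    using positive_sqrt_exists[OF abs_cop(1)] by blast
  obtain W where W: "T = W * Q" "\<And>x. norm (W \<cdot> x) \<le> norm (Q \<cdot> x)"
    using trace_class_factor[OF Q] by blast
  have sym: "cinner (Q \<cdot> u) w = cinner u (Q \<cdot> w)" for u w
    using adjoint_right[of Q u w] positive_cop_selfadjoint[OF Q(1)] by simp
  have d: "Re (cinner (abs_cop T \<cdot> ket i) (ket i)) = (norm (Q \<cdot> ket i))\<^sup>2" for i
    unfolding Q(2)[symmetric] by (simp add: norm_sq_cinner sym del: cinner_ket_right)
  have le: "norm (W \<cdot> ket i) * norm (Q \<cdot> ket i) \<le> 1 * (norm (Q \<cdot> ket i))\<^sup>2" for i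
    using W(2)[of "ket i"] by (simp add: power2_eq_square mult_right_mono)
  have s: "(\<lambda>i. (norm (Q \<cdot> ket i))\<^sup>2) summable_on UNIV"
    using T unfolding trace_class_def d .
  show ?thesis
  proof (rule nuclear.expansion)
    show "(\<lambda>i. norm (W \<cdot> ket i) * norm (Q \<cdot> ket i)) summable_on UNIV"
      by (rule infsum_bounded_le[OF s _ le]) auto
    have "(\<Sum>\<^sub>\<infinity>i. norm (W \<cdot> ket i) * norm (Q \<cdot> ket i)) \<le> 1 * (\<Sum>\<^sub>\<infinity>i. (norm (Q \<cdot> ket i))\<^sup>2)"
      by (rule infsum_bounded_le[OF s _ le]) auto
    then show "(\<Sum>\<^sub>\<infinity>i. norm (W \<cdot> ket i) * norm (Q \<cdot> ket i)) \<le> trace_norm T"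
      by (simp only: trace_norm_def d mult_1)
    show "((\<lambda>i. cinner u (Q \<cdot> ket i) *\<^sub>C W \<cdot> ket i) has_sum T \<cdot> u) UNIV" for u
      using cop_apply_has_sum[of "Q \<cdot> u" W] by (simp add: W(1) flip: sym)
  qed
qed

text \<open>With \<open>V\<^sub>\<epsilon> = T (P + \<epsilon>)\<^sup>-\<^sup>1\<close>, a contraction, \<open>V\<^sub>\<epsilon>\<^sup>* T\<close> is nuclear with the same bound as \<open>T\<close> and differs
  from \<open>P = \<bar>T\<bar>\<close> by at most \<open>\<epsilon>\<close> in norm. Hence the finite diagonal sums of \<open>P\<close> are bounded.\<close>

lemma nuclear_trace_class:
  assumes T: "nuclear c T"
  shows "trace_class T"
proof -
  define P where "P = abs_cop T"
  have P: "positive_cop P" "P * P = adjoint_cop T * T" "\<And>z. norm (T \<cdot> z) = norm (P \<cdot> z)"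
    by (simp_all add: P_def abs_cop norm_abs_cop_apply)
  have key: "(\<Sum>k\<in>F. Re (cinner (P \<cdot> ket k) (ket k))) \<le> c + real (card F) * e"
    if F: "finite F" and e: "e > 0" for F e
  proof -
    obtain A where A: "resolvent_of P e A" using resolvent_exists[OF P(1) e] by blast
    define X where "X = adjoint_cop (T * A) * T"
    have "norm (T * A) \<le> 1"
      by (rule norm_cop_bound) (use resolvent_contraction[OF P(1) e A] in \<open>auto simp: P(3)\<close>)
    then have "norm (adjoint_cop (T * A)) * c \<le> 1 * c"
      using nuclear_nonneg[OF T] by (intro mult_right_mono) (simp_all only: norm_adjoint)
    then have X: "nuclear c X"
      unfolding X_def using nuclear_mult_left[OF T] nuclear_mono by fastforce
    have XP: "X = A * P * P"
      by (simp add: X_def resolvent_selfadjoint[OF P(1) A] mult.assoc P(2))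
    have "Re (cinner (P \<cdot> ket k) (ket k)) \<le> cmod (coord (X \<cdot> ket k) k) + e" for k
    proof -
      have "P \<cdot> ket k = X \<cdot> ket k + e *\<^sub>R (A \<cdot> P \<cdot> ket k)"
        unfolding XP using resolvent_apply(2)[OF A, of "P \<cdot> ket k"] by simp
      then have "Re (cinner (P \<cdot> ket k) (ket k)) =
          Re (coord (X \<cdot> ket k) k) + e * Re (cinner (A \<cdot> P \<cdot> ket k) (ket k))"
        by (metis cinner_add_left cinner_ket_right cinner_scaleR_left plus_complex.sel(1) scaleR_complex.sel(1))
      also have "Re (cinner (A \<cdot> P \<cdot> ket k) (ket k)) \<le> 1"
      proof -
        have "cinner (A \<cdot> P \<cdot> ket k) (ket k) = cinner (ket k) (P \<cdot> A \<cdot> ket k)"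
          using adjoint_right[of A "P \<cdot> ket k" "ket k"] adjoint_right[of P "ket k" "A \<cdot> ket k"]
          by (simp add: resolvent_selfadjoint[OF P(1) A] positive_cop_selfadjoint[OF P(1)])
        then have "Re (cinner (A \<cdot> P \<cdot> ket k) (ket k)) \<le> norm (ket k) * norm (P \<cdot> A \<cdot> ket k)"
          by (metis complex_Re_le_cmod cmod_cinner_le order_trans)
        also have "\<dots> \<le> 1" using resolvent_contraction[OF P(1) e A, of "ket k"] by simp
        finally show ?thesis .
      qed
      then have "e * Re (cinner (A \<cdot> P \<cdot> ket k) (ket k)) \<le> e" using e by simp
      finally show ?thesis using complex_Re_le_cmod[of "coord (X \<cdot> ket k) k"] by linarith
    qed
    then have "(\<Sum>k\<in>F. Re (cinner (P \<cdot> ket k) (ket k))) \<le> (\<Sum>k\<in>F. cmod (coord (X \<cdot> ket k) k) + e)"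
      by (intro sum_mono)
    then show ?thesis using nuclear_diagonal_le[OF X F] by (simp add: sum.distrib)
  qed
  have "(\<Sum>k\<in>F. Re (cinner (P \<cdot> ket k) (ket k))) \<le> c" if F: "finite F" for F
  proof (rule field_le_epsilon)
    fix d :: real assume d: "d > 0"
    have "real (card F) * (d / (real (card F) + 1)) \<le> d"
      using d by (simp add: field_simps)
    then show "(\<Sum>k\<in>F. Re (cinner (P \<cdot> ket k) (ket k))) \<le> c + d"
      using key[OF F, of "d / (real (card F) + 1)"] d by (simp add: add_nonneg_pos)
  qed
  then show ?thesis
    unfolding trace_class_def P_def[symmetric]
    by (intro nonneg_bdd_above_summable_on)
      (auto intro!: bdd_aboveI2[where M = c] positive_copD[OF P(1)] simp del: cinner_ket_right)
qed

lemma trace_norm_nonneg: "0 \<le> trace_norm T"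
  unfolding trace_norm_def by (intro infsum_nonneg positive_copD abs_cop)

section \<open>Creation operators and the right semicircular system\<close>

lemma coord_lcr: "coord (lcr j \<cdot> x) w = (case w of [] \<Rightarrow> 0 | i # u \<Rightarrow> if i = j then coord x u else 0)"
  by (simp add: cop_apply.rep_eq lcr.rep_eq left_creation_blinfun.rep_eq left_creation_fun.rep_eq)

lemma coord_rcr: "coord (rcr j \<cdot> x) w = (if w \<noteq> [] \<and> last w = j then coord x (butlast w) else 0)"
  by (simp add: cop_apply.rep_eq rcr.rep_eq right_creation_blinfun.rep_eq right_creation_fun.rep_eq)

lemma lcr_ket: "lcr j \<cdot> ket w = ket (j # w)"
  by (rule ell2_eqI) (auto simp: coord_lcr split: list.splits)

lemma rcr_ket: "rcr j \<cdot> ket w = ket (w @ [j])"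
proof (rule ell2_eqI)
  show "coord (rcr j \<cdot> ket w) u = coord (ket (w @ [j])) u" for u
    by (cases u rule: rev_cases) (auto simp: coord_rcr)
qed

lemma coord_lcr_adj: "coord (adjoint_cop (lcr j) \<cdot> x) w = coord x (j # w)"
  using adjoint_left[of "lcr j" x "ket w"] by (simp add: lcr_ket)

lemma coord_rcr_adj: "coord (adjoint_cop (rcr j) \<cdot> x) w = coord x (w @ [j])"
  using adjoint_left[of "rcr j" x "ket w"] by (simp add: rcr_ket)

text \<open>The operators \<open>r\<^sub>j + r\<^sub>j\<^sup>*\<close> are right multiplications by \<open>s\<^sub>j\<close> and generate the commutant of \<open>M\<close>. Here they
  serve to move polynomials from the right of \<open>a\<close> to operators acting on \<open>a1\<close>.\<close>

definition right_semicircular :: "'n \<Rightarrow> 'n list cop" where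
  "right_semicircular j = rcr j + adjoint_cop (rcr j)"

lemma coord_semicircular: "coord (semicircular_op j \<cdot> x) w =
    (case w of [] \<Rightarrow> 0 | i # u \<Rightarrow> if i = j then coord x u else 0) + coord x (j # w)"
  by (simp add: semicircular_op_def coord_lcr coord_lcr_adj)

lemma coord_right_semicircular: "coord (right_semicircular j \<cdot> x) w =
    (if w \<noteq> [] \<and> last w = j then coord x (butlast w) else 0) + coord x (w @ [j])"
  by (simp add: right_semicircular_def coord_rcr coord_rcr_adj)

lemma semicircular_commute: "semicircular_op i * right_semicircular j = right_semicircular j * semicircular_op i"
  by (intro cop_eqI ell2_eqI)
    (auto simp: coord_semicircular coord_right_semicircular split: list.splits)

definition vacuum_proj :: "'n list cop" where
  "vacuum_proj = (SOME P. \<forall>u. P \<cdot> u = cinner u vacuum *\<^sub>C vacuum)"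

lemma vacuum_proj: "vacuum_proj \<cdot> u = cinner u vacuum *\<^sub>C vacuum"
proof -
  have "bounded_linear (\<lambda>u :: 'n fock. cinner u vacuum *\<^sub>C vacuum)"
    using cmod_cinner_le[of _ vacuum]
    by (intro bounded_linear_intro[where K = 1])
      (auto simp: cinner_bilinear scaleC_add_left norm_scaleC_ell2 scaleR_scaleC scaleC_scaleC scaleR_conv_of_real simp del: cinner_ket_right)
  then have "\<exists>P :: 'n list cop. \<forall>u. P \<cdot> u = cinner u vacuum *\<^sub>C vacuum"
    by (rule cop_exists) (simp add: cinner_bilinear scaleC_scaleC)
  from someI_ex[OF this] show ?thesis unfolding vacuum_proj_def by blast
qed

text \<open>The commutators \<open>[l\<^sub>i\<^sup>*, r\<^sub>j]\<close> and \<open>[l\<^sub>i, r\<^sub>j\<^sup>*]\<close> live on the vacuum. They cancel for \<open>r\<^sub>j + r\<^sub>j\<^sup>*\<close> and add up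
  here.\<close>

lemma commutator_semicircular: "commutator (semicircular_op i) (rcr j - adjoint_cop (rcr j)) =
    (if i = j then 2 *\<^sub>R vacuum_proj else 0)"
  by (intro cop_eqI ell2_eqI)
    (auto simp: commutator_def coord_semicircular coord_rcr coord_rcr_adj vacuum_proj split: list.splits)

section \<open>The algebra generated by the semicircular system\<close>

lemma op_simps [simp]:
  "op (a + b) = op a + op b" "op (a - b) = op a - op b" "op (- a) = - op a" "op (a * b) = op a * op b"
  "op 0 = 0" "op 1 = 1" "op (c *\<^sub>C a) = c *\<^sub>C op a" "op (r *\<^sub>R a) = r *\<^sub>R op a"
  "op (sgen j) = semicircular_op j"
  by (simp_all add: plus_scalg.rep_eq minus_scalg.rep_eq uminus_scalg.rep_eq times_scalg.rep_eq
      zero_scalg.rep_eq one_scalg.rep_eq scaleC_scalg.rep_eq scaleR_scalg.rep_eq sgen.rep_eq)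

lemma norm_op [simp]: "norm (op a) = norm a"
  by (simp add: norm_scalg.rep_eq)

lemma op_sum: "op (sum f A) = (\<Sum>x\<in>A. op (f x))"
  by (induction A rule: infinite_finite_induct) auto

lemma op_commute:
  assumes "\<And>j. X * semicircular_op j = semicircular_op j * X"
  shows "op a * X = X * op a"
  using op[of a] assms unfolding commutant_def by auto

lemma op_right_semicircular: "op a * right_semicircular j = right_semicircular j * op a"
  by (rule op_commute) (simp add: semicircular_commute)

lemma adjoint_semicircular [simp]: "adjoint_cop (semicircular_op j) = semicircular_op j"
  by (simp add: semicircular_op_def add.commute)

lemma adjoint_right_semicircular: "adjoint_cop (right_semicircular j) = right_semicircular j"
  by (simp add: right_semicircular_def add.commute)

lemma op_star [simp]: "op (star a) = adjoint_cop (op a)"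
proof -
  have "adjoint_cop (op a) * X = X * adjoint_cop (op a)"
    if X: "\<And>j. X * semicircular_op j = semicircular_op j * X" for X
  proof -
    have "adjoint_cop X * semicircular_op j = semicircular_op j * adjoint_cop X" for j
      using arg_cong[OF X[of j], of adjoint_cop] by simp
    then have "op a * adjoint_cop X = adjoint_cop X * op a" by (rule op_commute)
    from arg_cong[OF this, of adjoint_cop] show ?thesis by simp
  qed
  then have "adjoint_cop (op a) \<in> commutant (commutant (range semicircular_op))"
    unfolding commutant_def by auto
  then show ?thesis unfolding star_def by (rule Abs_scalg_inverse)
qed

lemma scalg_eqI: "op a = op b \<Longrightarrow> a = b"
  by (simp add: op_inject)

lemma star_simps [simp]:
  "star (a + b) = star a + star b" "star (a - b) = star a - star b" "star (- a) = - star a"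
  "star (a * b) = star b * star a" "star (c *\<^sub>C a) = cnj c *\<^sub>C star a" "star (star a) = a"
  "star 1 = 1" "star 0 = 0" "star (sgen j) = sgen j"
  by (rule scalg_eqI; simp)+

lemma scaleC_times_scalg [simp]: "(c *\<^sub>C a) * b = c *\<^sub>C (a * b)" "a * (c *\<^sub>C b) = c *\<^sub>C (a * b)"
  for a b :: "'n scalg"
  by (rule scalg_eqI; simp add: scaleC_times_cop)+

lemma norm_scaleC_scalg_le: "norm (c *\<^sub>C a :: 'n scalg) \<le> cmod c * norm a"
proof -
  have "norm (op (c *\<^sub>C a)) \<le> cmod c * norm a"
  proof (rule norm_cop_bound)
    show "norm (op (c *\<^sub>C a) \<cdot> x) \<le> cmod c * norm a * norm x" for x
      using mult_left_mono[OF norm_cop_apply[of "op a" x], of "cmod c"]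
      by (simp add: norm_scaleC_ell2 mult_ac)
  qed simp
  then show ?thesis by (simp only: norm_op)
qed

instance scalg :: (type) complete_space
proof
  fix X :: "nat \<Rightarrow> 'a scalg"
  assume "Cauchy X"
  then have "Cauchy (\<lambda>n. op (X n))"
    by (simp add: Cauchy_def dist_norm flip: norm_op)
  then obtain B where B: "(\<lambda>n. op (X n)) \<longlonglongrightarrow> B"
    using Cauchy_convergent_iff convergent_def by blast
  have "B * S = S * B" if S: "\<And>j. S * semicircular_op j = semicircular_op j * S" for S
  proof -
    have "(\<lambda>n. op (X n) * S) \<longlonglongrightarrow> B * S" "(\<lambda>n. S * op (X n)) \<longlonglongrightarrow> S * B"
      by (intro tendsto_intros B)+
    moreover have "(\<lambda>n. op (X n) * S) = (\<lambda>n. S * op (X n))" using op_commute[OF S] by simp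
    ultimately show ?thesis by (metis LIMSEQ_unique)
  qed
  then have "B \<in> commutant (commutant (range semicircular_op))"
    unfolding commutant_def by auto
  then have "op (Abs_scalg B) = B" by (rule Abs_scalg_inverse)
  then have "X \<longlonglongrightarrow> Abs_scalg B"
    using B by (simp add: LIMSEQ_iff flip: norm_op)
  then show "convergent X" by (auto simp: convergent_def)
qed

instance scalg :: (type) banach ..

lemma tau_simps [simp]:
  "tau (a + b) = tau a + tau b" "tau (a - b) = tau a - tau b" "tau (- a) = - tau a"
  "tau (c *\<^sub>C a) = c * tau a" "tau 0 = 0"
  by (simp_all add: tau_def)

lemma bounded_linear_tau: "bounded_linear tau"
  by (rule bounded_linear_intro[where K = 1]) (use norm_tau_le in \<open>auto simp: tau_scaleR\<close>)

section \<open>Non-commutative polynomials\<close>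

abbreviation monom_op :: "'n list \<Rightarrow> 'n scalg" where
  "monom_op w \<equiv> prod_list (map sgen w)"

lemma ncpoly_eval_superset:
  assumes "finite S" "Poly_Mapping.keys p \<subseteq> S"
  shows "ncpoly_eval p = (\<Sum>w\<in>S. Poly_Mapping.lookup p w *\<^sub>C monom_op w)"
  unfolding ncpoly_eval_def
  by (rule sum.mono_neutral_left) (use assms in \<open>auto simp: in_keys_iff intro!: scalg_eqI cop_eqI ell2_eqI\<close>)

lemma ncpoly_eval_add: "ncpoly_eval (p + q) = ncpoly_eval p + ncpoly_eval q"
proof -
  let ?S = "Poly_Mapping.keys p \<union> Poly_Mapping.keys q"
  have "Poly_Mapping.keys (p + q) \<subseteq> ?S" by (rule Poly_Mapping.keys_add)
  then show ?thesis
    by (simp add: ncpoly_eval_superset[of ?S] lookup_add scaleC_add_left sum.distrib)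
qed

lemma ncpoly_eval_0: "ncpoly_eval 0 = 0"
  by (simp add: ncpoly_eval_def)

lemma ncpoly_eval_sum: "ncpoly_eval (sum f A) = (\<Sum>a\<in>A. ncpoly_eval (f a))"
  by (induction A rule: infinite_finite_induct) (auto simp: ncpoly_eval_add ncpoly_eval_0)

lemma ncpoly_eval_single: "ncpoly_eval (Poly_Mapping.single w c) = c *\<^sub>C monom_op w"
  by (subst ncpoly_eval_superset[of "{w}"]) (auto split: if_splits)

lemma ncpolys_add: "a \<in> ncpolys \<Longrightarrow> b \<in> ncpolys \<Longrightarrow> a + b \<in> ncpolys"
  unfolding ncpolys_def by (auto simp flip: ncpoly_eval_add)

lemma ncpolys_monom: "c *\<^sub>C monom_op w \<in> ncpolys"
  unfolding ncpolys_def by (metis ncpoly_eval_single rangeI)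

lemma ncpolys_0: "0 \<in> ncpolys"
  unfolding ncpolys_def by (metis ncpoly_eval_0 rangeI)

lemma ncpolys_induct [consumes 1, case_names zero plus]:
  assumes "p \<in> ncpolys" "P 0" "\<And>q c w. q \<in> ncpolys \<Longrightarrow> P q \<Longrightarrow> P (q + c *\<^sub>C monom_op w)"
  shows "P p"
proof -
  have "(\<Sum>w\<in>F. f w *\<^sub>C monom_op w) \<in> ncpolys \<and> P (\<Sum>w\<in>F. f w *\<^sub>C monom_op w)" if "finite F" for F f
    using that
  proof (induction F rule: finite_induct)
    case (insert u F)
    let ?q = "\<Sum>w\<in>F. f w *\<^sub>C monom_op w"
    have "?q + f u *\<^sub>C monom_op u \<in> ncpolys \<and> P (?q + f u *\<^sub>C monom_op u)"
      using insert.IH by (intro conjI ncpolys_add ncpolys_monom assms(3)) auto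
    then show ?case using insert.hyps by (simp add: add.commute)
  qed (simp add: assms(2) ncpolys_0)
  then show ?thesis using assms(1) by (auto simp: ncpolys_def ncpoly_eval_def)
qed

lemma scaleC_zero_scalg [simp]: "c *\<^sub>C (0 :: 'n scalg) = 0" "0 *\<^sub>C (a :: 'n scalg) = 0"
  by (rule scalg_eqI, rule cop_eqI, rule ell2_eqI, simp)+

lemma ncpolys_scaleC: "a \<in> ncpolys \<Longrightarrow> c *\<^sub>C a \<in> ncpolys"
  by (induction rule: ncpolys_induct)
    (auto simp: ncpolys_0 scaleC_add_right scaleC_scaleC intro: ncpolys_add ncpolys_monom)

lemma scaleC_minus1_scalg: "(-1) *\<^sub>C (a :: 'n scalg) = - a"
  by (rule scalg_eqI, rule cop_eqI, rule ell2_eqI, simp)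

lemma ncpolys_diff: "a \<in> ncpolys \<Longrightarrow> b \<in> ncpolys \<Longrightarrow> a - b \<in> ncpolys"
  using ncpolys_add[OF _ ncpolys_scaleC, of a b "-1"] by (simp add: scaleC_minus1_scalg)

lemma ncpolys_mult_monom: "a \<in> ncpolys \<Longrightarrow> a * monom_op w \<in> ncpolys"
proof (induction rule: ncpolys_induct)
  case (plus q c u)
  have "monom_op u * monom_op w = monom_op (u @ w)" by simp
  then show ?case
    unfolding distrib_right scaleC_times_scalg
    by (intro ncpolys_add plus.IH) (metis ncpolys_monom)
qed (simp add: ncpolys_0)

lemma ncpolys_mult:
  assumes "a \<in> ncpolys" "b \<in> ncpolys"
  shows "a * b \<in> ncpolys"
  using assms(2)
  by (induction rule: ncpolys_induct)
    (auto simp: ncpolys_0 distrib_left intro: ncpolys_add ncpolys_scaleC ncpolys_mult_monom[OF assms(1)])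

lemma ncpolys_1: "1 \<in> ncpolys"
  using ncpolys_monom[of 1 "[]"] by (simp add: scaleC_one)

lemma ncpolys_sgen: "sgen j \<in> ncpolys"
  using ncpolys_monom[of 1 "[j]"] by (simp add: scaleC_one)

lemma ncpolys_sum: "(\<And>i. i \<in> A \<Longrightarrow> f i \<in> ncpolys) \<Longrightarrow> sum f A \<in> ncpolys"
  by (induction A rule: infinite_finite_induct) (auto simp: ncpolys_0 ncpolys_add)

text \<open>The polynomial \<open>wick w\<close> is the element of \<open>M\<close> that the identification \<open>a \<mapsto> a1\<close> sends to the
  basis vector \<open>ket w\<close>.\<close>

fun wick :: "'n list \<Rightarrow> 'n scalg" where
  "wick [] = 1"
| "wick [i] = sgen i"
| "wick (i # k # w) = sgen i * wick (k # w) - (if i = k then wick w else 0)"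

lemma wick_in_ncpolys: "wick w \<in> ncpolys"
  by (induction w rule: wick.induct)
    (auto intro: ncpolys_1 ncpolys_sgen ncpolys_mult ncpolys_diff simp: ncpolys_0)

lemma semicircular_ket: "semicircular_op j \<cdot> ket w =
    ket (j # w) + (case w of [] \<Rightarrow> 0 | i # u \<Rightarrow> if i = j then ket u else 0)"
  by (rule ell2_eqI) (auto simp: coord_semicircular split: list.splits)

lemma wick_vacuum: "op (wick w) \<cdot> vacuum = ket w"
  by (induction w rule: wick.induct) (auto simp: semicircular_ket)

text \<open>The fusion rule \<open>s\<^sub>j = l\<^sub>j + l\<^sub>j\<^sup>*\<close> on basis vectors, lifted to \<open>M\<close>.\<close>

lemma sgen_wick: "sgen j * wick w = wick (j # w) + (case w of [] \<Rightarrow> 0 | i # u \<Rightarrow> if i = j then wick u else 0)"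
  by (cases w) auto

text \<open>Linear identities on polynomials are easy to verify on Wick words, where the algebra meets the
  orthonormal basis; the fusion rule shows that these span.\<close>

inductive wick_span :: "'n scalg \<Rightarrow> bool" where
  zero: "wick_span 0"
| plus: "wick_span a \<Longrightarrow> wick_span b \<Longrightarrow> wick_span (a + b)"
| scale: "wick_span a \<Longrightarrow> wick_span (c *\<^sub>C a)"
| wick: "wick_span (wick w)"

lemma ncpolys_wick_span: "p \<in> ncpolys \<Longrightarrow> wick_span p"
proof (induction rule: ncpolys_induct)
  case (plus q c w)
  have step: "wick_span (sgen j * a)" if "wick_span a" for j :: 'a and a
    using that
  proof (induction rule: wick_span.induct)
    case (wick w)
    show ?case unfolding sgen_wick
      by (intro wick_span.plus wick_span.wick) (auto intro: wick_span.intros split: list.splits)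
  qed (auto simp: distrib_left intro: wick_span.intros)
  have "wick_span (monom_op w)"
    by (induction w) (use step wick_span.wick[of "[]"] in auto)
  then show ?case by (intro wick_span.plus wick_span.scale plus.IH)
qed (rule wick_span.zero)

section \<open>The flip, traciality and right multiplications\<close>

text \<open>The antiunitary \<open>\<xi> \<mapsto> \<xi>\<^sup>*\<close>.\<close>

definition flip :: "'n fock \<Rightarrow> 'n fock" where
  "flip x = (SOME y. \<forall>w. coord y w = cnj (coord x (rev w)))"

lemma bij_rev: "bij rev"
  by (rule o_bij[of rev]) auto

lemma coord_flip [simp]: "coord (flip x) w = cnj (coord x (rev w))"
proof -
  have "(\<lambda>w. (cmod (coord x (rev w)))\<^sup>2) summable_on UNIV"
    using has_sum_imp_summable[OF coord_norm_has_sum[of x]]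
      summable_on_reindex_bij_betw[OF bij_rev, of "\<lambda>w. (cmod (coord x w))\<^sup>2"] by simp
  then have "coord (Abs_ell2 (\<lambda>w. cnj (coord x (rev w)))) = (\<lambda>w. cnj (coord x (rev w)))"
    by (intro Abs_ell2_inverse) (simp add: square_summable_def)
  then have "\<exists>y. \<forall>w. coord y w = cnj (coord x (rev w))" by metis
  from someI_ex[OF this] show ?thesis unfolding flip_def by blast
qed

lemma norm_flip [simp]: "norm (flip x) = norm x"
  using infsum_reindex_bij_betw[OF bij_rev, of "\<lambda>w. (cmod (coord x w))\<^sup>2"]
  by (simp add: norm_ell2_sum)

lemma flip_simps [simp]:
  "flip (x + y) = flip x + flip y" "flip (c *\<^sub>C x) = cnj c *\<^sub>C flip x" "flip (r *\<^sub>R x) = r *\<^sub>R flip x"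
  "flip (flip x) = x" "flip (ket w) = ket (rev w)"
  by (rule ell2_eqI; auto)+

lemma cinner_flip: "cinner x (flip y) = cinner y (flip x)"
proof -
  have "cinner x (flip y) = (\<Sum>\<^sub>\<infinity>w. coord x w * coord y (rev w))" by (simp add: cinner_coord)
  also have "\<dots> = (\<Sum>\<^sub>\<infinity>w. coord x (rev w) * coord y (rev (rev w)))"
    using infsum_reindex_bij_betw[OF bij_rev, of "\<lambda>w. coord x w * coord y (rev w)"] by simp
  also have "\<dots> = cinner y (flip x)" by (simp add: cinner_coord mult.commute)
  finally show ?thesis .
qed

abbreviation right_word :: "'n list \<Rightarrow> 'n list cop" where
  "right_word w \<equiv> prod_list (map right_semicircular w)"

lemma flip_semicircular: "flip (semicircular_op j \<cdot> x) = right_semicircular j \<cdot> flip x"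
proof (rule ell2_eqI)
  fix w
  show "coord (flip (semicircular_op j \<cdot> x)) w = coord (right_semicircular j \<cdot> flip x) w"
    by (cases w rule: rev_cases) (auto simp: coord_semicircular coord_right_semicircular)
qed

lemma flip_monom: "flip (op (monom_op w) \<cdot> x) = right_word w \<cdot> flip x"
  by (induction w) (auto simp: flip_semicircular)

lemma op_right_word: "op a \<cdot> right_word w \<cdot> x = right_word w \<cdot> op a \<cdot> x"
proof -
  have "op a * right_word w = right_word w * op a"
  proof (induction w)
    case (Cons j w)
    have "op a * right_word (j # w) = right_semicircular j * (op a * right_word w)"
      by (simp add: op_right_semicircular flip: mult.assoc)
    then show ?case by (simp add: Cons mult.assoc)
  qed simp
  then show ?thesis by (metis cop_apply_simps(6))
qed

lemma monom_vacuum: "op (monom_op w) \<cdot> vacuum = right_word (rev w) \<cdot> vacuum"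
proof (induction w)
  case (Cons j w)
  have "op (monom_op (j # w)) \<cdot> vacuum = op (sgen j) \<cdot> right_word (rev w) \<cdot> vacuum"
    using Cons by simp
  also have "\<dots> = right_word (rev w) \<cdot> op (sgen j) \<cdot> vacuum" by (rule op_right_word)
  also have "op (sgen j) \<cdot> vacuum = right_semicircular j \<cdot> vacuum"
    by (rule ell2_eqI) (auto simp: coord_semicircular coord_right_semicircular split: list.splits)
  finally show ?case by simp
qed simp

lemma op_monom_vacuum: "op (a * monom_op w) \<cdot> vacuum = right_word (rev w) \<cdot> op a \<cdot> vacuum"
  by (simp add: monom_vacuum op_right_word)

text \<open>The vector \<open>a p 1\<close> is determined by \<open>a1\<close>, since right words commute with \<open>a\<close>.\<close>

lemma vacuum_separating:
  assumes "op a \<cdot> vacuum = op b \<cdot> vacuum"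
  shows "a = b"
proof -
  have "op (a * p) \<cdot> vacuum = op (b * p) \<cdot> vacuum" if "p \<in> ncpolys" for p
    using that
  proof (induction rule: ncpolys_induct)
    case (plus q c w)
    then show ?case using op_monom_vacuum[of a w] op_monom_vacuum[of b w] assms
      by (simp add: distrib_left)
  qed simp
  from this[OF wick_in_ncpolys] have "op a \<cdot> ket w = op b \<cdot> ket w" for w
    by (simp add: wick_vacuum)
  then show ?thesis by (intro scalg_eqI cop_eq_ketI)
qed

lemma adjoint_right_word: "adjoint_cop (right_word w) = right_word (rev w)"
  by (induction w) (auto simp: adjoint_right_semicircular)

lemma monom_total:
  assumes "\<And>w. cinner x (op (monom_op w) \<cdot> vacuum) = cinner y (op (monom_op w) \<cdot> vacuum)"
  shows "x = y"
proof (rule ell2_eqI)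
  have "cinner x (op p \<cdot> vacuum) = cinner y (op p \<cdot> vacuum)" if "p \<in> ncpolys" for p
    using that by (induction rule: ncpolys_induct) (auto simp: cinner_bilinear assms)
  from this[OF wick_in_ncpolys] show "coord x w = coord y w" for w
    by (simp add: wick_vacuum)
qed

text \<open>On polynomials the flip is the adjoint. For general \<open>a\<close> both sides have the same inner products
  with polynomial vectors, because right words commute with \<open>a\<close>. Traciality of \<open>\<tau>\<close> is then the
  symmetry of \<open>\<langle>x, y\<^sup>*\<rangle>\<close>.\<close>

lemma star_vacuum: "adjoint_cop (op a) \<cdot> vacuum = flip (op a \<cdot> vacuum)"
proof (rule monom_total)
  fix w
  have "cinner (adjoint_cop (op a) \<cdot> vacuum) (op (monom_op w) \<cdot> vacuum) =
      cinner vacuum (right_word (rev w) \<cdot> op a \<cdot> vacuum)"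
    unfolding adjoint_left using op_monom_vacuum[of a w] by (simp del: cinner_ket_left)
  also have "\<dots> = cinner (right_word w \<cdot> vacuum) (op a \<cdot> vacuum)"
    by (simp add: adjoint_right adjoint_right_word del: cinner_ket_left)
  also have "right_word w \<cdot> vacuum = flip (op (monom_op w) \<cdot> vacuum)"
    using flip_monom[of w vacuum] by simp
  also have "cinner \<dots> (op a \<cdot> vacuum) = cinner (flip (op a \<cdot> vacuum)) (op (monom_op w) \<cdot> vacuum)"
    by (metis cinner_commute cinner_flip)
  finally show "cinner (adjoint_cop (op a) \<cdot> vacuum) (op (monom_op w) \<cdot> vacuum) =
      cinner (flip (op a \<cdot> vacuum)) (op (monom_op w) \<cdot> vacuum)" .
qed

lemma tau_product: "tau (a * b) = cinner (op b \<cdot> vacuum) (flip (op a \<cdot> vacuum))"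
  by (simp add: tau_def adjoint_right star_vacuum del: cinner_ket_right)

lemma tau_commute: "tau (a * b) = tau (b * a)"
  unfolding tau_product by (rule cinner_flip)

text \<open>Right multiplication is bounded because it is \<open>J b\<^sup>* J\<close> for the flip \<open>J\<close>.\<close>

lemma right_mult_apply: "right_mult b \<cdot> op a \<cdot> vacuum = op (a * b) \<cdot> vacuum"
proof -
  have "bounded_linear (\<lambda>x. flip (adjoint_cop (op b) \<cdot> flip x))"
    using norm_cop_apply[of "adjoint_cop (op b)" "flip _"]
    by (intro bounded_linear_intro[where K = "norm b"]) (auto simp: mult.commute)
  then have "\<exists>X. \<forall>x. X \<cdot> x = flip (adjoint_cop (op b) \<cdot> flip x)"
    by (rule cop_exists) simp
  then obtain X where "\<And>x. X \<cdot> x = flip (adjoint_cop (op b) \<cdot> flip x)" by blast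
  then have X: "X \<cdot> op a \<cdot> vacuum = op (a * b) \<cdot> vacuum" for a
    using star_vacuum[of "a * b"] by (simp flip: star_vacuum)
  have "right_mult b = X"
    unfolding right_mult_def
  proof (rule the_equality)
    show "\<forall>a. X \<cdot> op a \<cdot> vacuum = op (a * b) \<cdot> vacuum" using X by blast
    show "Y = X" if "\<forall>a. Y \<cdot> op a \<cdot> vacuum = op (a * b) \<cdot> vacuum" for Y
      by (rule cop_eq_ketI) (metis X that wick_vacuum)
  qed
  then show ?thesis using X by simp
qed

lemma right_mult_commute: "right_mult b * op a = op a * right_mult b"
proof (rule cop_eq_ketI)
  fix w
  have "(right_mult b * op a) \<cdot> op (wick w) \<cdot> vacuum = op (a * wick w * b) \<cdot> vacuum"
    using right_mult_apply[of b "a * wick w"] by simp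
  moreover have "(op a * right_mult b) \<cdot> op (wick w) \<cdot> vacuum = op (a * wick w * b) \<cdot> vacuum"
    using right_mult_apply[of b "wick w"] by simp
  ultimately show "(right_mult b * op a) \<cdot> ket w = (op a * right_mult b) \<cdot> ket w"
    by (simp only: wick_vacuum)
qed

section \<open>Normal functionals\<close>

lemma toL1_apply [simp]: "blinfun_apply (toL1 a) b = tau (a * b)"
  by (simp add: toL1.rep_eq)

lemma L1_closed: "closed L1"
  by (simp add: L1_def)

lemma subspace_closure:
  fixes S :: "'a::real_normed_vector set"
  assumes S: "subspace S"
  shows "subspace (closure S)"
  unfolding subspace_def
proof (intro conjI ballI allI)
  show "0 \<in> closure S" using subspace_0[OF S] by (rule subsetD[OF closure_subset])
next
  fix x y assume "x \<in> closure S" "y \<in> closure S"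
  then obtain f g where fg: "\<And>n. f n \<in> S" "f \<longlonglongrightarrow> x" "\<And>n. g n \<in> S" "g \<longlonglongrightarrow> y"
    unfolding closure_sequential by auto
  then show "x + y \<in> closure S"
    unfolding closure_sequential
    by (intro exI[of _ "\<lambda>n. f n + g n"]) (auto intro: tendsto_add subspace_add[OF S])
next
  fix c :: real and x assume "x \<in> closure S"
  then obtain f where f: "\<And>n. f n \<in> S" "f \<longlonglongrightarrow> x"
    unfolding closure_sequential by auto
  then show "c *\<^sub>R x \<in> closure S"
    unfolding closure_sequential
    by (intro exI[of _ "\<lambda>n. c *\<^sub>R f n"]) (auto intro: tendsto_intros subspace_scale[OF S])
qed

lemma L1_subspace: "subspace (L1 :: 'n dual set)"
proof -
  have "linear (toL1 :: 'n scalg \<Rightarrow> 'n dual)"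
    by (rule linearI)
      (auto intro!: blinfun_eqI simp: distrib_right blinfun.add_left blinfun.scaleR_left tau_scaleR)
  then have "subspace (range (toL1 :: 'n scalg \<Rightarrow> 'n dual))"
    by (rule linear_subspace_image) simp
  then show ?thesis unfolding L1_def by (rule subspace_closure)
qed

lemma toL1_in_L1: "toL1 a \<in> L1"
  unfolding L1_def by (rule subsetD[OF closure_subset rangeI])

lemma closure_vacuum_orbit: "closure (range (\<lambda>a. op a \<cdot> vacuum)) = UNIV"
proof -
  have "x \<in> closure (range (\<lambda>a. op a \<cdot> vacuum))" for x :: "'a fock"
  proof (rule Lim_in_closed_set)
    show "((\<lambda>F. \<Sum>w\<in>F. coord x w *\<^sub>C ket w) \<longlongrightarrow> x) (finite_subsets_at_top UNIV)"
      using ket_expansion[of x] by (simp add: has_sum_def)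
    have "(\<Sum>w\<in>F. coord x w *\<^sub>C ket w) = op (\<Sum>w\<in>F. coord x w *\<^sub>C wick w) \<cdot> vacuum" for F
      by (simp add: op_sum cop_apply_sum wick_vacuum)
    then have "(\<Sum>w\<in>F. coord x w *\<^sub>C ket w) \<in> range (\<lambda>a. op a \<cdot> vacuum)" for F by blast
    then show "eventually (\<lambda>F. (\<Sum>w\<in>F. coord x w *\<^sub>C ket w) \<in> closure (range (\<lambda>a. op a \<cdot> vacuum)))
        (finite_subsets_at_top UNIV)"
      by (intro always_eventually allI subsetD[OF closure_subset])
  qed auto
  then show ?thesis by blast
qed

text \<open>By traciality \<open>\<langle>c a1, b1\<rangle> = \<tau>(a b\<^sup>* c)\<close>. So vector functionals are norm limits of functionals
  represented by \<open>M\<close>, and so are the functionals \<open>Tr(X \<cdot>)\<close> of nuclear operators.\<close>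

definition vector_functional :: "'n fock \<Rightarrow> 'n fock \<Rightarrow> 'n dual" where
  "vector_functional x y = Blinfun (\<lambda>a. cinner (op a \<cdot> x) y)"

lemma vector_functional_bound: "cmod (cinner (op a \<cdot> x) y) \<le> norm a * (norm x * norm y)"
proof -
  have "cmod (cinner (op a \<cdot> x) y) \<le> (norm a * norm x) * norm y"
    using norm_cop_apply[of "op a" x]
    by (intro order_trans[OF cmod_cinner_le] mult_right_mono) auto
  then show ?thesis by (simp add: mult.assoc)
qed

lemma vector_functional_apply: "blinfun_apply (vector_functional x y) a = cinner (op a \<cdot> x) y"
proof -
  have "bounded_linear (\<lambda>a. cinner (op a \<cdot> x) y)"
    by (rule bounded_linear_intro[where K = "norm x * norm y"])
      (auto simp: cinner_bilinear vector_functional_bound)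
  then show ?thesis unfolding vector_functional_def by (simp add: bounded_linear_Blinfun_apply)
qed

lemma norm_vector_functional: "norm (vector_functional x y) \<le> norm x * norm y"
proof (rule norm_blinfun_bound)
  show "norm (blinfun_apply (vector_functional x y) a) \<le> norm x * norm y * norm a" for a
    using vector_functional_bound[of a x y] by (simp add: vector_functional_apply mult_ac)
qed simp

lemma bounded_bilinear_vector_functional: "bounded_bilinear vector_functional"
proof
  show "\<exists>K. \<forall>a b. norm (vector_functional a b) \<le> norm a * norm b * K"
    by (rule exI[of _ 1]) (simp add: norm_vector_functional)
qed (auto intro!: blinfun_eqI simp: vector_functional_apply blinfun.bilinear_simps cinner_bilinear)

lemma vector_functional_in_L1: "vector_functional x y \<in> L1"
proof -
  have "\<exists>f. (\<lambda>n. op (f n) \<cdot> vacuum) \<longlonglongrightarrow> x" for x :: "'a fock"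
  proof -
    have "x \<in> closure (range (\<lambda>a. op a \<cdot> vacuum))" by (simp add: closure_vacuum_orbit)
    then obtain X where X: "\<And>n. X n \<in> range (\<lambda>a. op a \<cdot> vacuum)" "X \<longlonglongrightarrow> x"
      unfolding closure_sequential by auto
    from X(1) have "\<forall>n. \<exists>a. X n = op a \<cdot> vacuum" by (auto simp: image_iff)
    then obtain f where "\<And>n. X n = op (f n) \<cdot> vacuum" by metis
    then have "X = (\<lambda>n. op (f n) \<cdot> vacuum)" by auto
    then show ?thesis using X(2) by auto
  qed
  then obtain f g where f: "(\<lambda>n. op (f n) \<cdot> vacuum) \<longlonglongrightarrow> x" and g: "(\<lambda>n. op (g n) \<cdot> vacuum) \<longlonglongrightarrow> y"
    by meson
  have "vector_functional (op a \<cdot> vacuum) (op b \<cdot> vacuum) = toL1 (a * star b)" for a b :: "'a scalg"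
  proof (rule blinfun_eqI)
    fix c
    have "tau (star b * (c * a)) = tau (c * a * star b)" by (rule tau_commute)
    also have "\<dots> = tau (a * star b * c)" using tau_commute[of c "a * star b"] by (simp add: mult.assoc)
    finally show "blinfun_apply (vector_functional (op a \<cdot> vacuum) (op b \<cdot> vacuum)) c =
        blinfun_apply (toL1 (a * star b)) c"
      by (simp add: vector_functional_apply tau_def adjoint_left del: cinner_ket_right)
  qed
  then have "vector_functional (op (f n) \<cdot> vacuum) (op (g n) \<cdot> vacuum) \<in> L1" for n
    by (simp add: toL1_in_L1)
  then show ?thesis
    by (rule closed_sequentially[OF L1_closed _
        bounded_bilinear.tendsto[OF bounded_bilinear_vector_functional f g]])
qed

lemma nuclear_functional:
  "nuclear c X \<Longrightarrow> \<exists>\<xi>. \<xi> \<in> L1 \<and> (\<forall>a. Trace (X * op a) = blinfun_apply \<xi> a)"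
proof (induction rule: nuclear.induct)
  case (expansion x y c X)
  define f where "f i = vector_functional (x i) (y i)" for i
  have "(\<lambda>i. norm (f i)) summable_on UNIV"
    by (rule summable_on_comparison_test[OF expansion(1)]) (auto simp: f_def norm_vector_functional)
  then have s: "(f has_sum infsum f UNIV) UNIV" by (rule has_sum_infsum[OF abs_summable_summable])
  have "infsum f UNIV \<in> L1"
  proof (rule Lim_in_closed_set[OF L1_closed])
    show "(sum f \<longlongrightarrow> infsum f UNIV) (finite_subsets_at_top UNIV)" using s by (simp add: has_sum_def)
    show "eventually (\<lambda>F. sum f F \<in> L1) (finite_subsets_at_top UNIV)"
      by (intro always_eventually allI subspace_sum L1_subspace) (simp add: f_def vector_functional_in_L1)
  qed auto
  moreover have "Trace (X * op a) = blinfun_apply (infsum f UNIV) a" for a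
  proof -
    have "((\<lambda>i. blinfun_apply (f i) a) has_sum blinfun_apply (infsum f UNIV) a) UNIV"
      using has_sum_bounded_linear[OF blinfun.bounded_linear_left s, of a] by (simp add: o_def)
    then have "(\<Sum>\<^sub>\<infinity>i. cinner (op a \<cdot> x i) (y i)) = blinfun_apply (infsum f UNIV) a"
      by (intro infsumI) (simp add: f_def vector_functional_apply)
    moreover have "Trace (op a * X) = (\<Sum>\<^sub>\<infinity>i. cinner (op a \<cdot> x i) (y i))"
    proof (rule Trace_expansion)
      show "(\<lambda>i. norm (op a \<cdot> x i) * norm (y i)) summable_on UNIV"
        by (rule infsum_bounded_le[OF expansion(1) _ norm_apply_mult_le]) auto
      show "((\<lambda>i. cinner u (y i) *\<^sub>C op a \<cdot> x i) has_sum (op a * X) \<cdot> u) UNIV" for u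
        using has_sum_bounded_linear[OF bounded_linear_cop_apply[of "op a"] expansion(3)[of u]]
        by (simp add: o_def)
    qed
    ultimately show ?thesis
      using Trace_commute[OF nuclear.expansion[OF expansion], of "op a"] by simp
  qed
  ultimately show ?case by blast
next
  case (plus c X d Y)
  then obtain \<xi> \<eta> where \<xi>: "\<xi> \<in> L1" "\<And>a. Trace (X * op a) = blinfun_apply \<xi> a"
    and \<eta>: "\<eta> \<in> L1" "\<And>a. Trace (Y * op a) = blinfun_apply \<eta> a" by blast
  have "Trace ((X + Y) * op a) = blinfun_apply (\<xi> + \<eta>) a" for a
    using Trace_add[OF nuclear_mult_right[OF plus.hyps(1)] nuclear_mult_right[OF plus.hyps(2)], of "op a" "op a"]
    by (simp add: distrib_right blinfun.add_left \<xi> \<eta>)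
  moreover have "\<xi> + \<eta> \<in> L1" using \<xi>(1) \<eta>(1) L1_subspace by (rule subspace_add[rotated])
  ultimately show ?case by blast
qed

lemma Phi_nuclear:
  assumes "nuclear c X"
  shows "Phi X \<in> L1" "blinfun_apply (Phi X) a = Trace (X * op a)"
proof -
  obtain \<xi> where \<xi>: "\<xi> \<in> L1" "\<And>a. Trace (X * op a) = blinfun_apply \<xi> a"
    using nuclear_functional[OF assms] by blast
  have "Phi X = \<xi>"
    unfolding Phi_def by (rule the_equality) (use \<xi> in \<open>auto intro!: blinfun_eqI\<close>)
  then show "Phi X \<in> L1" "blinfun_apply (Phi X) a = Trace (X * op a)" using \<xi> by auto
qed

section \<open>The derivations of the smooth algebra\<close>

text \<open>Membership in \<open>\<B>\<^bsub>\<infinity>,1\<^esub>\<close>, in a form that is visibly stable under algebraic operations.\<close>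

definition smooth :: "'n scalg \<Rightarrow> bool" where
  "smooth a \<longleftrightarrow> (\<forall>j. \<exists>c. nuclear c (rcomm a j))"

lemma smooth_B_infty_1: "a \<in> B_infty_1 \<longleftrightarrow> smooth a"
  unfolding B_infty_1_def smooth_def using trace_class_nuclear nuclear_trace_class by blast

lemma scaleC_diff_cop: "c *\<^sub>C (S - T :: 'a cop) = c *\<^sub>C S - c *\<^sub>C T"
  by (rule cop_eqI) (simp add: scaleC_diff_ell2)

lemma rcomm_simps:
  "rcomm (a + b) j = rcomm a j + rcomm b j" "rcomm (a - b) j = rcomm a j - rcomm b j"
  "rcomm (c *\<^sub>C a) j = c *\<^sub>C rcomm a j" "rcomm 1 j = 0" "rcomm 0 j = 0"
  "rcomm (a * b) j = rcomm a j * op b + op a * rcomm b j"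
  by (simp_all add: rcomm_def commutator_def algebra_simps scaleC_times_cop scaleC_diff_cop scaleC_add_right)

lemma rcomm_sgen: "rcomm (sgen i) j = (if i = j then 2 *\<^sub>R vacuum_proj else 0)"
  by (simp add: rcomm_def commutator_semicircular)

lemma nuclear_vacuum_proj: "nuclear 1 vacuum_proj"
  using nuclear_rank_one[of vacuum_proj vacuum vacuum, OF vacuum_proj] by simp

lemma smooth_sgen: "smooth (sgen i)"
  using nuclear_scaleC[OF nuclear_vacuum_proj, of 2] nuclear_0
  unfolding smooth_def rcomm_sgen scaleR_scaleC by auto

lemma smooth_1: "smooth 1" and smooth_0: "smooth 0"
  unfolding smooth_def rcomm_simps using nuclear_0 by blast+

lemma smooth_scaleC: "smooth a \<Longrightarrow> smooth (c *\<^sub>C a)"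
  unfolding smooth_def rcomm_simps using nuclear_scaleC by metis

lemma smooth_add: "smooth a \<Longrightarrow> smooth b \<Longrightarrow> smooth (a + b)"
  unfolding smooth_def rcomm_simps using nuclear.plus by metis

lemma smooth_diff: "smooth a \<Longrightarrow> smooth b \<Longrightarrow> smooth (a - b)"
  unfolding smooth_def rcomm_simps using nuclear_diff by metis

lemma smooth_mult: "smooth a \<Longrightarrow> smooth b \<Longrightarrow> smooth (a * b)"
  unfolding smooth_def rcomm_simps
  using nuclear.plus[OF nuclear_mult_right nuclear_mult_left] by metis

lemmas smooth_simps = smooth_sgen smooth_0 smooth_1 smooth_scaleC smooth_add smooth_diff smooth_mult

lemma smooth_power: "smooth a \<Longrightarrow> smooth (a ^ k)"
  by (induction k) (auto intro: smooth_simps)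

lemma smooth_ncpolys: "p \<in> ncpolys \<Longrightarrow> smooth p"
proof (induction rule: ncpolys_induct)
  case (plus q c w)
  have "smooth (monom_op w)" by (induction w) (auto intro: smooth_simps)
  then show ?case by (intro smooth_simps plus.IH)
qed (rule smooth_simps)

lemma smooth_sum: "(\<And>i. i \<in> A \<Longrightarrow> smooth (f i)) \<Longrightarrow> smooth (sum f A)"
  by (induction A rule: infinite_finite_induct) (auto intro: smooth_simps)

definition deriv_op :: "'n::finite scalg ^ 'n \<Rightarrow> 'n scalg \<Rightarrow> 'n list cop" where
  "deriv_op b a = (1/2) *\<^sub>R (\<Sum>j\<in>UNIV. right_mult (b $ j) * rcomm a j)"

definition right_mult_norm :: "'n::finite scalg ^ 'n \<Rightarrow> real" where
  "right_mult_norm b = (\<Sum>j\<in>UNIV. norm (right_mult (b $ j)))"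

lemma nuclear_deriv_op:
  assumes "\<And>j. nuclear e (rcomm a j)"
  shows "nuclear (right_mult_norm b * e) (deriv_op b a)"
proof -
  have n: "nuclear (right_mult_norm b * e) (\<Sum>j\<in>UNIV. right_mult (b $ j) * rcomm a j)"
    unfolding right_mult_norm_def sum_distrib_right
    by (intro nuclear_sum nuclear_mult_left assms) auto
  have "nuclear (cmod (1/2) * (right_mult_norm b * e)) (deriv_op b a)"
    unfolding deriv_op_def scaleR_scaleC using nuclear_scaleC[OF n, of "1/2"] by simp
  then show ?thesis by (rule nuclear_mono) (use nuclear_nonneg[OF n] in \<open>simp add: mult.commute\<close>)
qed

lemma smooth_bound:
  fixes a :: "'n::finite scalg"
  assumes "smooth a"
  shows "\<exists>e. \<forall>j. nuclear e (rcomm a j)"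
proof -
  obtain c where c: "\<And>j. nuclear (c j) (rcomm a j)" using assms unfolding smooth_def by metis
  have "c j \<le> sum c UNIV" for j
    by (rule member_le_sum) (use nuclear_nonneg[OF c] in auto)
  then show ?thesis using c nuclear_mono by blast
qed

lemma smooth_deriv_op: "smooth a \<Longrightarrow> \<exists>c. nuclear c (deriv_op b a)"
  using smooth_bound nuclear_deriv_op by blast

text \<open>The value of the functional \<open>\<D>\<^sub>b a\<close> at \<open>c\<close>.\<close>

definition deriv_fun :: "'n::finite scalg ^ 'n \<Rightarrow> 'n scalg \<Rightarrow> 'n scalg \<Rightarrow> complex" where
  "deriv_fun b a c = Trace (deriv_op b a * op c)"

lemma deriv_along_apply:
  assumes "smooth a"
  shows "deriv_along b a \<in> L1" "blinfun_apply (deriv_along b a) c = deriv_fun b a c"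
proof -
  obtain e where "nuclear e (deriv_op b a)" using smooth_deriv_op[OF assms] by blast
  then show "deriv_along b a \<in> L1" "blinfun_apply (deriv_along b a) c = deriv_fun b a c"
    using Phi_nuclear[of e "deriv_op b a"] by (simp_all add: deriv_along_def deriv_op_def deriv_fun_def)
qed

lemma deriv_fun_bound:
  assumes "\<And>j. nuclear e (rcomm a j)"
  shows "cmod (deriv_fun b a c) \<le> right_mult_norm b * e * norm c"
  unfolding deriv_fun_def
  using nuclear_Trace(2)[OF nuclear_mult_right[OF nuclear_deriv_op[OF assms], where A = "op c"]] by simp

lemma sum_scaleC_cop: "(\<Sum>j\<in>A. k *\<^sub>C f j) = k *\<^sub>C (sum f A :: 'a cop)"
  by (induction A rule: infinite_finite_induct)
    (auto simp: scaleC_add_right scaleC_zero_ell2 intro!: cop_eqI)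

lemma deriv_op_simps:
  "deriv_op b (a + a') = deriv_op b a + deriv_op b a'"
  "deriv_op b (a - a') = deriv_op b a - deriv_op b a'"
  "deriv_op b (k *\<^sub>C a) = k *\<^sub>C deriv_op b a"
  "deriv_op b 0 = 0" "deriv_op b 1 = 0"
  "deriv_op b (a * a') = deriv_op b a * op a' + op a * deriv_op b a'"
proof -
  show "deriv_op b (k *\<^sub>C a) = k *\<^sub>C deriv_op b a"
    unfolding deriv_op_def rcomm_simps scaleC_times_cop sum_scaleC_cop scaleR_scaleC
    by (simp add: scaleC_scaleC mult.commute)
  have "right_mult (b $ j) * (op a * X) = op a * (right_mult (b $ j) * X)" for j X
    by (metis mult.assoc right_mult_commute)
  then show "deriv_op b (a * a') = deriv_op b a * op a' + op a * deriv_op b a'"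
    unfolding deriv_op_def rcomm_simps
    by (simp add: distrib_left sum.distrib scaleR_add_right sum_distrib_left sum_distrib_right mult.assoc)
qed (simp_all add: deriv_op_def rcomm_simps distrib_left right_diff_distrib sum.distrib sum_subtractf
    scaleR_add_right scaleR_diff_right)

lemma deriv_fun_left:
  assumes "smooth a" "smooth a'"
  shows "deriv_fun b (a + a') c = deriv_fun b a c + deriv_fun b a' c"
    "deriv_fun b (a - a') c = deriv_fun b a c - deriv_fun b a' c"
proof -
  obtain e e' where n: "nuclear e (deriv_op b a)" "nuclear e' (deriv_op b a')"
    using smooth_deriv_op assms by meson
  note m = nuclear_mult_right[OF n(1), of "op c"] nuclear_mult_right[OF n(2), of "op c"]
  show "deriv_fun b (a + a') c = deriv_fun b a c + deriv_fun b a' c"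
    using Trace_add[OF m] by (simp add: deriv_fun_def deriv_op_simps distrib_right)
  show "deriv_fun b (a - a') c = deriv_fun b a c - deriv_fun b a' c"
    using Trace_diff[OF m] by (simp add: deriv_fun_def deriv_op_simps left_diff_distrib)
qed

lemma deriv_fun_scaleC: "deriv_fun b (k *\<^sub>C a) c = k * deriv_fun b a c"
  by (simp add: deriv_fun_def deriv_op_simps scaleC_times_cop Trace_scaleC)

lemma deriv_fun_0 [simp]: "deriv_fun b 0 c = 0" "deriv_fun b 1 c = 0"
  by (simp_all add: deriv_fun_def deriv_op_simps)

lemma deriv_fun_sum:
  "(\<And>i. i \<in> A \<Longrightarrow> smooth (f i)) \<Longrightarrow> deriv_fun b (sum f A) c = (\<Sum>i\<in>A. deriv_fun b (f i) c)"
  by (induction A rule: infinite_finite_induct) (auto simp: deriv_fun_left smooth_sum)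

lemma deriv_fun_right:
  assumes "smooth a"
  shows "deriv_fun b a (c + d) = deriv_fun b a c + deriv_fun b a d"
    "deriv_fun b a (c - d) = deriv_fun b a c - deriv_fun b a d"
proof -
  obtain e where n: "nuclear e (deriv_op b a)" using smooth_deriv_op assms by meson
  note m = nuclear_mult_right[OF n, of "op c"] nuclear_mult_right[OF n, of "op d"]
  show "deriv_fun b a (c + d) = deriv_fun b a c + deriv_fun b a d"
    using Trace_add[OF m] by (simp add: deriv_fun_def distrib_left)
  show "deriv_fun b a (c - d) = deriv_fun b a c - deriv_fun b a d"
    using Trace_diff[OF m] by (simp add: deriv_fun_def right_diff_distrib)
qed

text \<open>The Leibniz rule, paired with \<open>c\<close>: right multiplications commute with \<open>a\<close>, and the trace property
  moves \<open>a\<close> behind \<open>c\<close>.\<close>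

lemma deriv_fun_mult:
  assumes "smooth a" "smooth a'"
  shows "deriv_fun b (a * a') c = deriv_fun b a (a' * c) + deriv_fun b a' (c * a)"
proof -
  obtain e e' where n: "nuclear e (deriv_op b a)" "nuclear e' (deriv_op b a')"
    using smooth_deriv_op assms by meson
  have "deriv_fun b (a * a') c = Trace (deriv_op b a * op (a' * c) + op a * (deriv_op b a' * op c))"
    by (simp add: deriv_fun_def deriv_op_simps distrib_right mult.assoc)
  also have "\<dots> = Trace (deriv_op b a * op (a' * c)) + Trace (op a * (deriv_op b a' * op c))"
    by (rule Trace_add[OF nuclear_mult_right[OF n(1)] nuclear_mult_left[OF nuclear_mult_right[OF n(2)]]])
  also have "Trace (op a * (deriv_op b a' * op c)) = Trace (deriv_op b a' * op (c * a))"
    using Trace_commute[OF nuclear_mult_right[OF n(2)], of "op c" "op a"] by (simp add: mult.assoc)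
  finally show ?thesis by (simp add: deriv_fun_def)
qed

lemma deriv_fun_sgen:
  fixes b :: "'n::finite scalg ^ 'n"
  shows "deriv_fun b (sgen i) c = tau (b $ i * c)"
proof -
  have "deriv_op b (sgen i) = (1/2) *\<^sub>R (\<Sum>j\<in>UNIV. if i = j then 2 *\<^sub>R (right_mult (b $ j) * vacuum_proj) else 0)"
    unfolding deriv_op_def rcomm_sgen by (intro arg_cong[of _ _ "scaleR _"] sum.cong) auto
  also have "\<dots> = right_mult (b $ i) * vacuum_proj" by (simp add: sum.delta)
  finally have d: "deriv_op b (sgen i) = right_mult (b $ i) * vacuum_proj" .
  let ?X = "op c * (right_mult (b $ i) * vacuum_proj)"
  have X: "coord (?X \<cdot> ket w) w = (if w = [] then coord (op (c * b $ i) \<cdot> vacuum) [] else 0)" for w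
    using right_mult_apply[of "b $ i" 1] by (simp add: vacuum_proj)
  have "deriv_fun b (sgen i) c = Trace ?X"
    unfolding deriv_fun_def d
    by (rule Trace_commute[OF nuclear_mult_left[OF nuclear_vacuum_proj]])
  also have "\<dots> = (\<Sum>\<^sub>\<infinity>w :: 'n list. if w = [] then coord (op (c * b $ i) \<cdot> vacuum) [] else 0)"
    unfolding Trace_def cinner_ket_right X ..
  also have "\<dots> = coord (op (c * b $ i) \<cdot> vacuum) []"
    by (rule infsumI[OF has_sum_finite_neutralI[of "{[]}"]]) auto
  also have "\<dots> = tau (c * b $ i)" by (simp add: tau_def)
  finally show ?thesis by (simp add: tau_commute)
qed

lemma deriv_fun_monom: "deriv_fun b (monom_op w) c =
    (\<Sum>k<length w. tau (b $ (w ! k) * monom_op (drop (Suc k) w) * c * monom_op (take k w)))"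
proof (induction w arbitrary: c)
  case (Cons j w)
  have "smooth (monom_op w)"
    using smooth_ncpolys[OF ncpolys_monom[of 1 w]] by (simp add: scaleC_one)
  then have "deriv_fun b (monom_op (j # w)) c =
      tau (b $ j * (monom_op w * c)) + deriv_fun b (monom_op w) (c * sgen j)"
    by (simp add: deriv_fun_mult smooth_simps deriv_fun_sgen)
  then show ?case by (simp add: Cons sum.lessThan_Suc_shift mult.assoc del: sum.lessThan_Suc)
qed simp

text \<open>On polynomials, \<open>\<tau>(\<D>\<^sub>b p)\<close> pairs \<open>b\<close> with the cyclic gradient of \<open>p\<close>.\<close>

lemma div_free_deriv_fun:
  assumes div: "div_free (vec_toL1 b)" and p: "p \<in> ncpolys"
  shows "deriv_fun b p 1 = 0"
  using p
proof (induction rule: ncpolys_induct)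
  case (plus q c w)
  let ?m = "\<lambda>k. monom_op (drop (Suc k) w @ take k w)"
  have cd: "ncpoly_eval (cyclic_deriv j (Poly_Mapping.single w 1)) =
      (\<Sum>k<length w. if w ! k = j then ?m k else 0)" for j
  proof -
    have "cyclic_deriv j (Poly_Mapping.single w 1) =
        (\<Sum>k | k < length w \<and> w ! k = j. Poly_Mapping.single (drop (Suc k) w @ take k w) 1)"
      by (simp add: cyclic_deriv_def)
    then have "ncpoly_eval (cyclic_deriv j (Poly_Mapping.single w 1)) = (\<Sum>k | k < length w \<and> w ! k = j. ?m k)"
      by (simp add: ncpoly_eval_sum ncpoly_eval_single scaleC_one)
    also have "\<dots> = (\<Sum>k<length w. if w ! k = j then ?m k else 0)"
      by (subst sum.inter_filter[symmetric]) (auto intro: sum.cong)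
    finally show ?thesis .
  qed
  have ts: "tau (a * sum f A) = (\<Sum>k\<in>A. tau (a * f k))" for a f and A :: "nat set"
    by (induction A rule: infinite_finite_induct) (auto simp: distrib_left)
  have "0 = (\<Sum>j\<in>UNIV. tau (b $ j * (\<Sum>k<length w. if w ! k = j then ?m k else 0)))"
    using div unfolding div_free_def vec_toL1_def by (simp flip: cd)
  also have "\<dots> = (\<Sum>j\<in>UNIV. \<Sum>k<length w. if w ! k = j then tau (b $ (w ! k) * ?m k) else 0)"
    unfolding ts by (intro sum.cong refl) auto
  also have "\<dots> = (\<Sum>k<length w. tau (b $ (w ! k) * ?m k))"
    by (subst sum.swap) (simp add: sum.delta)
  also have "\<dots> = deriv_fun b (monom_op w) 1"
    by (simp add: deriv_fun_monom mult.assoc)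
  finally have "deriv_fun b (monom_op w) 1 = 0" by simp
  moreover have "smooth (c *\<^sub>C monom_op w)" using ncpolys_monom smooth_ncpolys by blast
  ultimately show ?case
    using plus by (simp add: deriv_fun_left smooth_ncpolys deriv_fun_scaleC)
qed simp

text \<open>When \<open>c\<close> commutes with \<open>p\<close>, the \<open>k + 1\<close> terms of the Leibniz rule coincide.\<close>

lemma deriv_fun_power:
  assumes "smooth p" "c * p = p * c"
  shows "deriv_fun b (p ^ Suc k) c = of_nat (Suc k) * deriv_fun b p (p ^ k * c)"
  using assms(2)
proof (induction k arbitrary: c)
  case (Suc k)
  have "deriv_fun b (p ^ Suc (Suc k)) c = deriv_fun b p (p ^ Suc k * c) + deriv_fun b (p ^ Suc k) (c * p)"
    using assms(1) by (subst power_Suc) (simp only: deriv_fun_mult smooth_power)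
  also have "deriv_fun b (p ^ Suc k) (c * p) = of_nat (Suc k) * deriv_fun b p (p ^ k * (c * p))"
    by (rule Suc.IH) (simp add: Suc.prems mult.assoc)
  also have "p ^ k * (c * p) = p ^ Suc k * c"
    by (simp add: Suc.prems power_commutes flip: mult.assoc)
  finally show ?case by (simp add: algebra_simps)
qed (use assms(1) in simp)

lemma div_free_deriv_fun_power:
  assumes "div_free (vec_toL1 b)" "p \<in> ncpolys"
  shows "deriv_fun b p (p ^ k) = 0"
proof -
  have "p ^ Suc k \<in> ncpolys"
    by (induction k) (use assms(2) in \<open>auto intro: ncpolys_mult\<close>)
  then have "deriv_fun b (p ^ Suc k) 1 = 0" by (rule div_free_deriv_fun[OF assms(1)])
  then show ?thesis
    using deriv_fun_power[OF smooth_ncpolys[OF assms(2)], of 1 b k]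
    by (simp del: of_nat_Suc)
qed

section \<open>The derivative of the vorticity along the flow\<close>

lemma deriv_fun_vorticity:
  assumes w: "\<And>j. smooth (w $ j)"
  shows "deriv_fun v (vorticity w) c = \<i> * (\<Sum>j\<in>UNIV. deriv_fun v (w $ j) (c * sgen j - sgen j * c)
    + tau (v $ j * (w $ j * c - c * w $ j)))"
proof -
  have "deriv_fun v (vorticity w) c = \<i> * (\<Sum>j\<in>UNIV. deriv_fun v (commutator (sgen j) (w $ j)) c)"
    unfolding vorticity_def commutator_def deriv_fun_scaleC
    by (subst deriv_fun_sum) (auto intro: smooth_simps w)
  also have "(\<Sum>j\<in>UNIV. deriv_fun v (commutator (sgen j) (w $ j)) c) =
      (\<Sum>j\<in>UNIV. deriv_fun v (w $ j) (c * sgen j - sgen j * c) + tau (v $ j * (w $ j * c - c * w $ j)))"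
    unfolding commutator_def
    by (intro sum.cong refl)
      (simp add: deriv_fun_left deriv_fun_mult deriv_fun_sgen deriv_fun_right smooth_simps w right_diff_distrib)
  finally show ?thesis .
qed

lemma vorticity_ncpolys: "(\<And>j. w $ j \<in> ncpolys) \<Longrightarrow> vorticity w \<in> ncpolys"
  unfolding vorticity_def commutator_def
  by (intro ncpolys_scaleC ncpolys_sum ncpolys_diff ncpolys_mult ncpolys_sgen)

lemma C_infty_1_smooth: "a \<in> C_infty_1 \<Longrightarrow> smooth a"
  by (simp add: C_infty_1_def smooth_B_infty_1)

text \<open>A divergent \<open>trace_norm\<close> has the default value \<open>0\<close>. So a small \<open>B_norm\<close> bounds the commutators only
  after \<open>a - p\<close> is known to be smooth.\<close>

lemma C_infty_1_approx:
  fixes a :: "'n::finite scalg"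
  assumes a: "a \<in> C_infty_1" and e: "e > 0"
  shows "\<exists>p\<in>ncpolys. norm (a - p) < e \<and> (\<forall>j. nuclear e (rcomm (a - p) j))"
proof -
  obtain p where p: "p \<in> ncpolys" "B_norm (a - p) < e" using a e unfolding C_infty_1_def by blast
  have le: "trace_norm (rcomm (a - p) j) \<le> Max (range (\<lambda>j. trace_norm (rcomm (a - p) j)))" for j
    by (rule Max_ge) auto
  have "trace_class (rcomm (a - p) j)" for j
    using smooth_diff[OF C_infty_1_smooth[OF a] smooth_ncpolys[OF p(1)]]
    unfolding smooth_B_infty_1[symmetric] B_infty_1_def by blast
  then have "nuclear e (rcomm (a - p) j)" for j
    by (rule nuclear_mono[OF trace_class_nuclear])
      (use le[of j] p(2) norm_ge_zero[of "a - p"] in \<open>unfold B_norm_def, linarith\<close>)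
  moreover have "norm (a - p) < e"
    using le[of undefined] p(2) trace_norm_nonneg[of "rcomm (a - p) undefined"]
    unfolding B_norm_def by linarith
  ultimately show ?thesis using p(1) by blast
qed

lemma deriv_fun_tendsto:
  assumes a: "smooth a" and an: "\<And>n. smooth (an n)"
    and nuc: "\<And>n j. nuclear (e n) (rcomm (a - an n) j)" and e: "e \<longlonglongrightarrow> 0" and y: "yn \<longlonglongrightarrow> y"
  shows "(\<lambda>n. deriv_fun v (an n) (yn n)) \<longlonglongrightarrow> deriv_fun v a y"
proof -
  obtain E where E: "\<And>j. nuclear E (rcomm a j)" using smooth_bound[OF a] by blast
  let ?K = "right_mult_norm v"
  have "(\<lambda>n. deriv_fun v a y - deriv_fun v (an n) (yn n)) \<longlonglongrightarrow> 0"
  proof (rule Lim_null_comparison)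
    show "eventually (\<lambda>n. norm (deriv_fun v a y - deriv_fun v (an n) (yn n)) \<le>
        ?K * E * norm (y - yn n) + ?K * e n * norm (yn n)) sequentially"
    proof (intro always_eventually allI)
      fix n
      have "deriv_fun v a y - deriv_fun v (an n) (yn n) =
          deriv_fun v a (y - yn n) + deriv_fun v (a - an n) (yn n)"
        by (simp add: deriv_fun_left deriv_fun_right a an)
      then show "norm (deriv_fun v a y - deriv_fun v (an n) (yn n)) \<le>
          ?K * E * norm (y - yn n) + ?K * e n * norm (yn n)"
        using deriv_fun_bound[OF E, of v "y - yn n"] deriv_fun_bound[OF nuc, of v n "yn n"]
          norm_triangle_ineq[of "deriv_fun v a (y - yn n)" "deriv_fun v (a - an n) (yn n)"]
        by simp
    qed
    have "(\<lambda>n. ?K * E * norm (y - yn n) + ?K * e n * norm (yn n)) \<longlonglongrightarrow>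
        ?K * E * norm (y - y) + ?K * 0 * norm y"
      by (intro tendsto_intros e y)
    then show "(\<lambda>n. ?K * E * norm (y - yn n) + ?K * e n * norm (yn n)) \<longlonglongrightarrow> 0" by simp
  qed
  from tendsto_minus[OF this] have "(\<lambda>n. deriv_fun v (an n) (yn n) - deriv_fun v a y) \<longlonglongrightarrow> 0" by simp
  then show ?thesis by (rule LIM_zero_cancel)
qed

lemma bounded_linear_scaleC_scalg: "bounded_linear (\<lambda>a :: 'n scalg. c *\<^sub>C a)"
  by (rule bounded_linear_intro[where K = "cmod c"])
    (use norm_scaleC_scalg_le in \<open>auto simp: scaleC_add_right scaleR_scaleC scaleC_scaleC mult.commute\<close>)

lemma tendsto_scaleC_scalg: "(f \<longlongrightarrow> (a :: 'n scalg)) F \<Longrightarrow> ((\<lambda>n. c *\<^sub>C f n) \<longlongrightarrow> c *\<^sub>C a) F"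
  by (rule bounded_linear.tendsto[OF bounded_linear_scaleC_scalg])

lemma vorticity_approx:
  fixes v :: "'n::finite scalg ^ 'n"
  assumes v: "\<And>k. v $ k \<in> C_infty_1"
  shows "\<exists>w e. (\<forall>n k. w n $ k \<in> ncpolys) \<and> (\<forall>k. (\<lambda>n. w n $ k) \<longlonglongrightarrow> v $ k) \<and>
    (\<forall>n k j. nuclear (e n) (rcomm (v $ k - w n $ k) j)) \<and> e \<longlonglongrightarrow> 0 \<and>
    (\<lambda>n. vorticity (w n)) \<longlonglongrightarrow> vorticity v"
proof -
  define e where "e n = inverse (real (Suc n))" for n
  have e: "e \<longlonglongrightarrow> 0" unfolding e_def by (rule LIMSEQ_inverse_real_of_nat)
  have "\<forall>n k. \<exists>p\<in>ncpolys. norm (v $ k - p) < e n \<and> (\<forall>j. nuclear (e n) (rcomm (v $ k - p) j))"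
    using C_infty_1_approx[OF v] by (simp add: e_def)
  then obtain p where p: "\<And>n k. p n k \<in> ncpolys" "\<And>n k. norm (v $ k - p n k) < e n"
    "\<And>n k j. nuclear (e n) (rcomm (v $ k - p n k) j)" by metis
  define w where "w n = (\<chi> k. p n k)" for n
  have wv: "(\<lambda>n. w n $ k) \<longlonglongrightarrow> v $ k" for k
  proof -
    have "(\<lambda>n. w n $ k - v $ k) \<longlonglongrightarrow> 0"
      by (rule Lim_null_comparison[OF _ e])
        (use p(2) in \<open>auto simp: w_def norm_minus_commute less_imp_le\<close>)
    then show ?thesis by (rule LIM_zero_cancel)
  qed
  have "(\<lambda>n. vorticity (w n)) \<longlonglongrightarrow> vorticity v"
    unfolding vorticity_def commutator_def by (intro tendsto_scaleC_scalg tendsto_intros wv)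
  then show ?thesis using p e wv by (intro exI[of _ w] exI[of _ e]) (simp add: w_def)
qed

lemma vorticity_power_approx:
  fixes v :: "'n::finite scalg ^ 'n"
  assumes v: "\<And>k. v $ k \<in> C_infty_1"
  shows "vorticity v ^ k \<in> closure ncpolys"
proof -
  obtain w where w: "\<And>n k. w n $ k \<in> ncpolys" "(\<lambda>n. vorticity (w n)) \<longlonglongrightarrow> vorticity v"
    using vorticity_approx[OF v] by blast
  have "vorticity (w n) ^ k \<in> ncpolys" for n
    by (induction k) (auto intro: ncpolys_1 ncpolys_mult vorticity_ncpolys w)
  then show ?thesis
    unfolding closure_sequential
    by (intro exI[of _ "\<lambda>n. vorticity (w n) ^ k"]) (auto intro: tendsto_intros w)
qed

text \<open>The advection term contributes the derivative of \<open>\<Omega>\<close> along \<open>v\<close>: the terms \<open>\<D>\<^sub>v s\<^sub>j = v\<^sub>j\<close> drop out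
  by traciality. For polynomial \<open>\<Omega>\<close> the value at \<open>\<Omega>\<^sup>k\<close> is a multiple of \<open>\<tau>(\<D>\<^sub>v \<Omega>\<^sup>k\<^sup>+\<^sup>1) = 0\<close>; the general
  case is a limit in the norm of the smooth algebra.\<close>

lemma advection_vorticity_power:
  fixes v :: "'n::finite scalg ^ 'n"
  assumes v: "\<And>k. v $ k \<in> C_infty_1" and div: "div_free (vec_toL1 v)"
  shows "(\<Sum>j\<in>UNIV. deriv_fun v (v $ j) (vorticity v ^ k * sgen j - sgen j * vorticity v ^ k)) = 0"
proof -
  obtain w e where w: "\<And>n k. w n $ k \<in> ncpolys" "\<And>k. (\<lambda>n. w n $ k) \<longlonglongrightarrow> v $ k"
    "\<And>n k j. nuclear (e n) (rcomm (v $ k - w n $ k) j)" "e \<longlonglongrightarrow> 0"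
    "(\<lambda>n. vorticity (w n)) \<longlonglongrightarrow> vorticity v"
    using vorticity_approx[OF v] by metis
  let ?T = "\<lambda>w c. \<Sum>j\<in>UNIV. deriv_fun v (w $ j) (c * sgen j - sgen j * c)
    + tau (v $ j * (w $ j * c - c * w $ j))"
  have "?T (w n) (vorticity (w n) ^ k) = 0" for n
    using div_free_deriv_fun_power[OF div vorticity_ncpolys[OF w(1)], of n k]
      deriv_fun_vorticity[OF smooth_ncpolys[OF w(1)], of v n "vorticity (w n) ^ k"] by simp
  moreover have "(\<lambda>n. ?T (w n) (vorticity (w n) ^ k)) \<longlonglongrightarrow> ?T v (vorticity v ^ k)"
    by (intro tendsto_sum tendsto_add bounded_linear.tendsto[OF bounded_linear_tau]
        deriv_fun_tendsto[OF C_infty_1_smooth[OF v] smooth_ncpolys[OF w(1)] w(3,4)] tendsto_intros w(2,5))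
  ultimately have "?T v (vorticity v ^ k) = 0" by (simp add: LIMSEQ_const_iff)
  moreover have "tau (a * (a * c - c * a)) = 0" for a c :: "'n scalg"
    using tau_commute[of a "a * c"] by (simp add: right_diff_distrib mult.assoc)
  ultimately show ?thesis by simp
qed

section \<open>The pressure term\<close>

lemma L1_scaleC:
  assumes "\<xi> \<in> L1"
  shows "blinfun_apply \<xi> (c *\<^sub>C a) = c * blinfun_apply \<xi> a"
proof -
  obtain f where f: "\<And>n. f n \<in> range toL1" "f \<longlonglongrightarrow> \<xi>"
    using assms unfolding L1_def closure_sequential by auto
  have "blinfun_apply (f n) (c *\<^sub>C a) = c * blinfun_apply (f n) a" for n
    using f(1)[of n] by auto
  moreover have "(\<lambda>n. blinfun_apply (f n) (c *\<^sub>C a)) \<longlonglongrightarrow> blinfun_apply \<xi> (c *\<^sub>C a)"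
    "(\<lambda>n. c * blinfun_apply (f n) a) \<longlonglongrightarrow> c * blinfun_apply \<xi> a"
    by (intro tendsto_intros f(2))+
  ultimately show ?thesis by (simp add: LIMSEQ_unique)
qed

lemma blinfun_apply_sum: "blinfun_apply \<xi> (sum f A) = (\<Sum>a\<in>A. blinfun_apply \<xi> (f a))"
  by (induction A rule: infinite_finite_induct) (auto simp: blinfun.add_right)

lemma tau_sum: "tau (sum f A) = (\<Sum>a\<in>A. tau (f a))"
  by (induction A rule: infinite_finite_induct) auto

lemma tau_wick: "tau (a * wick w) = coord (op a \<cdot> vacuum) (rev w)"
  by (simp add: tau_product wick_vacuum)

lemma finite_words: "finite {w :: 'n::finite list. length w = k}"
  using finite_lists_length_eq[of "UNIV :: 'n set" k] by simp

text \<open>The Wick words of length \<open>k\<close> are a basis of the degree \<open>k\<close> part of \<open>M\<close> with dual basis, for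
  \<open>\<tau>(ab)\<close>, the reversed words.\<close>

lemma component_coord:
  fixes \<xi> :: "'n::finite dual"
  assumes \<xi>: "\<xi> \<in> L1"
  shows "coord (op (component k \<xi>) \<cdot> vacuum) u = (if length u = k then blinfun_apply \<xi> (wick (rev u)) else 0)"
proof -
  let ?P = "\<lambda>a. a \<in> tensor_power_alg k \<and> (\<forall>\<eta>\<in>tensor_power_alg k. tau (a * \<eta>) = blinfun_apply \<xi> \<eta>)"
  have wt: "wick w \<in> tensor_power_alg k" if "length w = k" for w :: "'n list"
    using that by (simp add: tensor_power_alg_def tensor_power_def wick_vacuum)
  have co: "coord (op a \<cdot> vacuum) u = (if length u = k then blinfun_apply \<xi> (wick (rev u)) else 0)"
    if "?P a" for a u
  proof (cases "length u = k")
    case True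
    then have "tau (a * wick (rev u)) = blinfun_apply \<xi> (wick (rev u))" using that wt[of "rev u"] by simp
    then show ?thesis using True by (simp add: tau_wick)
  qed (use that in \<open>auto simp: tensor_power_alg_def tensor_power_def\<close>)
  define a where "a = (\<Sum>w | length w = k. blinfun_apply \<xi> (wick (rev w)) *\<^sub>C wick w)"
  have ca: "coord (op a \<cdot> vacuum) u = (if length u = k then blinfun_apply \<xi> (wick (rev u)) else 0)" for u
    by (simp add: a_def op_sum cop_apply_sum coord_sum wick_vacuum finite_words sum.delta if_distrib cong: if_cong)
  have "?P a"
  proof (intro conjI ballI)
    show "a \<in> tensor_power_alg k" by (simp add: tensor_power_alg_def tensor_power_def ca)
    fix \<eta> :: "'n scalg" assume \<eta>: "\<eta> \<in> tensor_power_alg k"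
    define c where "c w = coord (op \<eta> \<cdot> vacuum) w" for w
    have e: "\<eta> = (\<Sum>w | length w = k. c w *\<^sub>C wick w)"
      by (rule vacuum_separating, rule ell2_eqI)
        (use \<eta> in \<open>auto simp: c_def op_sum cop_apply_sum coord_sum wick_vacuum finite_words sum.delta
          tensor_power_alg_def tensor_power_def if_distrib cong: if_cong\<close>)
    have "tau (a * \<eta>) = (\<Sum>w | length w = k. c w * tau (a * wick w))"
      by (subst e) (simp add: sum_distrib_left tau_sum)
    also have "\<dots> = (\<Sum>w | length w = k. c w * blinfun_apply \<xi> (wick w))"
      by (intro sum.cong) (auto simp: tau_wick ca)
    also have "\<dots> = blinfun_apply \<xi> \<eta>"
      by (subst e) (simp add: blinfun_apply_sum L1_scaleC[OF \<xi>])
    finally show "tau (a * \<eta>) = blinfun_apply \<xi> \<eta>" .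
  qed
  moreover have "b = a" if "?P b" for b
    by (rule vacuum_separating, rule ell2_eqI) (simp add: co[OF that] ca)
  ultimately have "?P (component k \<xi>)"
    unfolding component_def by (rule theI)
  then show ?thesis by (rule co)
qed

lemma span_projection:
  fixes x :: "'a::real_inner"
  assumes "finite B"
  shows "\<exists>y\<in>span B. \<forall>z\<in>span B. inner (x - y) z = 0"
  using assms
proof (induction B arbitrary: x rule: finite_induct)
  case (insert b B)
  obtain p where p: "p \<in> span B" "\<And>z. z \<in> span B \<Longrightarrow> inner (b - p) z = 0" using insert.IH by blast
  obtain y where y: "y \<in> span B" "\<And>z. z \<in> span B \<Longrightarrow> inner (x - y) z = 0" using insert.IH by blast
  define d where "d = b - p"
  define t where "t = inner (x - y) d / inner d d"
  have sub: "span B \<subseteq> span (insert b B)" by (rule span_mono) auto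
  have d: "d \<in> span (insert b B)"
    unfolding d_def using sub p(1) by (intro span_diff) (auto intro: span_base)
  show ?case
  proof (intro bexI ballI)
    show "y + t *\<^sub>R d \<in> span (insert b B)"
      using sub y(1) d by (intro span_add span_scale) auto
    fix z assume "z \<in> span (insert b B)"
    then obtain k where k: "z - k *\<^sub>R b \<in> span B" unfolding span_insert by blast
    define u where "u = z - k *\<^sub>R b + k *\<^sub>R p"
    have u: "u \<in> span B" unfolding u_def by (intro span_add span_scale k p(1))
    have z: "z = u + k *\<^sub>R d" by (simp add: u_def d_def algebra_simps)
    have du: "inner d u = 0" using p(2)[OF u] by (simp add: d_def)
    have dd: "t * inner d d = inner (x - y) d" by (cases "d = 0") (simp_all add: t_def)
    have "inner (x - (y + t *\<^sub>R d)) z = inner (x - y) u + k * inner (x - y) d - t * inner d u - k * (t * inner d d)"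
      unfolding z by (simp add: inner_diff_left inner_add_left inner_add_right algebra_simps)
    then show "inner (x - (y + t *\<^sub>R d)) z = 0" by (simp add: y(2)[OF u] du dd)
  qed
qed simp

definition ip_vec :: "'n::finite fock ^ 'n \<Rightarrow> 'n fock ^ 'n \<Rightarrow> complex" where
  "ip_vec x y = (\<Sum>j\<in>UNIV. cinner (x $ j) (y $ j))"

text \<open>The projection is constructed for the real inner product; as \<open>X\<close> is stable under \<open>i\<close>, orthogonality
  holds for the complex one.\<close>

lemma orth_proj_orthogonal:
  fixes X :: "('n::finite fock ^ 'n) set"
  assumes B: "finite B" "X = span B" and i: "\<And>z. z \<in> X \<Longrightarrow> (\<chi> j. \<i> *\<^sub>C z $ j) \<in> X" and z: "z \<in> X"
  shows "ip_vec (x - orth_proj X x) z = 0"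
proof -
  let ?P = "\<lambda>y. y \<in> X \<and> (\<forall>z\<in>X. (\<Sum>j\<in>UNIV. cinner (x $ j - y $ j) (z $ j)) = 0)"
  have re: "inner u z = Re (ip_vec u z)" for u z :: "'n fock ^ 'n"
    by (simp add: inner_vec_def inner_ell2_def ip_vec_def)
  obtain y where y: "y \<in> X" "\<And>z. z \<in> X \<Longrightarrow> inner (x - y) z = 0"
    using span_projection[OF B(1), of x] B(2) by blast
  have "ip_vec (x - y) z = 0" if z: "z \<in> X" for z
  proof -
    have "ip_vec (x - y) (\<chi> j. \<i> *\<^sub>C z $ j) = - \<i> * ip_vec (x - y) z"
      by (simp add: ip_vec_def cinner_scaleC_right sum_distrib_left)
    then show ?thesis using y(2)[OF z] y(2)[OF i[OF z]] by (simp add: re complex_eq_iff)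
  qed
  then have "?P y" using y(1) by (simp add: ip_vec_def)
  moreover have "y' = y" if y': "?P y'" for y'
  proof -
    have s: "y - y' \<in> X" using y(1) y' unfolding B(2) by (auto intro: span_diff)
    have "ip_vec (y - y') (y - y') = ip_vec (x - y') (y - y') - ip_vec (x - y) (y - y')"
      by (simp add: ip_vec_def cinner_diff_left sum_subtractf)
    also have "\<dots> = 0"
      using \<open>?P y\<close>[THEN conjunct2, THEN bspec, OF s] y'[THEN conjunct2, THEN bspec, OF s]
      by (simp add: ip_vec_def)
    finally have "inner (y - y') (y - y') = 0" by (simp add: re)
    then show ?thesis by simp
  qed
  ultimately have "?P (orth_proj X x)" unfolding orth_proj_def by (rule theI)
  then show ?thesis using z by (simp add: ip_vec_def)
qed

lemma tensor_power_span:
  "tensor_power k = span ((\<lambda>w :: 'n::finite list. ket w) ` {w. length w = k} \<union>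
    (\<lambda>w. \<i> *\<^sub>C ket w) ` {w. length w = k})"
  (is "_ = span ?B")
proof
  have "subspace (tensor_power k)"
    by (simp add: subspace_def tensor_power_def)
  moreover have "?B \<subseteq> tensor_power k" by (auto simp: tensor_power_def)
  ultimately show "span ?B \<subseteq> tensor_power k" by (rule span_minimal[rotated])
next
  show "tensor_power k \<subseteq> span ?B"
  proof
    fix \<xi> :: "'n fock" assume \<xi>: "\<xi> \<in> tensor_power k"
    have "\<xi> = (\<Sum>w | length w = k. Re (coord \<xi> w) *\<^sub>R ket w + Im (coord \<xi> w) *\<^sub>R \<i> *\<^sub>C ket w)"
      by (rule ell2_eqI)
        (use \<xi> in \<open>auto simp: tensor_power_def coord_sum finite_words sum.delta if_distrib sum.distrib
          complex_eq_iff cong: if_cong\<close>)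
    also have "\<dots> \<in> span ?B"
      by (intro span_sum span_add span_scale span_base) auto
    finally show "\<xi> \<in> span ?B" .
  qed
qed

text \<open>The generator of \<open>\<X>\<^sub>k\<close> given by a word has only the entries \<open>tl u\<close> at \<open>hd u\<close> and \<open>- butlast u\<close> at
  \<open>last u\<close>. Orthogonality to these fields makes \<open>q\<^sub>j(wick w)\<close> a function of the cyclic rotation class of
  \<open>j # w\<close>.\<close>

lemma pressure_rotation:
  fixes q :: "'n::finite dual ^ 'n"
  assumes L1: "\<And>j. q $ j \<in> L1" and P: "\<And>k. Piproj k q = 0" and u: "u \<noteq> []"
  shows "blinfun_apply (q $ last u) (wick (butlast u)) = blinfun_apply (q $ hd u) (wick (tl u))"
proof -
  define D :: "'n fock \<Rightarrow> 'n fock ^ 'n" where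
    "D \<xi> = (\<chi> j. (adjoint_cop (lcr j) - adjoint_cop (rcr j)) \<cdot> \<xi>)" for \<xi>
  define k where "k = length u - 1"
  have linD: "linear D"
    by (rule linearI) (simp_all add: D_def vec_eq_iff scaleR_diff_right)
  have X: "Xspace k = D ` tensor_power (k + 1)" by (simp add: Xspace_def D_def[abs_def])
  let ?B = "ket ` {w :: 'n list. length w = k + 1} \<union> (\<lambda>w. \<i> *\<^sub>C ket w) ` {w. length w = k + 1}"
  have Xspan: "Xspace k = span (D ` ?B)"
    unfolding X tensor_power_span by (rule linear_span_image[OF linD, symmetric])
  have fin: "finite (D ` ?B)" using finite_words[of "k + 1"] by blast
  have rotX: "(\<chi> j. \<i> *\<^sub>C z $ j) \<in> Xspace k" if z: "z \<in> Xspace k" for z :: "'n fock ^ 'n"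
  proof -
    obtain \<xi> where \<xi>: "\<xi> \<in> tensor_power (k + 1)" "z = D \<xi>" using z unfolding X by auto
    have "(\<chi> j. \<i> *\<^sub>C z $ j) = D (\<i> *\<^sub>C \<xi>)"
      by (simp add: \<xi> D_def vec_eq_iff scaleC_diff_ell2)
    moreover have "\<i> *\<^sub>C \<xi> \<in> tensor_power (k + 1)" using \<xi>(1) by (simp add: tensor_power_def)
    ultimately show ?thesis unfolding X by blast
  qed
  let ?r = "rev u"
  have "ket ?r \<in> tensor_power (k + 1)" using u by (simp add: tensor_power_def k_def)
  then have "D (ket ?r) \<in> Xspace k" unfolding X by (rule imageI)
  then have "ip_vec (Qproj k q) (D (ket ?r)) = 0"
    using orth_proj_orthogonal[OF fin Xspan rotX, of "D (ket ?r)" "Qproj k q"] P[of k]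
    by (simp add: Piproj_def)
  moreover have "D (ket ?r) $ j = (if j = last u then ket (rev (butlast u)) else 0)
      - (if j = hd u then ket (rev (tl u)) else 0)" for j
  proof (rule ell2_eqI)
    fix w
    have "j # w = rev u \<longleftrightarrow> j = last u \<and> w = rev (butlast u)"
      using u by (metis append_butlast_last_id list.inject rev.simps(2) rev_append rev_rev_ident rev_swap
          append_Cons append_Nil)
    moreover have "w @ [j] = rev u \<longleftrightarrow> j = hd u \<and> w = rev (tl u)"
      using u by (cases u) auto
    ultimately show "coord (D (ket ?r) $ j) w = coord ((if j = last u then ket (rev (butlast u)) else 0)
      - (if j = hd u then ket (rev (tl u)) else 0)) w"
      by (simp add: D_def coord_lcr_adj coord_rcr_adj)
  qed
  moreover have "cinner x (if c then y else 0) = (if c then cinner x y else 0)" for c and x y :: "'n fock"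
    by simp
  ultimately have "(\<Sum>j\<in>UNIV. (if j = last u then coord (Qproj k q $ j) (rev (butlast u)) else 0)
      - (if j = hd u then coord (Qproj k q $ j) (rev (tl u)) else 0)) = 0"
    by (simp only: ip_vec_def cinner_diff_right cinner_ket_right)
  then have "coord (Qproj k q $ last u) (rev (butlast u)) = coord (Qproj k q $ hd u) (rev (tl u))"
    by (simp add: sum_subtractf sum.delta)
  then show ?thesis
    using u by (simp add: Qproj_def component_coord[OF L1] k_def)
qed

lemma wick_sgen: "wick w * sgen j = wick (w @ [j]) + (if w \<noteq> [] \<and> last w = j then wick (butlast w) else 0)"
proof (rule vacuum_separating, rule ell2_eqI)
  fix u
  let ?r = "wick (w @ [j]) + (if w \<noteq> [] \<and> last w = j then wick (butlast w) else 0)"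
  have "op (wick w * sgen j) \<cdot> vacuum = right_semicircular j \<cdot> ket w"
    using op_monom_vacuum[of "wick w" "[j]"] by (simp add: wick_vacuum)
  then have "coord (op (wick w * sgen j) \<cdot> vacuum) u = coord (right_semicircular j \<cdot> ket w) u" by simp
  also have "\<dots> = coord (op ?r \<cdot> vacuum) u"
    by (cases u rule: rev_cases; cases w rule: rev_cases)
      (auto simp: coord_right_semicircular coord_semicircular wick_vacuum butlast_append split: list.splits)
  finally show "coord (op (wick w * sgen j) \<cdot> vacuum) u =
      coord (op ?r \<cdot> vacuum) u" .
qed

text \<open>On a Wick word the commutator with \<open>s\<^sub>j\<close> has a part of degree one higher and a part of degree one
  lower. After summation over \<open>j\<close> both cancel by rotation invariance.\<close>

lemma pressure_commutator:
  fixes q :: "'n::finite dual ^ 'n"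
  assumes L1: "\<And>j. q $ j \<in> L1" and P: "\<And>k. Piproj k q = 0" and p: "p \<in> closure ncpolys"
  shows "(\<Sum>j\<in>UNIV. blinfun_apply (q $ j) (p * sgen j - sgen j * p)) = 0"
proof -
  let ?G = "\<lambda>p. \<Sum>j\<in>UNIV. blinfun_apply (q $ j) (p * sgen j - sgen j * p)"
  note rot = pressure_rotation[OF L1 P]
  have wick: "?G (wick w) = 0" for w
  proof -
    have "blinfun_apply (q $ j) (wick w * sgen j - sgen j * wick w) =
        (if w \<noteq> [] \<and> j = last w then blinfun_apply (q $ j) (wick (butlast w)) else 0)
        - (if w \<noteq> [] \<and> j = hd w then blinfun_apply (q $ j) (wick (tl w)) else 0)" for j
    proof -
      have "blinfun_apply (q $ j) (wick (w @ [j])) = blinfun_apply (q $ j) (wick (j # w))"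
        using rot[of "j # w @ [j]"] by (simp add: butlast_append)
      moreover have "wick w * sgen j - sgen j * wick w = wick (w @ [j]) - wick (j # w)
          + ((if w \<noteq> [] \<and> j = last w then wick (butlast w) else 0)
             - (if w \<noteq> [] \<and> j = hd w then wick (tl w) else 0))"
        unfolding wick_sgen sgen_wick by (cases w) simp_all
      moreover have "blinfun_apply (q $ j) (if c then x else 0) =
          (if c then blinfun_apply (q $ j) x else 0)" for c x by simp
      ultimately show ?thesis by (simp only: blinfun.add_right blinfun.diff_right diff_self add_0)
    qed
    then have "?G (wick w) = (\<Sum>j\<in>UNIV. (if w \<noteq> [] \<and> j = last w then blinfun_apply (q $ j) (wick (butlast w)) else 0)
        - (if w \<noteq> [] \<and> j = hd w then blinfun_apply (q $ j) (wick (tl w)) else 0))" by simp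
    also have "\<dots> = 0"
      by (cases "w = []") (simp_all add: sum_subtractf sum.delta rot[of w])
    finally show ?thesis .
  qed
  have "?G p = 0" if "p \<in> ncpolys" for p
    using ncpolys_wick_span[OF that]
  proof (induction rule: wick_span.induct)
    case (plus a b)
    have "?G (a + b) = ?G a + ?G b"
      unfolding sum.distrib[symmetric]
      by (intro sum.cong refl) (simp add: algebra_simps blinfun.add_right blinfun.diff_right)
    then show ?case using plus.IH by simp
  next
    case (scale a c)
    have "?G (c *\<^sub>C a) = c * ?G a"
      unfolding sum_distrib_left
      by (intro sum.cong refl) (simp add: algebra_simps blinfun.diff_right L1_scaleC[OF L1])
    then show ?case using scale.IH by simp
  qed (simp_all add: wick)
  moreover obtain f where f: "\<And>n. f n \<in> ncpolys" "f \<longlonglongrightarrow> p"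
    using p unfolding closure_sequential by auto
  ultimately have "(\<lambda>n. ?G (f n)) = (\<lambda>n. 0)" by auto
  moreover have "(\<lambda>n. ?G (f n)) \<longlonglongrightarrow> ?G p" by (intro tendsto_intros f(2))
  ultimately show ?thesis by (simp add: LIMSEQ_const_iff)
qed

section \<open>Resolvents of self-adjoint elements\<close>

inductive power_span :: "'n scalg \<Rightarrow> 'n scalg \<Rightarrow> bool" for a where
  zero: "power_span a 0"
| plus: "power_span a p \<Longrightarrow> power_span a (p + c *\<^sub>C a ^ k)"

lemma power_span_power: "power_span a (a ^ k)"
  using power_span.plus[OF power_span.zero, of a 1 k] by (simp add: scaleC_one)

lemma power_span_add: "power_span a q \<Longrightarrow> power_span a p \<Longrightarrow> power_span a (p + q)"
  by (induction rule: power_span.induct) (auto simp: power_span.plus simp flip: add.assoc)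

lemma power_span_scaleC: "power_span a p \<Longrightarrow> power_span a (c *\<^sub>C p)"
  by (induction rule: power_span.induct)
    (auto simp: scaleC_add_right scaleC_scaleC intro: power_span.intros)

lemma power_span_mult_power: "power_span a p \<Longrightarrow> power_span a (p * a ^ k)"
  by (induction rule: power_span.induct)
    (auto simp: distrib_right simp flip: power_add intro: power_span.intros)

lemma power_span_mult: "power_span a q \<Longrightarrow> power_span a p \<Longrightarrow> power_span a (p * q)"
  by (induction rule: power_span.induct)
    (auto simp: distrib_left intro: power_span.zero power_span_add power_span_scaleC power_span_mult_power)

definition power_closure :: "'n scalg \<Rightarrow> 'n scalg set" where
  "power_closure a = closure (Collect (power_span a))"

lemma power_closure_base: "power_span a p \<Longrightarrow> p \<in> power_closure a"
  unfolding power_closure_def by (rule subsetD[OF closure_subset]) simp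

lemma power_closure_add:
  assumes "p \<in> power_closure a" "q \<in> power_closure a"
  shows "p + q \<in> power_closure a"
proof -
  obtain f g where "\<And>n. power_span a (f n)" "f \<longlonglongrightarrow> p" "\<And>n. power_span a (g n)" "g \<longlonglongrightarrow> q"
    using assms unfolding power_closure_def closure_sequential by auto
  then show ?thesis
    unfolding power_closure_def closure_sequential
    by (intro exI[of _ "\<lambda>n. f n + g n"]) (auto intro: tendsto_add power_span_add)
qed

lemma power_closure_mult:
  assumes "p \<in> power_closure a" "q \<in> power_closure a"
  shows "p * q \<in> power_closure a"
proof -
  obtain f g where "\<And>n. power_span a (f n)" "f \<longlonglongrightarrow> p" "\<And>n. power_span a (g n)" "g \<longlonglongrightarrow> q"
    using assms unfolding power_closure_def closure_sequential by auto
  then show ?thesis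
    unfolding power_closure_def closure_sequential
    by (intro exI[of _ "\<lambda>n. f n * g n"]) (auto intro: tendsto_mult power_span_mult)
qed

lemma power_closure_scaleC: "p \<in> power_closure a \<Longrightarrow> c *\<^sub>C p \<in> power_closure a"
  using power_closure_mult[OF power_closure_base[OF power_span_scaleC[OF power_span_power[of a 0], of c]]]
  by simp

lemma power_closure_1: "1 \<in> power_closure a"
  using power_closure_base[OF power_span_power[of a 0]] by simp

lemma power_closure_self: "a \<in> power_closure a"
  using power_closure_base[OF power_span_power[of a 1]] by simp

lemma power_closure_power: "b \<in> power_closure a \<Longrightarrow> b ^ n \<in> power_closure a"
  by (induction n) (auto intro: power_closure_1 power_closure_mult)

lemma power_closure_suminf:
  assumes "summable f" "\<And>n. f n \<in> power_closure a"
  shows "suminf f \<in> power_closure a"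
proof (rule closed_sequentially)
  show "closed (power_closure a)" by (simp add: power_closure_def)
  show "(\<lambda>n. \<Sum>i<n. f i) \<longlonglongrightarrow> suminf f" using assms(1) by (rule summable_LIMSEQ)
  show "(\<Sum>i<n. f i) \<in> power_closure a" for n
    by (induction n) (auto intro: power_closure_base power_span.zero power_closure_add assms(2))
qed

abbreviation shifted :: "real \<Rightarrow> 'n scalg \<Rightarrow> 'n scalg" where
  "shifted x a \<equiv> 1 + (\<i> * complex_of_real x) *\<^sub>C a"

lemma resolvent_norm_le:
  assumes a: "star a = a" and R: "shifted x a * R = 1"
  shows "norm R \<le> 1"
proof -
  have "norm (op R) \<le> 1"
  proof (rule norm_cop_bound)
    fix \<xi>
    let ?z = "op R \<cdot> \<xi>"
    have "op (shifted x a * R) \<cdot> \<xi> = op 1 \<cdot> \<xi>" by (simp only: R)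
    then have xi: "?z + (\<i> * complex_of_real x) *\<^sub>C op a \<cdot> ?z = \<xi>" by simp
    have "adjoint_cop (op a) = op a" using a by (metis op_star)
    then obtain r where "cinner (op a \<cdot> ?z) ?z = complex_of_real r"
      by (metis selfadjoint_cinner_real Reals_cases)
    then have "Re (cinner ((\<i> * complex_of_real x) *\<^sub>C op a \<cdot> ?z) ?z) = 0"
      by (simp add: cinner_scaleC_left)
    then have "(norm \<xi>)\<^sup>2 = (norm ?z)\<^sup>2 + (norm ((\<i> * complex_of_real x) *\<^sub>C op a \<cdot> ?z))\<^sup>2"
      using norm_sq_add[of ?z "(\<i> * complex_of_real x) *\<^sub>C op a \<cdot> ?z"] unfolding xi by simp
    then have "(norm ?z)\<^sup>2 \<le> (norm \<xi>)\<^sup>2" by simp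
    then show "norm ?z \<le> 1 * norm \<xi>" by (simp add: power2_le_iff_abs_le)
  qed simp
  then show ?thesis by simp
qed

definition is_resolvent :: "real \<Rightarrow> 'n scalg \<Rightarrow> 'n scalg \<Rightarrow> bool" where
  "is_resolvent x a R \<longleftrightarrow> R \<in> power_closure a \<and> R * shifted x a = 1 \<and> shifted x a * R = 1"

text \<open>The bound \<open>\<parallel>(1 + i x a)\<^sup>-\<^sup>1\<parallel> \<le> 1\<close> does not depend on \<open>x\<close>, so Neumann series extend the resolvent in
  steps of constant length, without leaving the closed algebra generated by \<open>a\<close>.\<close>

lemma resolvent_step:
  assumes a: "star a = a" and R: "is_resolvent x a R" and small: "\<bar>y - x\<bar> * norm a < 1"
  shows "\<exists>R'. is_resolvent y a R'"
proof -
  define b where "b = - ((\<i> * complex_of_real (y - x)) *\<^sub>C (R * a))"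
  have R': "R \<in> power_closure a" "R * shifted x a = 1" "shifted x a * R = 1"
    using R by (auto simp: is_resolvent_def)
  have "norm b \<le> \<bar>y - x\<bar> * norm (R * a)"
    using norm_scaleC_scalg_le[of "\<i> * complex_of_real (y - x)" "R * a"]
    by (simp add: b_def norm_mult del: of_real_diff)
  also have "\<dots> \<le> \<bar>y - x\<bar> * (1 * norm a)"
    using resolvent_norm_le[OF a R'(3)]
    by (intro mult_left_mono order_trans[OF norm_mult_ineq] mult_right_mono) auto
  finally have nb: "norm b < 1" using small by simp
  have bc: "b \<in> power_closure a"
    using power_closure_scaleC[OF power_closure_mult[OF R'(1) power_closure_self], of "- (\<i> * complex_of_real (y - x))"]
    unfolding b_def by (metis scaleC_minus1_scalg scaleC_scaleC mult_minus1)
  define S where "S = suminf (\<lambda>n. b ^ n)"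
  have S: "(1 - b) * S = 1" "S * (1 - b) = 1" unfolding S_def by (rule neumann_series[OF nb])+
  have Sc: "S \<in> power_closure a"
    unfolding S_def
    by (intro power_closure_suminf complete_algebra_summable_geometric nb power_closure_power bc)
  have "shifted x a * (1 - b) = shifted x a + (\<i> * complex_of_real (y - x)) *\<^sub>C (shifted x a * R * a)"
    by (simp add: b_def distrib_left mult.assoc)
  also have "\<dots> = shifted y a"
    unfolding R'(3) by (simp add: add.assoc algebra_simps flip: scaleC_add_left)
  finally have eq: "shifted y a = shifted x a * (1 - b)" by simp
  have "S * R * shifted y a = S * (R * shifted x a) * (1 - b)" unfolding eq by (simp only: mult.assoc)
  then have 1: "S * R * shifted y a = 1" by (simp only: R'(2) S mult_1_right)
  have "shifted y a * (S * R) = shifted x a * ((1 - b) * S) * R" unfolding eq by (simp only: mult.assoc)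
  then have "shifted y a * (S * R) = 1" by (simp only: R'(3) S mult_1_right)
  then have "is_resolvent y a (S * R)"
    using 1 power_closure_mult[OF Sc R'(1)] by (simp add: is_resolvent_def)
  then show ?thesis by blast
qed

lemma is_resolvent_exists:
  assumes a: "star a = a"
  shows "\<exists>R. is_resolvent x a R"
proof -
  obtain N :: nat where N: "\<bar>x\<bar> * norm a < real N" using reals_Archimedean2 by blast
  have N0: "N > 0" using N by (metis gr0I abs_ge_zero mult_nonneg_nonneg norm_ge_zero not_le of_nat_0)
  have "\<exists>R. is_resolvent (real k * (x / real N)) a R" for k
  proof (induction k)
    case 0
    show ?case by (intro exI[of _ 1]) (simp add: is_resolvent_def power_closure_1)
  next
    case (Suc k)
    then obtain R where R: "is_resolvent (real k * (x / real N)) a R" by blast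
    have "real (Suc k) * (x / real N) - real k * (x / real N) = x / real N"
      by (simp add: add_divide_distrib algebra_simps)
    then have "\<bar>real (Suc k) * (x / real N) - real k * (x / real N)\<bar> * norm a < 1"
      using N N0 by (simp add: field_simps)
    then show ?case by (rule resolvent_step[OF a R])
  qed
  from this[of N] show ?thesis using N0 by simp
qed

definition resolvent :: "real \<Rightarrow> 'n scalg \<Rightarrow> 'n scalg" where
  "resolvent x a = (SOME R. is_resolvent x a R)"

lemma resolvent:
  assumes "star a = a"
  shows "resolvent x a \<in> power_closure a" "resolvent x a * shifted x a = 1" "shifted x a * resolvent x a = 1"
    "norm (resolvent x a) \<le> 1"
proof -
  have "is_resolvent x a (resolvent x a)"
    unfolding resolvent_def by (rule someI_ex[OF is_resolvent_exists[OF assms]])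
  then show "resolvent x a \<in> power_closure a" "resolvent x a * shifted x a = 1" "shifted x a * resolvent x a = 1"
    "norm (resolvent x a) \<le> 1"
    using resolvent_norm_le[OF assms] by (auto simp: is_resolvent_def)
qed

lemma resolvent_diff:
  assumes a: "star a = a" and b: "star b = b"
  shows "resolvent x b - resolvent x a =
    - ((\<i> * complex_of_real x) *\<^sub>C (resolvent x b * (b - a) * resolvent x a))"
proof -
  have "resolvent x b * (shifted x b - shifted x a) * resolvent x a =
      (resolvent x b * shifted x b) * resolvent x a - resolvent x b * (shifted x a * resolvent x a)"
    by (simp only: left_diff_distrib right_diff_distrib mult.assoc)
  also have "\<dots> = resolvent x a - resolvent x b" by (simp only: resolvent[OF a] resolvent[OF b] mult_1_left mult_1_right)
  also have "shifted x b - shifted x a = (\<i> * complex_of_real x) *\<^sub>C (b - a)"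
    using scaleC_add_right[of "\<i> * complex_of_real x" "b - a" a] by (simp add: algebra_simps)
  finally show ?thesis by simp
qed

lemma resolvent_series:
  assumes a: "star a = a" and x: "\<bar>x\<bar> * norm a < 1"
  shows "(\<lambda>n. ((- \<i>) ^ n * tau (a ^ n)) * complex_of_real x ^ n) sums tau (resolvent x a)"
proof -
  define b where "b = (- \<i> * complex_of_real x) *\<^sub>C a"
  have "norm b \<le> \<bar>x\<bar> * norm a"
    using norm_scaleC_scalg_le[of "- \<i> * complex_of_real x" a] by (simp add: b_def norm_mult)
  then have nb: "norm b < 1" using x by simp
  have ab: "shifted x a = 1 - b"
    using scaleC_minus1_scalg[of b] by (simp add: b_def scaleC_scaleC)
  have "resolvent x a = resolvent x a * ((1 - b) * suminf (\<lambda>n. b ^ n))" by (simp add: neumann_series[OF nb])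
  also have "\<dots> = suminf (\<lambda>n. b ^ n)"
    unfolding mult.assoc[symmetric] using resolvent(2)[OF a, of x] unfolding ab by simp
  finally have "(\<lambda>n. b ^ n) sums resolvent x a"
    using summable_sums[OF complete_algebra_summable_geometric[OF nb]] by simp
  then have "(\<lambda>n. tau (b ^ n)) sums tau (resolvent x a)"
    by (rule bounded_linear.sums[OF bounded_linear_tau])
  moreover have "b ^ n = ((- \<i> * complex_of_real x) ^ n) *\<^sub>C a ^ n" for n
    by (induction n) (simp_all add: b_def scaleC_one scaleC_scaleC mult_ac)
  moreover have "(- \<i> * complex_of_real x) ^ n * tau (a ^ n) = ((- \<i>) ^ n * tau (a ^ n)) * complex_of_real x ^ n" for n
    unfolding power_mult_distrib by (simp only: mult_ac)
  ultimately show ?thesis by (simp only: tau_simps)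
qed

lemma powser_coeffs_0:
  fixes c :: "nat \<Rightarrow> real"
  assumes r: "r > 0" and s: "\<And>x. \<bar>x\<bar> < r \<Longrightarrow> (\<lambda>n. c n * x ^ n) sums 0"
  shows "c n = 0"
proof (induction n rule: less_induct)
  case (less m)
  have "(\<lambda>n. c (n + m) * x ^ n) sums 0" if x: "x \<noteq> 0" "norm x < r" for x
  proof -
    have "(\<lambda>n. c (n + m) * x ^ (n + m)) sums (0 - (\<Sum>i<m. c i * x ^ i))"
      using s[of x] x by (intro sums_split_initial_segment) simp
    then have "(\<lambda>n. c (n + m) * x ^ (n + m) * inverse (x ^ m)) sums (0 * inverse (x ^ m))"
      by (intro sums_mult2) (simp add: less)
    then show ?thesis using x(1) by (simp add: power_add field_simps)
  qed
  then have "((\<lambda>x :: real. 0) \<longlongrightarrow> c (0 + m)) (at 0)" by (rule powser_limit_0_strong[OF r])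
  then show ?case by (simp add: tendsto_const_iff)
qed

text \<open>For small \<open>x\<close> both resolvent traces are power series in \<open>x\<close> with the moments as coefficients; the
  radius depends on the elements, which is harmless as only two are compared.\<close>

lemma moments_eq:
  assumes a: "star a = a" and b: "star b = b"
    and eq: "\<And>x. tau (resolvent x a) = tau (resolvent x b)"
  shows "tau (a ^ m) = tau (b ^ m)"
proof -
  define c where "c n = (- \<i>) ^ n * tau (a ^ n) - (- \<i>) ^ n * tau (b ^ n)" for n
  define r where "r = 1 / (norm a + norm b + 1)"
  have D: "norm a + norm b + 1 > 0" by (simp add: add_nonneg_pos)
  then have r: "r > 0" by (simp add: r_def)
  have sm: "(\<lambda>n. c n * complex_of_real (x ^ n)) sums 0" if "\<bar>x\<bar> < r" for x
  proof -
    have lt: "\<bar>x\<bar> * (norm a + norm b + 1) < 1" using that D by (simp add: r_def field_simps)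
    have "\<bar>x\<bar> * norm a \<le> \<bar>x\<bar> * (norm a + norm b + 1)" "\<bar>x\<bar> * norm b \<le> \<bar>x\<bar> * (norm a + norm b + 1)"
      by (intro mult_left_mono; simp)+
    then have "\<bar>x\<bar> * norm a < 1" "\<bar>x\<bar> * norm b < 1" using lt by linarith+
    then show ?thesis
      using sums_diff[OF resolvent_series[OF a] resolvent_series[OF b], of x x] eq[of x]
      by (simp add: c_def left_diff_distrib)
  qed
  have "Re (c m) = 0"
    by (rule powser_coeffs_0[OF r, of "\<lambda>n. Re (c n)"]) (use sums_Re[OF sm] in \<open>simp flip: of_real_power\<close>)
  moreover have "Im (c m) = 0"
    by (rule powser_coeffs_0[OF r, of "\<lambda>n. Im (c n)"]) (use sums_Im[OF sm] in \<open>simp flip: of_real_power\<close>)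
  ultimately have "c m = 0" by (simp add: complex_eq_iff)
  then show ?thesis by (simp add: c_def)
qed

section \<open>Differentiation of the resolvent trace\<close>

text \<open>Elements of \<open>L\<^sup>1\<close> are norm limits of elements of \<open>M\<close>, so on bounded families they are controlled by
  the pairing with \<open>M\<close>.\<close>

lemma L1_tendsto:
  assumes \<xi>: "\<xi> \<in> L1" and g: "\<And>s. norm (g s) \<le> M" and y: "\<And>y. ((\<lambda>s. tau (y * g s)) \<longlongrightarrow> 0) F"
  shows "((\<lambda>s. blinfun_apply \<xi> (g s)) \<longlongrightarrow> 0) F"
proof (rule tendstoI)
  fix e :: real assume e: "e > 0"
  have M: "0 \<le> M" using g[of undefined] norm_ge_zero order_trans by blast
  then have "e / (2 * (M + 1)) > 0" using e by simp
  then obtain \<eta> where \<eta>: "\<eta> \<in> range toL1" "dist \<eta> \<xi> < e / (2 * (M + 1))"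
    using \<xi> unfolding L1_def closure_approachable by blast
  from \<eta>(1) obtain y where y': "\<eta> = toL1 y" by blast
  have "eventually (\<lambda>s. dist (tau (y * g s)) 0 < e / 2) F"
    using y[of y] e by (intro tendstoD) auto
  then show "eventually (\<lambda>s. dist (blinfun_apply \<xi> (g s)) 0 < e) F"
  proof eventually_elim
    case (elim s)
    have "norm (blinfun_apply (\<xi> - \<eta>) (g s)) \<le> norm (\<xi> - \<eta>) * norm (g s)" by (rule norm_blinfun)
    also have "\<dots> \<le> e / (2 * (M + 1)) * M"
      using \<eta>(2) g[of s] M e by (intro mult_mono) (auto simp: dist_norm norm_minus_commute)
    also have "\<dots> \<le> e / 2" using M e by (simp add: field_simps)
    finally have 1: "norm (blinfun_apply (\<xi> - \<eta>) (g s)) \<le> e / 2" .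
    have "blinfun_apply \<xi> (g s) = blinfun_apply (\<xi> - \<eta>) (g s) + tau (y * g s)"
      by (simp add: y' blinfun.diff_left)
    then have "norm (blinfun_apply \<xi> (g s)) \<le> norm (blinfun_apply (\<xi> - \<eta>) (g s)) + norm (tau (y * g s))"
      by (metis norm_triangle_ineq)
    then show ?case using 1 elim by simp
  qed
qed

lemma paired_has_vector_derivative:
  fixes f :: "real \<Rightarrow> 'n dual"
  assumes f: "(f has_vector_derivative f') (at t within S)" and f0: "f t = 0"
    and g: "\<And>s. norm (g s) \<le> M"
    and lim: "((\<lambda>s. blinfun_apply f' (g s)) \<longlongrightarrow> blinfun_apply f' y) (at t within S)"
  shows "((\<lambda>s. blinfun_apply (f s) (g s)) has_vector_derivative blinfun_apply f' y) (at t within S)"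
  unfolding has_vector_derivative_def has_derivative_within
proof (intro conjI)
  let ?e = "\<lambda>s. (1 / norm (s - t)) *\<^sub>R (f s - (f t + (s - t) *\<^sub>R f'))"
  let ?q = "\<lambda>s. (1 / norm (s - t)) *\<^sub>R (blinfun_apply (f s) (g s) - (blinfun_apply (f t) (g t)
      + (s - t) *\<^sub>R blinfun_apply f' y))"
  have e: "(?e \<longlongrightarrow> 0) (at t within S)"
    using f unfolding has_vector_derivative_def has_derivative_within by blast
  show "(?q \<longlongrightarrow> 0) (at t within S)"
  proof (rule Lim_null_comparison)
    have "((\<lambda>s. norm (?e s) * M + norm (blinfun_apply f' (g s) - blinfun_apply f' y)) \<longlongrightarrow>
        norm (0 :: 'n dual) * M + norm (blinfun_apply f' y - blinfun_apply f' y)) (at t within S)"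
      by (intro tendsto_intros e lim)
    then show "((\<lambda>s. norm (?e s) * M + norm (blinfun_apply f' (g s) - blinfun_apply f' y)) \<longlongrightarrow> 0) (at t within S)"
      by simp
    show "eventually (\<lambda>s. norm (?q s) \<le> norm (?e s) * M + norm (blinfun_apply f' (g s) - blinfun_apply f' y))
      (at t within S)"
    proof (intro always_eventually allI)
      fix s
      let ?d = "blinfun_apply f' (g s) - blinfun_apply f' y"
      have "?q s = blinfun_apply (?e s) (g s) + ((s - t) / norm (s - t)) *\<^sub>R ?d"
        by (simp add: f0 blinfun.bilinear_simps scaleR_diff_right)
      moreover have "norm (blinfun_apply (?e s) (g s)) \<le> norm (?e s) * M"
        by (rule order_trans[OF norm_blinfun mult_left_mono[OF g norm_ge_zero]])
      moreover have "norm (((s - t) / norm (s - t)) *\<^sub>R ?d) \<le> 1 * norm ?d"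
        unfolding norm_scaleR by (intro mult_right_mono) (auto simp: abs_divide)
      ultimately show "norm (?q s) \<le> norm (?e s) * M + norm ?d"
        by (metis (no_types, lifting) add_mono norm_triangle_le mult_1)
    qed
  qed
qed (rule bounded_linear_scaleR_left)

lemma star_sum: "star (sum f A) = (\<Sum>a\<in>A. star (f a))"
  by (induction A rule: infinite_finite_induct) auto

lemma star_vorticity:
  assumes "\<And>j. star (w $ j) = w $ j"
  shows "star (vorticity w) = vorticity w"
proof -
  have "star (\<Sum>j\<in>UNIV. commutator (sgen j) (w $ j)) = - (\<Sum>j\<in>UNIV. commutator (sgen j) (w $ j))"
    unfolding star_sum sum_negf[symmetric] by (intro sum.cong refl) (simp add: commutator_def assms)
  then have "star (vorticity w) = cnj \<i> *\<^sub>C (- (\<Sum>j\<in>UNIV. commutator (sgen j) (w $ j)))"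
    unfolding vorticity_def by simp
  also have "\<dots> = vorticity w"
    unfolding vorticity_def scaleC_minus1_scalg[symmetric] by (simp add: scaleC_scaleC)
  finally show ?thesis .
qed

lemma tau_vorticity_diff: "tau ((vorticity v - vorticity w) * y) =
    \<i> * (\<Sum>j\<in>UNIV. tau ((v $ j - w $ j) * (y * sgen j - sgen j * y)))"
proof -
  have "vorticity v - vorticity w = \<i> *\<^sub>C (\<Sum>j\<in>UNIV. commutator (sgen j) (v $ j - w $ j))"
  proof -
    have "vorticity v = \<i> *\<^sub>C ((\<Sum>j\<in>UNIV. commutator (sgen j) (v $ j - w $ j)) + (\<Sum>j\<in>UNIV. commutator (sgen j) (w $ j)))"
      unfolding vorticity_def sum.distrib[symmetric]
      by (intro arg_cong[of _ _ "scaleC \<i>"] sum.cong refl) (simp add: commutator_def algebra_simps)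
    then show ?thesis unfolding scaleC_add_right by (simp add: vorticity_def[of w])
  qed
  then have "tau ((vorticity v - vorticity w) * y) = \<i> * (\<Sum>j\<in>UNIV. tau (commutator (sgen j) (v $ j - w $ j) * y))"
    by (simp add: sum_distrib_right tau_sum)
  moreover have "tau (commutator (sgen j) d * y) = tau (d * (y * sgen j - sgen j * y))" for j d
    using tau_commute[of "sgen j" "d * y"] by (simp add: commutator_def algebra_simps)
  ultimately show ?thesis by simp
qed

text \<open>Only the \<open>L\<^sup>1\<close>-distance of the fields enters on the right, and resolvents only as contractions.\<close>

lemma tau_resolvent_diff:
  fixes x :: real
  assumes v: "\<And>j. star (v $ j) = v $ j" and w: "\<And>j. star (w $ j) = w $ j"
  defines "Rv \<equiv> resolvent x (vorticity v)" and "Rw \<equiv> resolvent x (vorticity w)"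
  shows "tau (z * (Rv - Rw)) = complex_of_real x * (\<Sum>j\<in>UNIV. blinfun_apply (toL1 (v $ j) - toL1 (w $ j))
    (Rw * z * Rv * sgen j - sgen j * (Rw * z * Rv)))"
proof -
  have "tau (z * (Rv - Rw)) = - (\<i> * complex_of_real x) * tau (z * (Rv * ((vorticity v - vorticity w) * Rw)))"
    unfolding Rv_def Rw_def resolvent_diff[OF star_vorticity[of w, OF w] star_vorticity[of v, OF v]]
    by (simp add: mult.assoc)
  also have "tau (z * (Rv * ((vorticity v - vorticity w) * Rw))) =
      tau ((vorticity v - vorticity w) * (Rw * z * Rv))"
    using tau_commute[of "z * Rv" "(vorticity v - vorticity w) * Rw"] by (simp add: mult.assoc)
  finally have "tau (z * (Rv - Rw)) = - ((\<i> * complex_of_real x) * (\<i> * (\<Sum>j\<in>UNIV. tau ((v $ j - w $ j) *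
      (Rw * z * Rv * sgen j - sgen j * (Rw * z * Rv))))))"
    by (simp only: tau_vorticity_diff mult_minus_left)
  moreover have "(\<i> * c) * (\<i> * d) = - (c * d)" for c d :: complex
    by (simp add: complex_eq_iff algebra_simps)
  moreover have "tau ((a - b) * c) = blinfun_apply (toL1 a - toL1 b) c" for a b c :: "'a scalg"
    by (simp add: blinfun.diff_left left_diff_distrib)
  ultimately show ?thesis by simp
qed

lemma norm_commutator_le:
  fixes R R' z s :: "'n scalg"
  assumes "norm R \<le> 1" "norm R' \<le> 1"
  shows "norm (R * z * R' * s - s * (R * z * R')) \<le> 2 * (norm z * norm s)"
proof -
  have "norm (R * z * R') \<le> (1 * norm z) * 1"
    using assms by (intro order_trans[OF norm_mult_ineq] mult_mono) auto
  then have n: "norm (R * z * R') \<le> norm z" by simp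
  have "norm (R * z * R' * s) \<le> norm z * norm s" "norm (s * (R * z * R')) \<le> norm s * norm z"
    by (rule order_trans[OF norm_mult_ineq]; intro mult_mono n; simp)+
  then show ?thesis
    using norm_triangle_ineq4[of "R * z * R' * s" "s * (R * z * R')"] by (simp add: mult.commute)
qed

text \<open>Only the \<open>L\<^sup>1\<close>-derivative of \<open>v\<close> is available and \<open>\<parallel>\<Omega>\<parallel>\<close> may be unbounded near \<open>t\<close>. The
  resolvents are contractions, hence converge weakly against \<open>L\<^sup>1\<close>, which suffices.\<close>

lemma resolvent_trace_derivative:
  fixes v :: "real \<Rightarrow> 'n::finite scalg ^ 'n" and x :: real
  assumes t: "t \<in> S" and sa: "\<And>s j. s \<in> S \<Longrightarrow> star (v s $ j) = v s $ j"
    and d: "\<And>j. ((\<lambda>s. toL1 (v s $ j)) has_vector_derivative D j) (at t within S)"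
    and L1: "\<And>j. D j \<in> L1"
  defines "R \<equiv> \<lambda>s. resolvent x (vorticity (v s))"
  shows "((\<lambda>s. tau (R s)) has_vector_derivative complex_of_real x *
    (\<Sum>j\<in>UNIV. blinfun_apply (D j) (R t * R t * sgen j - sgen j * (R t * R t)))) (at t within S)"
proof -
  \<comment> \<open>Off \<open>S\<close> the vorticity need not be self-adjoint; a constant value there keeps \<open>Q\<close> contractive.\<close>
  define Q where "Q s = (if s \<in> S then R s else R t)" for s
  have QR: "Q s = R s" if "s \<in> S" for s using that by (simp add: Q_def)
  have Qn: "norm (Q s) \<le> 1" for s
    using resolvent(4)[OF star_vorticity[OF sa]] t by (auto simp: Q_def R_def)
  define f where "f j s = toL1 (v s $ j) - toL1 (v t $ j)" for j s
  have fd: "(f j has_vector_derivative D j) (at t within S)" for j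
    unfolding f_def[abs_def] using has_vector_derivative_diff[OF d has_vector_derivative_const] by simp
  have f0: "f j t = 0" for j by (simp add: f_def)
  have flim: "(f j \<longlongrightarrow> 0) (at t within S)" for j
    using has_vector_derivative_continuous[OF fd, of j] by (simp add: continuous_within f0)
  define C where "C z j s = Q t * z * Q s * sgen j - sgen j * (Q t * z * Q s)" for z j s
  have Cn: "norm (C z j s) \<le> 2 * (norm z * norm (sgen j :: 'n scalg))" for z j s
    unfolding C_def by (rule norm_commutator_le[OF Qn Qn])
  have diff: "tau (z * (Q s - Q t)) = complex_of_real x * (\<Sum>j\<in>UNIV. blinfun_apply (f j s) (C z j s))"
    if "s \<in> S" for s z
    using tau_resolvent_diff[of "v s" "v t" z x] sa[OF that] sa[OF t]
    by (simp add: QR[OF that] QR[OF t] R_def f_def C_def)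
  have weak: "((\<lambda>s. tau (z * (Q s - Q t))) \<longlongrightarrow> 0) (at t within S)" for z
  proof (rule Lim_transform_eventually)
    show "((\<lambda>s. complex_of_real x * (\<Sum>j\<in>UNIV. blinfun_apply (f j s) (C z j s))) \<longlongrightarrow> 0) (at t within S)"
    proof -
      have "((\<lambda>s. blinfun_apply (f j s) (C z j s)) \<longlongrightarrow> 0) (at t within S)" for j
      proof (rule Lim_null_comparison)
        show "eventually (\<lambda>s. norm (blinfun_apply (f j s) (C z j s)) \<le>
            norm (f j s) * (2 * (norm z * norm (sgen j :: 'n scalg)))) (at t within S)"
          by (intro always_eventually allI order_trans[OF norm_blinfun] mult_left_mono Cn) auto
        show "((\<lambda>s. norm (f j s) * (2 * (norm z * norm (sgen j :: 'n scalg)))) \<longlongrightarrow> 0) (at t within S)"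
          using flim[of j] by (intro tendsto_mult_left_zero tendsto_norm_zero)
      qed
      then have "((\<lambda>s. complex_of_real x * (\<Sum>j\<in>UNIV. blinfun_apply (f j s) (C z j s))) \<longlongrightarrow>
          complex_of_real x * (\<Sum>j\<in>(UNIV :: 'n set). 0)) (at t within S)"
        by (intro tendsto_intros)
      then show ?thesis by simp
    qed
    show "eventually (\<lambda>s. complex_of_real x * (\<Sum>j\<in>UNIV. blinfun_apply (f j s) (C z j s)) = tau (z * (Q s - Q t)))
        (at t within S)"
      unfolding eventually_at_filter by (intro always_eventually) (auto simp: diff)
  qed
  have Dlim: "((\<lambda>s. blinfun_apply (D j) (C 1 j s)) \<longlongrightarrow> blinfun_apply (D j) (C 1 j t)) (at t within S)" for j
  proof (rule LIM_zero_cancel)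
    have "((\<lambda>s. blinfun_apply (D j) (C 1 j s - C 1 j t)) \<longlongrightarrow> 0) (at t within S)"
    proof (rule L1_tendsto[OF L1])
      show "norm (C 1 j s - C 1 j t) \<le> 2 * norm (sgen j :: 'n scalg) + 2 * norm (sgen j :: 'n scalg)" for s
        using Cn[of 1 j s] Cn[of 1 j t] norm_triangle_ineq4[of "C 1 j s" "C 1 j t"] by simp
      fix y
      let ?z = "(sgen j * y - y * sgen j) * Q t"
      have "tau (y * (C 1 j s - C 1 j t)) = tau (?z * (Q s - Q t))" for s
      proof -
        let ?d = "Q t * (Q s - Q t)"
        have "C 1 j s - C 1 j t = ?d * sgen j - sgen j * ?d"
          by (simp add: C_def algebra_simps)
        then have "tau (y * (C 1 j s - C 1 j t)) = tau ((y * ?d) * sgen j) - tau (y * sgen j * ?d)"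
          by (simp only: right_diff_distrib[of y] tau_simps mult.assoc)
        also have "tau ((y * ?d) * sgen j) = tau (sgen j * y * ?d)"
          using tau_commute[of "y * ?d" "sgen j"] by (simp add: mult.assoc)
        also have "tau (sgen j * y * ?d) - tau (y * sgen j * ?d) = tau (?z * (Q s - Q t))"
          by (simp add: left_diff_distrib mult.assoc)
        finally show ?thesis .
      qed
      then show "((\<lambda>s. tau (y * (C 1 j s - C 1 j t))) \<longlongrightarrow> 0) (at t within S)"
        using weak[of ?z] by simp
    qed
    then show "((\<lambda>s. blinfun_apply (D j) (C 1 j s) - blinfun_apply (D j) (C 1 j t)) \<longlongrightarrow> 0) (at t within S)"
      by (simp add: blinfun.diff_right)
  qed
  have "((\<lambda>s. blinfun_apply (f j s) (C 1 j s)) has_vector_derivative blinfun_apply (D j) (C 1 j t)) (at t within S)" for j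
    by (rule paired_has_vector_derivative[OF fd f0 Cn Dlim])
  then have der: "((\<lambda>s. tau (R t) + complex_of_real x * (\<Sum>j\<in>UNIV. blinfun_apply (f j s) (C 1 j s))) has_vector_derivative
      0 + complex_of_real x * (\<Sum>j\<in>UNIV. blinfun_apply (D j) (C 1 j t))) (at t within S)"
    by (intro has_vector_derivative_add has_vector_derivative_const has_vector_derivative_mult_right
        has_vector_derivative_sum)
  have "tau (R s) = tau (R t) + complex_of_real x * (\<Sum>j\<in>UNIV. blinfun_apply (f j s) (C 1 j s))"
    if s: "s \<in> S" for s
  proof -
    have eq: "tau (R s) - tau (R t) = complex_of_real x * (\<Sum>j\<in>UNIV. blinfun_apply (f j s) (C 1 j s))"
      using diff[OF s, of 1] by (simp add: QR[OF s] QR[OF t])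
    then show ?thesis by (simp flip: eq)
  qed
  from has_vector_derivative_transform[OF t this der] have "((\<lambda>s. tau (R s)) has_vector_derivative
      0 + complex_of_real x * (\<Sum>j\<in>UNIV. blinfun_apply (D j) (C 1 j t))) (at t within S)" .
  then show ?thesis by (simp add: C_def QR[OF t])
qed

lemma functional_power_closure_0:
  fixes D :: "'n::finite \<Rightarrow> 'n dual"
  assumes L1: "\<And>j. D j \<in> L1"
    and pow: "\<And>k. (\<Sum>j\<in>UNIV. blinfun_apply (D j) (a ^ k * sgen j - sgen j * a ^ k)) = 0"
    and c: "c \<in> power_closure a"
  shows "(\<Sum>j\<in>UNIV. blinfun_apply (D j) (c * sgen j - sgen j * c)) = 0"
proof -
  let ?G = "\<lambda>c. \<Sum>j\<in>UNIV. blinfun_apply (D j) (c * sgen j - sgen j * c)"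
  have "?G p = 0" if "power_span a p" for p
    using that
  proof (induction rule: power_span.induct)
    case (plus p c k)
    have "?G (p + c *\<^sub>C a ^ k) = ?G p + c * ?G (a ^ k)"
      unfolding sum.distrib[symmetric] sum_distrib_left
      by (intro sum.cong refl) (simp add: distrib_left distrib_right blinfun.bilinear_simps L1_scaleC[OF L1] right_diff_distrib)
    then show ?case using plus.IH pow by simp
  qed simp
  moreover obtain f where f: "\<And>n. power_span a (f n)" "f \<longlonglongrightarrow> c"
    using c unfolding power_closure_def closure_sequential by auto
  ultimately have "(\<lambda>n. ?G (f n)) = (\<lambda>n. 0)" by auto
  moreover have "(\<lambda>n. ?G (f n)) \<longlonglongrightarrow> ?G c" by (intro tendsto_intros f(2))
  ultimately show ?thesis by (simp add: LIMSEQ_const_iff)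
qed

section \<open>Conservation of the moments of the vorticity\<close>

theorem mainTheorem2:
  fixes T :: real
    and v :: "real \<Rightarrow> 'n::finite scalg ^ 'n"
    and v' q :: "real \<Rightarrow> 'n dual ^ 'n"
  assumes "T > 0"
    and v_smooth: "\<And>t k. t \<in> {0..<T} \<Longrightarrow> v t $ k \<in> C_infty_1_sa"
    and v_div_free: "\<And>t. t \<in> {0..<T} \<Longrightarrow> vec_toL1 (v t) \<in> Vect_L1_sa_tau"
    and v_deriv: "\<And>t. t \<in> {0..<T} \<Longrightarrow>
      ((\<lambda>t. vec_toL1 (v t)) has_vector_derivative v' t) (at t within {0..<T})"
    and euler: "\<And>t. t \<in> {0..<T} \<Longrightarrow> - v' t = (\<chi> k. deriv_along (v t) (v t $ k)) + q t"
    and q_sa: "\<And>t k. t \<in> {0..<T} \<Longrightarrow> q t $ k \<in> L1_sa"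
    and q_cont: "continuous_on {0..<T} q"
    and q_pressure: "\<And>t k. t \<in> {0..<T} \<Longrightarrow> Piproj k (q t) = 0"
  shows "\<forall>m::nat. m > 0 \<longrightarrow> (\<lambda>t. tau (vorticity (v t) ^ m)) constant_on {0..<T}"
proof -
  let ?S = "{0..<T}"
  have C: "v t $ k \<in> C_infty_1" and sa: "star (v t $ k) = v t $ k" if "t \<in> ?S" for t k
    using v_smooth[OF that] by (auto simp: C_infty_1_sa_def)
  have div: "div_free (vec_toL1 (v t))" if "t \<in> ?S" for t
    using v_div_free[OF that] by (simp add: Vect_L1_sa_tau_def Vect_L1_tau_def)
  have qL1: "q t $ j \<in> L1" if "t \<in> ?S" for t j using q_sa[OF that] by (simp add: L1_sa_def)
  have v'j: "v' t $ j = - (deriv_along (v t) (v t $ j) + q t $ j)" if "t \<in> ?S" for t j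
  proof -
    have "(- v' t) $ j = deriv_along (v t) (v t $ j) + q t $ j" unfolding euler[OF that] by simp
    then show ?thesis by (metis add.inverse_inverse uminus_vec_def vector_uminus_component)
  qed
  have v'L1: "v' t $ j \<in> L1" if "t \<in> ?S" for t j
    unfolding v'j[OF that]
    by (intro subspace_neg[OF L1_subspace] subspace_add[OF L1_subspace] qL1[OF that]
        deriv_along_apply(1) C_infty_1_smooth C[OF that])
  have zero: "(\<Sum>j\<in>UNIV. blinfun_apply (v' t $ j) (c * sgen j - sgen j * c)) = 0"
    if t: "t \<in> ?S" and c: "c \<in> power_closure (vorticity (v t))" for t c
  proof (rule functional_power_closure_0[OF v'L1[OF t] _ c])
    fix k
    let ?c = "vorticity (v t) ^ k"
    have "(\<Sum>j\<in>UNIV. blinfun_apply (v' t $ j) (?c * sgen j - sgen j * ?c)) =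
        - ((\<Sum>j\<in>UNIV. deriv_fun (v t) (v t $ j) (?c * sgen j - sgen j * ?c))
          + (\<Sum>j\<in>UNIV. blinfun_apply (q t $ j) (?c * sgen j - sgen j * ?c)))"
      unfolding sum.distrib[symmetric] sum_negf[symmetric]
      by (intro sum.cong refl)
        (simp only: v'j[OF t] blinfun.minus_left blinfun.add_left
          deriv_along_apply(2)[OF C_infty_1_smooth[OF C[OF t]]])
    also have "\<dots> = 0"
      using advection_vorticity_power[OF C[OF t] div[OF t]]
        pressure_commutator[OF qL1[OF t] q_pressure[OF t] vorticity_power_approx[OF C[OF t]]] by simp
    finally show "(\<Sum>j\<in>UNIV. blinfun_apply (v' t $ j) (?c * sgen j - sgen j * ?c)) = 0" .
  qed
  have const: "\<exists>c. \<forall>t\<in>?S. tau (resolvent x (vorticity (v t))) = c" for x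
  proof -
    have "((\<lambda>s. tau (resolvent x (vorticity (v s)))) has_vector_derivative 0) (at t within ?S)"
      if t: "t \<in> ?S" for t
    proof -
      let ?R = "resolvent x (vorticity (v t))"
      have "((\<lambda>s. toL1 (v s $ j)) has_vector_derivative v' t $ j) (at t within ?S)" for j
        using bounded_linear.has_vector_derivative[OF bounded_linear_vec_nth v_deriv[OF t], of j]
        by (simp add: vec_toL1_def)
      note d = resolvent_trace_derivative[OF t sa this v'L1[OF t], of x]
      have "?R \<in> power_closure (vorticity (v t))"
        by (rule resolvent(1)[OF star_vorticity[OF sa[OF t]]])
      then have "?R * ?R \<in> power_closure (vorticity (v t))" by (intro power_closure_mult)
      from zero[OF t this] d show ?thesis by simp
    qed
    then show ?thesis
      by (rule has_vector_derivative_zero_constant[rotated]) auto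
  qed
  have "tau (vorticity (v s) ^ m) = tau (vorticity (v t) ^ m)" if "s \<in> ?S" "t \<in> ?S" for s t m
  proof (rule moments_eq)
    show "star (vorticity (v s)) = vorticity (v s)" "star (vorticity (v t)) = vorticity (v t)"
      by (intro star_vorticity sa that)+
    show "tau (resolvent x (vorticity (v s))) = tau (resolvent x (vorticity (v t)))" for x
      using const[of x] that by metis
  qed
  then show ?thesis unfolding constant_on_def by metis
qed

end
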